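(* Let $\Omega$ be a bounded regular domain of an oriented Riemannian manifold $(M,g)$ and let $\Omega_\varepsilon=f_\varepsilon(\Omega)$ be a deformation of $\Omega$. Let $\phi_\varepsilon\in\mathcal C^\infty(\Omega_\varepsilon)$ and $\Lambda_\varepsilon\in\mathbb R$ be two differentiable curves such that, for all $\varepsilon$, $\|\phi_\varepsilon\|_{L^2(\Omega_\varepsilon,g)}=1$ and $$\Delta\phi_\varepsilon=\Lambda_\varepsilon\phi_\varepsilon\ \text{ in }\Omega_\varepsilon,\qquad \phi_\varepsilon=0\ \text{ on }\partial\Omega_\varepsilon .$$ Then $$\frac{d}{d\varepsilon}\Lambda_\varepsilon\Big|_{\varepsilon=0}=-\int_{\partial\Omega}v\left(\frac{\partial\phi}{\partial\nu}\right)^2v_{\bar g},$$ where $\phi=\phi_0$ and $v=g\left(\frac{d}{d\varepsilon}f_\varepsilon\big|_{\varepsilon=0},\nu\right)$ is the normal component of the variation vector field of the deformation $\Omega_\varepsilon$.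
   Context: A bounded regular domain is a connected open set with compact closure and nonempty smooth boundary; $\nu$ is the outward unit normal on $\partial\Omega$, $\bar g$ is the metric induced by $g$ on $\partial\Omega$ and $v_{\bar g}$ its volume element. $\Delta=\Delta_g$ is the nonnegative Laplacian ($\Delta=-\mathrm{div}\,\nabla$). A deformation $\Omega_\varepsilon=f_\varepsilon(\Omega)$ is given by a smooth 1-parameter family of diffeomorphisms $f_\varepsilon:\Omega\to\Omega_\varepsilon$ (up to the boundary) with $f_\varepsilon(\partial\Omega)=\partial\Omega_\varepsilon$ and $f_0=\mathrm{Id}$. A family $\phi_\varepsilon\in\mathcal C^\infty(\Omega_\varepsilon)$ (functions smooth up to the boundary) is called differentiable in $\varepsilon$ if the family $\phi_\varepsilon\circ f_\varepsilon\in\mathcal C^\infty(\Omega)$ is. *)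

theory Defs
  imports "HOL-Analysis.Analysis"
begin

section \<open>Smooth maps between Euclidean spaces\<close>

primrec dirs_deriv ::
  "'a::real_normed_vector list \<Rightarrow> ('a \<Rightarrow> 'b::real_normed_vector) \<Rightarrow> 'a \<Rightarrow> 'b" where
  "dirs_deriv [] f = f"
| "dirs_deriv (v # vs) f = (\<lambda>x. frechet_derivative (dirs_deriv vs f) (at x) v)"

text \<open>\<open>C\<^sup>\<infinity>\<close> on an open set: all iterated directional derivatives exist and are (Frechet)
  differentiable, hence continuous. Only meant for open \<open>S\<close>.\<close>

definition smooth_on ::
  "'a::real_normed_vector set \<Rightarrow> ('a \<Rightarrow> 'b::real_normed_vector) \<Rightarrow> bool" where
  "smooth_on S f \<longleftrightarrow> (\<forall>vs. \<forall>x\<in>S. dirs_deriv vs f differentiable (at x))"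

definition partial :: "'n::finite \<Rightarrow> (real^'n \<Rightarrow> real) \<Rightarrow> real^'n \<Rightarrow> real" where
  "partial i h x = frechet_derivative h (at x) (axis i 1)"


section \<open>Smooth manifolds\<close>

text \<open>The manifold \<open>M\<close> is the universe of a Hausdorff, second countable type \<open>'m\<close>; its dimension
  is \<open>CARD('n)\<close>. A chart is a domain together with a coordinate map, whose values outside the
  domain are irrelevant.\<close>

type_synonym ('m, 'n) chart = "'m set \<times> ('m \<Rightarrow> real^'n)"

abbreviation cdom :: "('m, 'n::finite) chart \<Rightarrow> 'm set" where
  "cdom c \<equiv> fst c"

abbreviation cmap :: "('m, 'n::finite) chart \<Rightarrow> 'm \<Rightarrow> real^'n" where
  "cmap c \<equiv> snd c"

abbreviation cinv :: "('m, 'n::finite) chart \<Rightarrow> real^'n \<Rightarrow> 'm" where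
  "cinv c \<equiv> inv_into (cdom c) (cmap c)"

abbreviation crange :: "('m, 'n::finite) chart \<Rightarrow> (real^'n) set" where
  "crange c \<equiv> cmap c ` cdom c"

definition topological_chart ::
  "('m::{t2_space,second_countable_topology}, 'n::finite) chart \<Rightarrow> bool" where
  "topological_chart c \<longleftrightarrow>
     open (cdom c) \<and> open (crange c) \<and> homeomorphism (cdom c) (crange c) (cmap c) (cinv c)"

definition transition :: "('m, 'n::finite) chart \<Rightarrow> ('m, 'n) chart \<Rightarrow> real^'n \<Rightarrow> real^'n" where
  "transition c c' = (\<lambda>x. cmap c' (cinv c x))"

definition jacobian :: "('m, 'n::finite) chart \<Rightarrow> ('m, 'n) chart \<Rightarrow> real^'n \<Rightarrow> real^'n^'n" where
  "jacobian c c' x = matrix (frechet_derivative (transition c c') (at x))"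

definition compatible :: "('m, 'n::finite) chart \<Rightarrow> ('m, 'n) chart \<Rightarrow> bool" where
  "compatible c c' \<longleftrightarrow>
     smooth_on (cmap c ` (cdom c \<inter> cdom c')) (transition c c') \<and>
     smooth_on (cmap c' ` (cdom c \<inter> cdom c')) (transition c' c)"

text \<open>A smooth structure is a maximal smooth atlas.\<close>

definition smooth_structure ::
  "('m::{t2_space,second_countable_topology}, 'n::finite) chart set \<Rightarrow> bool" where
  "smooth_structure A \<longleftrightarrow>
     (\<forall>c\<in>A. topological_chart c) \<and> (\<Union>c\<in>A. cdom c) = UNIV \<and>
     (\<forall>c\<in>A. \<forall>c'\<in>A. compatible c c') \<and>
     (\<forall>c. topological_chart c \<and> (\<forall>c'\<in>A. compatible c c') \<longrightarrow> c \<in> A)"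

definition orientation :: "('m, 'n::finite) chart set \<Rightarrow> ('m, 'n) chart set \<Rightarrow> bool" where
  "orientation A Or \<longleftrightarrow>
     Or \<subseteq> A \<and> (\<Union>c\<in>Or. cdom c) = UNIV \<and>
     (\<forall>c\<in>Or. \<forall>c'\<in>Or. \<forall>x\<in>cmap c ` (cdom c \<inter> cdom c'). det (jacobian c c' x) > 0)"

text \<open>An arbitrary chart at \<open>p\<close>, in which to evaluate quantities that do not depend on the chart.\<close>

definition chart_at :: "('m, 'n::finite) chart set \<Rightarrow> 'm \<Rightarrow> ('m, 'n) chart" where
  "chart_at A p = (SOME c. c \<in> A \<and> p \<in> cdom c)"

text \<open>Smoothness on an arbitrary subset \<open>S\<close> of the manifold means existence of local smooth
  extensions; on the closure of a regular domain this is smoothness up to the boundary.\<close>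

definition smooth_fun_on :: "('m, 'n::finite) chart set \<Rightarrow> 'm set \<Rightarrow> ('m \<Rightarrow> real) \<Rightarrow> bool" where
  "smooth_fun_on A S u \<longleftrightarrow>
     (\<forall>p\<in>S. \<exists>c\<in>A. p \<in> cdom c \<and>
       (\<exists>W F. open W \<and> cmap c p \<in> W \<and> smooth_on W F \<and>
         (\<forall>x\<in>W \<inter> crange c. cinv c x \<in> S \<longrightarrow> F x = u (cinv c x))))"

text \<open>Joint smoothness of \<open>(\<epsilon>, p) \<mapsto> f \<epsilon> p\<close> on \<open>I \<times> S\<close>.\<close>

definition smooth_family_on ::
  "('m, 'n::finite) chart set \<Rightarrow> real set \<Rightarrow> 'm set \<Rightarrow> (real \<Rightarrow> 'm \<Rightarrow> 'm) \<Rightarrow> bool" where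
  "smooth_family_on A I S f \<longleftrightarrow>
     (\<forall>\<epsilon>\<in>I. \<forall>p\<in>S. \<exists>c\<in>A. \<exists>c'\<in>A. p \<in> cdom c \<and> f \<epsilon> p \<in> cdom c' \<and>
       (\<exists>W F. open W \<and> (\<epsilon>, cmap c p) \<in> W \<and> smooth_on W F \<and>
         (\<forall>(s, x)\<in>W. s \<in> I \<and> x \<in> crange c \<and> cinv c x \<in> S \<longrightarrow>
            f s (cinv c x) \<in> cdom c' \<and> F (s, x) = cmap c' (f s (cinv c x)))))"

definition smooth_map_on :: "('m, 'n::finite) chart set \<Rightarrow> 'm set \<Rightarrow> ('m \<Rightarrow> 'm) \<Rightarrow> bool" where
  "smooth_map_on A S h \<longleftrightarrow>
     (\<forall>p\<in>S. \<exists>c\<in>A. \<exists>c'\<in>A. p \<in> cdom c \<and> h p \<in> cdom c' \<and>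
       (\<exists>W F. open W \<and> cmap c p \<in> W \<and> smooth_on W F \<and>
         (\<forall>x\<in>W \<inter> crange c. cinv c x \<in> S \<longrightarrow>
            h (cinv c x) \<in> cdom c' \<and> F x = cmap c' (h (cinv c x)))))"


section \<open>Riemannian metrics, volume and Laplacian\<close>

text \<open>A metric is given by its component matrices: \<open>g c x $ i $ j\<close> is \<open>g(\<partial>\<^sub>i, \<partial>\<^sub>j)\<close> in the chart \<open>c\<close>,
  as a function of the coordinates \<open>x\<close>. The last conjunct is the tensor transformation law.\<close>

definition riemannian_metric ::
  "('m, 'n::finite) chart set \<Rightarrow> (('m, 'n) chart \<Rightarrow> real^'n \<Rightarrow> real^'n^'n) \<Rightarrow> bool" where
  "riemannian_metric A g \<longleftrightarrow>
     (\<forall>c\<in>A.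
        (\<forall>i j. smooth_on (crange c) (\<lambda>x. g c x $ i $ j)) \<and>
        (\<forall>x\<in>crange c. transpose (g c x) = g c x \<and> (\<forall>w. w \<noteq> 0 \<longrightarrow> w \<bullet> (g c x *v w) > 0)) \<and>
        (\<forall>c'\<in>A. \<forall>x\<in>cmap c ` (cdom c \<inter> cdom c').
           g c x = transpose (jacobian c c' x) ** g c' (transition c c' x) ** jacobian c c' x))"

text \<open>The Borel measure that is \<open>sqrt (det (g\<^sub>i\<^sub>j)) dx\<close> in every chart.\<close>

definition riemannian_volume ::
  "('m::{t2_space,second_countable_topology}, 'n::finite) chart set \<Rightarrow>
   (('m, 'n) chart \<Rightarrow> real^'n \<Rightarrow> real^'n^'n) \<Rightarrow> 'm measure" where
  "riemannian_volume A g = (THE \<mu>. sets \<mu> = sets borel \<and>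
     (\<forall>c\<in>A. \<forall>B\<in>sets borel. B \<subseteq> cdom c \<longrightarrow>
        emeasure \<mu> B = (\<integral>\<^sup>+x\<in>cmap c ` B. ennreal (sqrt (det (g c x))) \<partial>lborel)))"

text \<open>Gradient and divergence in the coordinates of \<open>c\<close>: \<open>(\<nabla>u)\<^sup>i = \<Sum>\<^sub>j g\<^sup>i\<^sup>j \<partial>\<^sub>j u\<close> and
  \<open>div X = (det g) powr (-1/2) \<Sum>\<^sub>i \<partial>\<^sub>i (sqrt (det g) X\<^sup>i)\<close>. The Laplacian is the nonnegative one;
  its value at \<open>p\<close> is the same for all charts \<open>c\<close> at \<open>p\<close>.\<close>

definition gradient ::
  "(('m, 'n::finite) chart \<Rightarrow> real^'n \<Rightarrow> real^'n^'n) \<Rightarrow> ('m, 'n) chart \<Rightarrow> ('m \<Rightarrow> real) \<Rightarrow>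
   real^'n \<Rightarrow> real^'n" where
  "gradient g c u x = matrix_inv (g c x) *v (\<chi> i. partial i (\<lambda>y. u (cinv c y)) x)"

definition divergence ::
  "(('m, 'n::finite) chart \<Rightarrow> real^'n \<Rightarrow> real^'n^'n) \<Rightarrow> ('m, 'n) chart \<Rightarrow> (real^'n \<Rightarrow> real^'n) \<Rightarrow>
   real^'n \<Rightarrow> real" where
  "divergence g c X x =
     (\<Sum>i\<in>UNIV. partial i (\<lambda>y. sqrt (det (g c y)) * X y $ i) x) / sqrt (det (g c x))"

definition laplacian ::
  "(('m, 'n::finite) chart \<Rightarrow> real^'n \<Rightarrow> real^'n^'n) \<Rightarrow> ('m, 'n) chart \<Rightarrow> ('m \<Rightarrow> real) \<Rightarrow>
   'm \<Rightarrow> real" where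
  "laplacian g c u p = - divergence g c (gradient g c u) (cmap c p)"

definition L2_norm_on :: "'m measure \<Rightarrow> 'm set \<Rightarrow> ('m \<Rightarrow> real) \<Rightarrow> real" where
  "L2_norm_on \<mu> S u = sqrt (LINT p:S|\<mu>. (u p)\<^sup>2)"


section \<open>Regular domains and their boundary\<close>

definition boundary_chart ::
  "('m, 'n::finite) chart set \<Rightarrow> 'm set \<Rightarrow> ('m, 'n) chart \<Rightarrow> 'n \<Rightarrow> bool" where
  "boundary_chart A \<Omega> c k \<longleftrightarrow> c \<in> A \<and> \<Omega> \<inter> cdom c = {p \<in> cdom c. cmap c p $ k < 0}"

text \<open>The boundary is smooth in the sense that \<open>\<Omega>\<close> is locally a half space, so that \<open>\<Omega>\<close> lies on
  one side of its boundary and \<open>frontier \<Omega>\<close> is \<open>{x\<^sub>k = 0}\<close> in a boundary chart.\<close>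

definition bounded_regular_domain ::
  "('m::{t2_space,second_countable_topology}, 'n::finite) chart set \<Rightarrow> 'm set \<Rightarrow> bool" where
  "bounded_regular_domain A \<Omega> \<longleftrightarrow>
     open \<Omega> \<and> connected \<Omega> \<and> compact (closure \<Omega>) \<and> frontier \<Omega> \<noteq> {} \<and>
     (\<forall>p\<in>frontier \<Omega>. \<exists>c k. boundary_chart A \<Omega> c k \<and> p \<in> cdom c)"

text \<open>The volume element of the metric induced on \<open>frontier \<Omega>\<close>. In a boundary chart the coordinates
  of the boundary are \<open>(x\<^sub>i)\<^bsub>i \<noteq> k\<^esub>\<close>, inserted into the hyperplane \<open>x\<^sub>k = 0\<close> by \<open>insert_zero\<close>; the
  components of the induced metric are \<open>g\<^sub>i\<^sub>j\<close> with \<open>i, j \<noteq> k\<close>, padded in \<open>induced_gram\<close> to a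
  matrix with the same determinant. In dimension one the product over the empty index set is a
  point mass, so one gets the counting measure on the boundary points.\<close>

definition insert_zero :: "'n::finite \<Rightarrow> ('n \<Rightarrow> real) \<Rightarrow> real^'n" where
  "insert_zero k y = (\<chi> i. if i = k then 0 else y i)"

definition induced_gram :: "'n::finite \<Rightarrow> real^'n^'n \<Rightarrow> real^'n^'n" where
  "induced_gram k G = (\<chi> i j. if i = k \<or> j = k then (if i = j then 1 else 0) else G $ i $ j)"

definition boundary_volume ::
  "('m::{t2_space,second_countable_topology}, 'n::finite) chart set \<Rightarrow>
   (('m, 'n) chart \<Rightarrow> real^'n \<Rightarrow> real^'n^'n) \<Rightarrow> 'm set \<Rightarrow> 'm measure" where
  "boundary_volume A g \<Omega> = (THE \<sigma>. sets \<sigma> = sets borel \<and> emeasure \<sigma> (- frontier \<Omega>) = 0 \<and>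
     (\<forall>c k. boundary_chart A \<Omega> c k \<longrightarrow>
       (\<forall>B\<in>sets borel. B \<subseteq> cdom c \<inter> frontier \<Omega> \<longrightarrow>
         emeasure \<sigma> B =
           (\<integral>\<^sup>+y. ennreal (sqrt (det (induced_gram k (g c (insert_zero k y))))) *
                 indicator (cmap c ` B) (insert_zero k y)
              \<partial>(\<Pi>\<^sub>M i\<in>UNIV - {k}. lborel)))))"

text \<open>Tangent vectors of \<open>frontier \<Omega>\<close> at \<open>p\<close>, in components: velocities of curves in the boundary.\<close>

definition boundary_tangent :: "('m::topological_space, 'n::finite) chart \<Rightarrow> 'm set \<Rightarrow> 'm \<Rightarrow> (real^'n) set" where
  "boundary_tangent c \<Omega> p =
     {w. \<exists>\<gamma>. \<gamma> 0 = cmap c p \<and> (\<gamma> has_vector_derivative w) (at 0) \<and>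
          (\<forall>\<^sub>F t in at 0. \<gamma> t \<in> cmap c ` (cdom c \<inter> frontier \<Omega>))}"

text \<open>Components of \<open>\<nu>(p)\<close> in the chart \<open>c\<close>.\<close>

definition outward_normal ::
  "(('m::topological_space, 'n::finite) chart \<Rightarrow> real^'n \<Rightarrow> real^'n^'n) \<Rightarrow> ('m, 'n) chart \<Rightarrow>
   'm set \<Rightarrow> 'm \<Rightarrow> real^'n" where
  "outward_normal g c \<Omega> p = (THE \<nu>.
     \<nu> \<bullet> (g c (cmap c p) *v \<nu>) = 1 \<and>
     (\<forall>w\<in>boundary_tangent c \<Omega> p. \<nu> \<bullet> (g c (cmap c p) *v w) = 0) \<and>
     (\<forall>\<^sub>F t in at_right 0. cmap c p + t *\<^sub>R \<nu> \<notin> cmap c ` (cdom c \<inter> closure \<Omega>)))"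

text \<open>\<open>\<partial>u/\<partial>\<nu>\<close> as a one-sided derivative from inside \<open>\<Omega>\<close>, because the values of \<open>u\<close> outside
  \<open>closure \<Omega>\<close> are irrelevant.\<close>

definition normal_derivative ::
  "('m::topological_space, 'n::finite) chart set \<Rightarrow>
   (('m, 'n) chart \<Rightarrow> real^'n \<Rightarrow> real^'n^'n) \<Rightarrow> 'm set \<Rightarrow> ('m \<Rightarrow> real) \<Rightarrow> 'm \<Rightarrow> real" where
  "normal_derivative A g \<Omega> u p =
     (let c = chart_at A p in
      vector_derivative (\<lambda>t. u (cinv c (cmap c p + t *\<^sub>R outward_normal g c \<Omega> p))) (at_left 0))"


section \<open>Deformations\<close>

definition deformation ::
  "('m::{t2_space,second_countable_topology}, 'n::finite) chart set \<Rightarrow> real set \<Rightarrow> 'm set \<Rightarrow>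
   (real \<Rightarrow> 'm \<Rightarrow> 'm) \<Rightarrow> bool" where
  "deformation A I \<Omega> f \<longleftrightarrow>
     smooth_family_on A I (closure \<Omega>) f \<and>
     (\<forall>\<epsilon>\<in>I. inj_on (f \<epsilon>) (closure \<Omega>) \<and>
        smooth_map_on A (f \<epsilon> ` closure \<Omega>) (inv_into (closure \<Omega>) (f \<epsilon>)) \<and>
        f \<epsilon> ` frontier \<Omega> = frontier (f \<epsilon> ` \<Omega>)) \<and>
     (\<forall>p\<in>closure \<Omega>. f 0 p = p)"

definition normal_velocity ::
  "('m::topological_space, 'n::finite) chart set \<Rightarrow>
   (('m, 'n) chart \<Rightarrow> real^'n \<Rightarrow> real^'n^'n) \<Rightarrow> 'm set \<Rightarrow> (real \<Rightarrow> 'm \<Rightarrow> 'm) \<Rightarrow> 'm \<Rightarrow> real" where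
  "normal_velocity A g \<Omega> f p =
     (let c = chart_at A p in
      vector_derivative (\<lambda>\<epsilon>. cmap c (f \<epsilon> p)) (at 0) \<bullet>
        (g c (cmap c p) *v outward_normal g c \<Omega> p))"

text \<open>Differentiability of \<open>\<epsilon> \<mapsto> F \<epsilon>\<close> as a curve in the Frechet space \<open>C\<^sup>\<infinity>(closure \<Omega>)\<close>: the difference
  quotients converge to a function \<open>G\<close> of that space in its topology, that is, uniformly on the
  compact subsets of every chart together with all derivatives. Derivatives are taken in the open
  set \<open>\<Omega>\<close>, whose closure carries the same suprema.\<close>

definition differentiable_curve ::
  "('m::{t2_space,second_countable_topology}, 'n::finite) chart set \<Rightarrow> real set \<Rightarrow> 'm set \<Rightarrow>
   (real \<Rightarrow> 'm \<Rightarrow> real) \<Rightarrow> bool" where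
  "differentiable_curve A I \<Omega> F \<longleftrightarrow>
     (\<forall>\<epsilon>\<in>I. smooth_fun_on A (closure \<Omega>) (F \<epsilon>)) \<and>
     (\<forall>\<epsilon>\<in>I. \<exists>G. smooth_fun_on A (closure \<Omega>) G \<and>
        (\<forall>c\<in>A. \<forall>K vs. compact K \<and> K \<subseteq> crange c \<longrightarrow>
           uniform_limit (K \<inter> cmap c ` (cdom c \<inter> \<Omega>))
             (\<lambda>h. dirs_deriv vs (\<lambda>x. (F (\<epsilon> + h) (cinv c x) - F \<epsilon> (cinv c x)) / h - G (cinv c x)))
             (\<lambda>_. 0) (at 0)))"

end

theory Submission
  imports Defs
begin

text \<open>Let \<open>\<phi>'\<close> be the derivative of \<open>\<phi>\<^sub>\<epsilon>(p)\<close> at \<open>\<epsilon> = 0\<close> for fixed \<open>p \<in> \<Omega>\<close>. Differentiating the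
  eigenvalue equation gives \<open>\<Delta>\<phi>' = \<Lambda>\<phi>' + \<Lambda>'\<phi>\<close> in \<open>\<Omega>\<close>, and differentiating \<open>\<phi>\<^sub>\<epsilon> \<circ> f\<^sub>\<epsilon> = 0\<close> on \<open>\<partial>\<Omega>\<close> shows
  that \<open>\<phi>'\<close> extends to the boundary with the value \<open>- v \<partial>\<phi>/\<partial>\<nu>\<close>. Green's formula for \<open>\<phi>\<close> and \<open>\<phi>'\<close>
  then reads \<open>\<Lambda>' \<integral> \<phi>\<^sup>2 = \<integral>\<^bsub>\<partial>\<Omega>\<^esub> \<phi>' \<partial>\<phi>/\<partial>\<nu> = - \<integral>\<^bsub>\<partial>\<Omega>\<^esub> v (\<partial>\<phi>/\<partial>\<nu>)\<^sup>2\<close>, because \<open>\<phi>\<close> vanishes on \<open>\<partial>\<Omega>\<close>.\<close>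

section \<open>Functions of class \<open>C\<^sup>k\<close>\<close>

text \<open>The hypothesis on \<open>\<phi>\<close> controls the composites
  \<open>\<phi> \<epsilon> \<circ> f \<epsilon>\<close> on the fixed domain, while the equation is
  differentiated at fixed points of moving domains. Passing from one to the other means solving
  \<open>f h q = p\<close> for \<open>q\<close> with an error of order \<open>h\<close>, and yields
  \<open>\<phi>' = G - d\<phi>(V)\<close>, with \<open>G\<close> the derivative of the composites
  and \<open>V\<close> the velocity of \<open>f\<close>. This formula does three jobs:
  \<open>\<phi>'\<close> is smooth in \<Omega>, it extends across the boundary, and its boundary
  value is computable, since \<open>G\<close> vanishes there and \<open>d\<phi>(V)\<close> sees only
  the normal part of \<open>V\<close>. The functions are given on the closed domain only. Green's
  formula is therefore proved chart by chart for local extensions, in the density form with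
  \<open>sqrt (det g) g^ij \<partial>_j u\<close>, which reduces it to the fundamental theorem of
  calculus along coordinate lines. The two Riemannian measures are definite descriptions; they
  become usable only after existence and uniqueness have been derived from the change of variables
  formula.\<close>

primrec Ck_on :: "nat \<Rightarrow> 'a::euclidean_space set \<Rightarrow> ('a \<Rightarrow> 'b::euclidean_space) \<Rightarrow> bool" where
  "Ck_on 0 S f = continuous_on S f"
| "Ck_on (Suc k) S f = ((\<forall>x\<in>S. f differentiable at x) \<and>
     (\<forall>v. Ck_on k S (\<lambda>x. frechet_derivative f (at x) v)))"

lemma Ck_on_cong:
  assumes "open S" "\<And>x. x \<in> S \<Longrightarrow> f x = g x" "Ck_on k S f"
  shows "Ck_on k S g"
  using assms
proof (induction k arbitrary: f g)
  case 0
  then show ?case using continuous_on_cong by (metis Ck_on.simps(1))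
next
  case (Suc k)
  have d: "g differentiable at x" if "x \<in> S" for x
  proof -
    from Suc.prems(3) that have "f differentiable at x" by auto
    then obtain D where "(f has_derivative D) (at x)" by (auto simp: differentiable_def)
    then have "(g has_derivative D) (at x)"
      using has_derivative_transform_within_open Suc.prems(1,2) that by blast
    then show ?thesis by (auto simp: differentiable_def)
  qed
  have "Ck_on k S (\<lambda>x. frechet_derivative g (at x) v)" for v
  proof (rule Suc.IH[OF Suc.prems(1)])
    show "Ck_on k S (\<lambda>x. frechet_derivative f (at x) v)" using Suc.prems(3) by auto
    show "frechet_derivative f (at x) v = frechet_derivative g (at x) v" if "x \<in> S" for x
      using frechet_derivative_transform_within_open[of f x S g] Suc.prems that by auto
  qed
  with d show ?case by auto
qed

lemma Ck_on_subset: "Ck_on k S f \<Longrightarrow> T \<subseteq> S \<Longrightarrow> Ck_on k T f"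
  by (induction k arbitrary: f) (auto intro: continuous_on_subset)

lemma Ck_on_SucD: "Ck_on (Suc k) S f \<Longrightarrow> Ck_on k S f"
proof (induction k arbitrary: f)
  case 0
  then show ?case
    by (simp add: continuous_at_imp_continuous_on differentiable_imp_continuous_within)
qed auto

lemma Ck_on_mono: "Ck_on k S f \<Longrightarrow> j \<le> k \<Longrightarrow> Ck_on j S f"
  by (induction k arbitrary: j) (auto simp: le_Suc_eq simp del: Ck_on.simps(2) dest: Ck_on_SucD)

lemma Ck_on_continuous: "Ck_on k S f \<Longrightarrow> continuous_on S f"
  using Ck_on_mono[of k S f 0] by simp

lemma Ck_on_differentiable: "Ck_on k S f \<Longrightarrow> 0 < k \<Longrightarrow> x \<in> S \<Longrightarrow> f differentiable at x"
  by (cases k) auto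

lemma Ck_on_has_derivative:
  "Ck_on k S f \<Longrightarrow> 0 < k \<Longrightarrow> x \<in> S \<Longrightarrow> (f has_derivative frechet_derivative f (at x)) (at x)"
  using Ck_on_differentiable frechet_derivative_works by blast

lemma Ck_on_frechet: "Ck_on (Suc k) S f \<Longrightarrow> Ck_on k S (\<lambda>x. frechet_derivative f (at x) v)"
  by auto

text \<open>Any explicit formula \<open>D\<close> for the derivative may be used: on an open set
  derivatives are unique, so \<open>D x\<close> coincides with
  \<open>frechet_derivative f (at x)\<close>. Most closure rules below are this rule plus induction
  on \<open>k\<close>.\<close>

lemma Ck_on_SucI:
  assumes "open S" "\<And>x. x \<in> S \<Longrightarrow> (f has_derivative D x) (at x)" "\<And>v. Ck_on k S (\<lambda>x. D x v)"
  shows "Ck_on (Suc k) S f"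
proof -
  have "Ck_on k S (\<lambda>x. frechet_derivative f (at x) v)" for v
    using assms(1) _ assms(3)[of v]
  proof (rule Ck_on_cong)
    show "D x v = frechet_derivative f (at x) v" if "x \<in> S" for x
      using frechet_derivative_at[OF assms(2)[OF that]] by simp
  qed
  moreover have "\<forall>x\<in>S. f differentiable at x" using assms(2) by (auto simp: differentiable_def)
  ultimately show ?thesis by simp
qed

text \<open>Differentiability at a point depends on the germ only. Coordinate extensions and
  variation formulas are available only near each point, and this rule assembles them.\<close>

lemma Ck_on_local:
  assumes "\<And>x. x \<in> S \<Longrightarrow> \<exists>U. open U \<and> x \<in> U \<and> Ck_on k U f"
  shows "Ck_on k S f"
  using assms
proof (induction k arbitrary: f)
  case 0
  then show ?case 
    by (metis Ck_on.simps(1) continuous_at_imp_continuous_on continuous_on_eq_continuous_at)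
next
  case (Suc k)
  have "Ck_on k S (\<lambda>x. frechet_derivative f (at x) v)" for v
    using Suc.prems by (intro Suc.IH) force
  with Suc.prems show ?case by fastforce
qed

lemma Ck_on_const: "Ck_on k S (\<lambda>x. c)"
  by (induction k arbitrary: c) auto

lemma Ck_on_bounded_linear:
  assumes "bounded_linear f" shows "Ck_on k S f"
proof -
  have fd: "frechet_derivative f (at x) = f" for x
    using frechet_derivative_at[OF bounded_linear_imp_has_derivative[OF assms]] by simp
  show ?thesis
  proof (cases k)
    case 0 then show ?thesis using assms by (simp add: linear_continuous_on)
  next
    case (Suc j)
    then show ?thesis
      using assms by (simp add: fd Ck_on_const bounded_linear_imp_differentiable)
  qed
qed

lemma Ck_on_add:
  assumes "open S" shows "Ck_on k S f \<Longrightarrow> Ck_on k S g \<Longrightarrow> Ck_on k S (\<lambda>x. f x + g x)"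
proof (induction k arbitrary: f g)
  case 0 then show ?case by (simp add: continuous_on_add)
next
  case (Suc k)
  show ?case
  proof (rule Ck_on_SucI[OF assms])
    show "((\<lambda>x. f x + g x) has_derivative (\<lambda>v. frechet_derivative f (at x) v + frechet_derivative g (at x) v)) (at x)"
      if "x \<in> S" for x
      using Suc.prems that by (auto intro!: has_derivative_add simp: frechet_derivative_works[symmetric])
    show "Ck_on k S (\<lambda>x. frechet_derivative f (at x) v + frechet_derivative g (at x) v)" for v
      using Suc.prems by (intro Suc.IH) auto
  qed
qed

lemma Ck_on_bilinear:
  assumes "open S" and b: "bounded_bilinear h"
  shows "Ck_on k S f \<Longrightarrow> Ck_on k S g \<Longrightarrow> Ck_on k S (\<lambda>x. h (f x) (g x))"
proof (induction k arbitrary: f g)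
  case 0 then show ?case using bounded_bilinear.continuous_on[OF b] by simp
next
  case (Suc k)
  show ?case
  proof (rule Ck_on_SucI[OF assms(1)])
    show "((\<lambda>x. h (f x) (g x)) has_derivative
       (\<lambda>v. h (f x) (frechet_derivative g (at x) v) + h (frechet_derivative f (at x) v) (g x))) (at x)"
      if "x \<in> S" for x
      using Suc.prems that
      by (auto intro!: bounded_bilinear.FDERIV[OF b] simp: frechet_derivative_works[symmetric])
    show "Ck_on k S (\<lambda>x. h (f x) (frechet_derivative g (at x) v) + h (frechet_derivative f (at x) v) (g x))" for v
      using Suc.prems by (intro Ck_on_add assms Suc.IH Ck_on_SucD[of k S f] Ck_on_SucD[of k S g] Ck_on_frechet)
  qed
qed

lemmas Ck_on_scaleR = Ck_on_bilinear[OF _ bounded_bilinear_scaleR]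
lemmas Ck_on_inner = Ck_on_bilinear[OF _ bounded_bilinear_inner]

lemma Ck_on_mult:
  fixes f g :: "'a::euclidean_space \<Rightarrow> real"
  shows "open S \<Longrightarrow> Ck_on k S f \<Longrightarrow> Ck_on k S g \<Longrightarrow> Ck_on k S (\<lambda>x. f x * g x)"
  using Ck_on_bilinear[OF _ bounded_bilinear_mult] .

lemma Ck_on_minus: "open S \<Longrightarrow> Ck_on k S f \<Longrightarrow> Ck_on k S (\<lambda>x. - f x)"
  using Ck_on_scaleR[of S k "\<lambda>x. -1" f] Ck_on_const[of k S "-1::real"] by simp

lemma Ck_on_diff: "open S \<Longrightarrow> Ck_on k S f \<Longrightarrow> Ck_on k S g \<Longrightarrow> Ck_on k S (\<lambda>x. f x - g x)"
  using Ck_on_add[of S k f "\<lambda>x. - g x"] Ck_on_minus[of S k g] by simp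

lemma Ck_on_sum: "open S \<Longrightarrow> (\<And>i. i \<in> J \<Longrightarrow> Ck_on k S (f i)) \<Longrightarrow> Ck_on k S (\<lambda>x. \<Sum>i\<in>J. f i x)"
  by (induction J rule: infinite_finite_induct) (auto intro: Ck_on_const Ck_on_add)

lemma Ck_on_prod:
  fixes f :: "'i \<Rightarrow> 'a::euclidean_space \<Rightarrow> real"
  shows "open S \<Longrightarrow> (\<And>i. i \<in> J \<Longrightarrow> Ck_on k S (f i)) \<Longrightarrow> Ck_on k S (\<lambda>x. \<Prod>i\<in>J. f i x)"
  by (induction J rule: infinite_finite_induct) (auto intro: Ck_on_const Ck_on_mult)

lemma Ck_on_component:
  fixes f :: "'a::euclidean_space \<Rightarrow> real^'n"
  shows "open S \<Longrightarrow> Ck_on k S f \<Longrightarrow> Ck_on k S (\<lambda>x. f x $ i)"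
  using Ck_on_inner[of S k f "\<lambda>x. axis i 1"] Ck_on_const[of k S "axis i (1::real)"]
  by (simp add: inner_axis)

lemma linear_Basis_expansion:
  fixes f :: "'a::euclidean_space \<Rightarrow> 'b::real_vector"
  assumes "linear f" shows "f v = (\<Sum>b\<in>Basis. (v \<bullet> b) *\<^sub>R f b)"
proof -
  have "f v = f (\<Sum>b\<in>Basis. (v \<bullet> b) *\<^sub>R b)" by (simp only: euclidean_representation)
  also have "\<dots> = (\<Sum>b\<in>Basis. (v \<bullet> b) *\<^sub>R f b)"
    using assms by (simp only: linear_sum linear_scale)
  finally show ?thesis .
qed

text \<open>The direction may vary with the point: expanding it in \<open>Basis\<close> leaves
  finitely many derivatives in fixed directions, with \<open>C^k\<close> coefficients. This is used
  for \<open>d\<phi>(V)\<close> with a velocity field \<open>V\<close>.\<close>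

lemma Ck_on_frechet':
  assumes S: "open S" and f: "Ck_on (Suc k) S f" and V: "Ck_on k S V"
  shows "Ck_on k S (\<lambda>x. frechet_derivative f (at x) (V x))"
proof -
  have "frechet_derivative f (at x) (V x) = (\<Sum>b\<in>Basis. (V x \<bullet> b) *\<^sub>R frechet_derivative f (at x) b)"
    if "x \<in> S" for x
  proof -
    have "linear (frechet_derivative f (at x))"
      using f that by (intro linear_frechet_derivative) auto
    then show ?thesis
      by (rule linear_Basis_expansion)
  qed
  moreover have "Ck_on k S (\<lambda>x. \<Sum>b\<in>Basis. (V x \<bullet> b) *\<^sub>R frechet_derivative f (at x) b)"
    using f V by (intro Ck_on_sum Ck_on_scaleR Ck_on_inner S Ck_on_const) auto
  ultimately show ?thesis using Ck_on_cong[OF S] by (metis (no_types, lifting))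
qed

lemma Ck_on_compose:
  assumes S: "open S" and T: "open T" and "g ` S \<subseteq> T"
  shows "Ck_on k T f \<Longrightarrow> Ck_on k S g \<Longrightarrow> Ck_on k S (\<lambda>x. f (g x))"
proof (induction k arbitrary: f)
  case 0 then show ?case using assms continuous_on_compose2 by (metis Ck_on.simps(1))
next
  case (Suc k)
  have gT: "g x \<in> T" if "x \<in> S" for x using assms that by auto
  show ?case
  proof (rule Ck_on_SucI[OF S])
    show "((\<lambda>x. f (g x)) has_derivative (\<lambda>v. frechet_derivative f (at (g x)) (frechet_derivative g (at x) v))) (at x)"
      if "x \<in> S" for x
      using has_derivative_compose[of g _ x UNIV f] Suc.prems that gT[OF that]
      by (auto simp: frechet_derivative_works)
    fix v
    \<comment> \<open>The chain rule evaluates the derivative of \<open>f\<close> in a direction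
      depending on \<open>x\<close>; the expansion in \<open>Basis\<close> restores fixed
      directions, so that the induction hypothesis applies to each directional derivative of
      \<open>f\<close>.\<close>
    have "Ck_on k S (\<lambda>x. \<Sum>b\<in>Basis. (frechet_derivative g (at x) v \<bullet> b) *\<^sub>R frechet_derivative f (at (g x)) b)"
      using Suc.prems Ck_on_SucD[of k S g]
      by (intro Ck_on_sum Ck_on_scaleR Ck_on_inner S Ck_on_const Suc.IH) auto
    moreover have "frechet_derivative f (at (g x)) (frechet_derivative g (at x) v) =
       (\<Sum>b\<in>Basis. (frechet_derivative g (at x) v \<bullet> b) *\<^sub>R frechet_derivative f (at (g x)) b)" if "x \<in> S" for x
    proof -
      have "linear (frechet_derivative f (at (g x)))"
        using Suc.prems gT[OF that] by (intro linear_frechet_derivative) auto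
      then show ?thesis
        by (rule linear_Basis_expansion)
    qed
    ultimately show "Ck_on k S (\<lambda>x. frechet_derivative f (at (g x)) (frechet_derivative g (at x) v))"
      using Ck_on_cong[OF S] by (metis (no_types, lifting))
  qed
qed

lemma dirs_deriv_append: "dirs_deriv (vs @ ws) f = dirs_deriv vs (dirs_deriv ws f)"
  by (induction vs) auto

lemma smooth_on_differentiable: "smooth_on S f \<Longrightarrow> x \<in> S \<Longrightarrow> f differentiable at x"
  unfolding smooth_on_def by (drule spec[of _ "[]"]) simp

text \<open>\<open>dirs_deriv\<close> applies the last element of the list first. Appending
  \<open>v\<close> at the end therefore turns iterated derivatives of \<open>f\<close> into those of
  its \<open>v\<close>-derivative, and the induction on \<open>k\<close> can proceed.\<close>

lemma smooth_on_imp_Ck_on: "smooth_on S f \<Longrightarrow> Ck_on k S f"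
proof (induction k arbitrary: f)
  case 0
  then show ?case
    by (simp add: continuous_at_imp_continuous_on differentiable_imp_continuous_within smooth_on_differentiable)
next
  case (Suc k)
  have "smooth_on S (\<lambda>x. frechet_derivative f (at x) v)" for v
    unfolding smooth_on_def
  proof (intro allI ballI)
    fix vs x assume "x \<in> S"
    then have "dirs_deriv (vs @ [v]) f differentiable at x"
      using Suc.prems unfolding smooth_on_def by blast
    then show "dirs_deriv vs (\<lambda>x. frechet_derivative f (at x) v) differentiable at x"
      by (simp add: dirs_deriv_append)
  qed
  then show ?case using Suc.IH smooth_on_differentiable[OF Suc.prems] by auto
qed

section \<open>Reciprocals, square roots, determinants and inverse matrices\<close>

lemma Ck_on_inverse: "Ck_on k (- {0::real}) inverse"
proof (induction k)
  case 0 show ?case by (auto intro!: continuous_intros)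
next
  case (Suc k)
  show ?case
  proof (rule Ck_on_SucI)
    show "open (- {0::real})" by auto
    show "(inverse has_derivative (\<lambda>v. - (inverse x * v * inverse x))) (at x)" if "x \<in> - {0::real}" for x :: real
      using that by (auto intro!: derivative_eq_intros)
    show "Ck_on k (- {0::real}) (\<lambda>x. - (inverse x * v * inverse x))" for v
      using Suc by (intro Ck_on_minus Ck_on_mult Ck_on_const) auto
  qed
qed

lemma Ck_on_divide:
  fixes f g :: "'a::euclidean_space \<Rightarrow> real"
  assumes "open S" "Ck_on k S f" "Ck_on k S g" "\<And>x. x \<in> S \<Longrightarrow> g x \<noteq> 0"
  shows "Ck_on k S (\<lambda>x. f x / g x)"
  unfolding divide_inverse
  using assms by (intro Ck_on_mult Ck_on_compose[OF _ _ _ Ck_on_inverse]) auto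

lemma Ck_on_sqrt: "Ck_on k {0<..} sqrt"
proof (induction k)
  case 0 show ?case by (auto intro!: continuous_intros)
next
  case (Suc k)
  show ?case
  proof (rule Ck_on_SucI)
    show "open ({0<..} :: real set)" by auto
    show "(sqrt has_derivative (\<lambda>v. v * (1 / (2 * sqrt x)))) (at x)" if "x \<in> {0<..}" for x :: real
      using that by (auto intro!: derivative_eq_intros simp: divide_simps)
    show "Ck_on k {0<..} (\<lambda>x. v * (1 / (2 * sqrt x)))" for v
      using Suc by (intro Ck_on_divide Ck_on_mult Ck_on_const) auto
  qed
qed

lemma Ck_on_det:
  fixes A :: "'a::euclidean_space \<Rightarrow> real^'n^'n"
  assumes "open S" "\<And>i j. Ck_on k S (\<lambda>x. A x $ i $ j)"
  shows "Ck_on k S (\<lambda>x. det (A x))"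
  unfolding det_def using assms by (intro Ck_on_sum Ck_on_mult Ck_on_const Ck_on_prod)

lemma matrix_inv_mult:
  fixes A :: "real^'n^'n"
  assumes "det A \<noteq> 0" shows "A ** matrix_inv A = mat 1" "matrix_inv A ** A = mat 1"
proof -
  have "\<exists>B. A ** B = mat 1 \<and> B ** A = mat 1"
    using assms by (simp add: invertible_det_nz[symmetric] invertible_def)
  then have "A ** matrix_inv A = mat 1 \<and> matrix_inv A ** A = mat 1"
    unfolding matrix_inv_def by (rule someI_ex)
  then show "A ** matrix_inv A = mat 1" "matrix_inv A ** A = mat 1" by auto
qed

text \<open>Cramer's rule for the \<open>j\<close>-th unit vector. The quotient of determinants
  gives the regularity of the inverse metric; a diagonal entry is also how the determinant of the
  induced metric enters.\<close>

lemma matrix_inv_cramer: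
  fixes A :: "real^'n^'n"
  assumes "det A \<noteq> 0"
  shows "matrix_inv A $ i $ j = det (\<chi> a b. if b = i then (axis j 1 :: real^'n) $ a else A $ a $ b) / det A"
proof -
  have "A *v (matrix_inv A *v axis j 1) = axis j 1"
    by (simp add: matrix_vector_mul_assoc matrix_inv_mult[OF assms])
  then have "matrix_inv A *v axis j 1 = (\<chi> k. det (\<chi> a b. if b = k then (axis j 1 :: real^'n) $ a else A $ a $ b) / det A)"
    using cramer[OF assms] by blast
  moreover have "(matrix_inv A *v axis j 1) $ i = matrix_inv A $ i $ j"
    by (simp add: matrix_vector_mult_basis column_def)
  ultimately show ?thesis by simp
qed

lemma Ck_on_matrix_inv:
  fixes A :: "'a::euclidean_space \<Rightarrow> real^'n^'n"
  assumes "open S" "\<And>i j. Ck_on k S (\<lambda>x. A x $ i $ j)" "\<And>x. x \<in> S \<Longrightarrow> det (A x) \<noteq> 0"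
  shows "Ck_on k S (\<lambda>x. matrix_inv (A x) $ i $ j)"
proof (rule Ck_on_cong[OF assms(1)])
  show "det (\<chi> a b. if b = i then (axis j 1 :: real^'n) $ a else A x $ a $ b) / det (A x) = matrix_inv (A x) $ i $ j"
    if "x \<in> S" for x using matrix_inv_cramer[OF assms(3)[OF that]] by simp
  have "Ck_on k S (\<lambda>x. (\<chi> a b. if b = i then (axis j 1 :: real^'n) $ a else A x $ a $ b) $ c $ d)" for c d
    using assms(2)[of c d] by (cases "d = i") (auto intro: Ck_on_const)
  then show "Ck_on k S (\<lambda>x. det (\<chi> a b. if b = i then (axis j 1 :: real^'n) $ a else A x $ a $ b) / det (A x))"
    using assms by (intro Ck_on_divide Ck_on_det)
qed

text \<open>A polynomial cut-off: it is only \<open>C\<^sup>2\<close>, which is all that integration by parts requires.\<close>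

definition bump :: "'a::euclidean_space \<Rightarrow> real \<Rightarrow> 'a \<Rightarrow> real" where
  "bump a r x = 1 - (max 0 (1 - (max 0 ((r\<^sup>2 - (x - a) \<bullet> (x - a)) * (2 / r\<^sup>2))) ^ 3)) ^ 3"

text \<open>Away from 0 this is the power rule or the constant 0. At the kink the difference
  quotient is bounded by \<open>\<bar>h\<bar> ^ Suc n\<close>, which still tends to 0 because the
  exponent is at least 2.\<close>

lemma max0_power_has_derivative:
  fixes t :: real
  shows "((\<lambda>t::real. (max 0 t) ^ Suc (Suc n)) has_derivative (\<lambda>v. v * (real (Suc (Suc n)) * (max 0 t) ^ Suc n))) (at t)"
proof -
  consider "t < 0" | "t = 0" | "t > 0" by linarith
  then show ?thesis
  proof cases
    case 1
    then have m: "(max 0 t) ^ Suc n = 0" by (simp add: max_absorb1)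
    have "((\<lambda>t::real. 0) has_derivative (\<lambda>v. v * (real (Suc (Suc n)) * (max 0 t) ^ Suc n))) (at t)"
      unfolding m by simp
    then show ?thesis
      by (rule has_derivative_transform_within_open[of _ _ _ _ "{..<0}"]) (use 1 in \<open>auto simp: max_absorb1\<close>)
  next
    case 3
    then have m: "max 0 t = t" by (simp add: max_absorb2)
    have "((\<lambda>t::real. t ^ Suc (Suc n)) has_derivative (\<lambda>v. v * (real (Suc (Suc n)) * (max 0 t) ^ Suc n))) (at t)"
      unfolding m using has_derivative_power[OF has_derivative_ident, of "Suc (Suc n)" t UNIV]
      by (simp add: mult_ac)
    then show ?thesis
      by (rule has_derivative_transform_within_open[of _ _ _ _ "{0<..}"]) (use 3 in \<open>auto simp: max_absorb2\<close>)
  next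
    case 2
    have l0: "((\<lambda>h. \<bar>h\<bar> ^ Suc n) \<longlongrightarrow> 0) (at (0::real))"
      by (intro tendsto_null_power tendsto_rabs_zero tendsto_ident_at) simp
    have le: "norm ((max 0 h ^ Suc (Suc n)) / h) \<le> \<bar>h\<bar> ^ Suc n" for h :: real
    proof (cases "h \<le> 0")
      case True
      then have "max 0 h ^ Suc (Suc n) = 0" by (simp only: max_absorb1 power_0_Suc)
      then show ?thesis by (simp only: div_0 norm_zero abs_ge_zero zero_le_power)
    next
      case False
      then have "max 0 h ^ Suc (Suc n) / h = h ^ Suc n" by (simp add: max_absorb2)
      then show ?thesis by (simp only: real_norm_def power_abs order_refl)
    qed
    have l: "((\<lambda>h. (max 0 h ^ Suc (Suc n)) / h) \<longlongrightarrow> 0) (at (0::real))"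
      by (rule Lim_null_comparison[OF always_eventually[OF allI[OF le]] l0])
    have e: "(\<lambda>h. (max 0 (0 + h) ^ Suc (Suc n) - max 0 (0::real) ^ Suc (Suc n)) / h) = (\<lambda>h. max 0 h ^ Suc (Suc n) / h)"
      by (simp only: add_0 max.idem power_0_Suc diff_zero)
    have "((\<lambda>t::real. (max 0 t) ^ Suc (Suc n)) has_field_derivative 0) (at 0)"
      unfolding DERIV_def e by (rule l)
    then show ?thesis unfolding has_field_derivative_def 2
      by (rule has_derivative_eq_rhs) (simp add: fun_eq_iff)
  qed
qed

text \<open>Each differentiation lowers the exponent by one and the positive part itself is
  continuous, so the cube is the lowest integer power that is twice continuously
  differentiable.\<close>

lemma Ck_on_max0_cubed: "Ck_on 2 UNIV (\<lambda>t::real. (max 0 t) ^ 3)"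
proof -
  note d = max0_power_has_derivative
  have "Ck_on (Suc 0) UNIV (\<lambda>t::real. (max 0 t) ^ Suc (Suc 0))"
  proof (rule Ck_on_SucI[OF open_UNIV d])
    show "Ck_on 0 UNIV (\<lambda>t::real. v * (real (Suc (Suc 0)) * (max 0 t) ^ Suc 0))" for v
      unfolding Ck_on.simps by (intro continuous_intros)
  qed
  then have "Ck_on (Suc 0) UNIV (\<lambda>t::real. v * (real (Suc (Suc (Suc 0))) * (max 0 t) ^ Suc (Suc 0)))" for v
    by (intro Ck_on_mult open_UNIV Ck_on_const)
  then have "Ck_on (Suc (Suc 0)) UNIV (\<lambda>t::real. (max 0 t) ^ Suc (Suc (Suc 0)))"
    by (rule Ck_on_SucI[OF open_UNIV d])
  then show ?thesis unfolding numeral_2_eq_2 numeral_3_eq_3 .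
qed

lemma Ck_on_bump: "Ck_on 2 UNIV (bump a r)"
proof -
  have cube: "Ck_on 2 UNIV (\<lambda>x. (max 0 (f x)) ^ 3)" if "Ck_on 2 UNIV f" for f :: "'a \<Rightarrow> real"
    using Ck_on_compose[OF open_UNIV open_UNIV subset_UNIV Ck_on_max0_cubed that] .
  have "Ck_on 2 UNIV (\<lambda>x. (r\<^sup>2 - (x - a) \<bullet> (x - a)) * (2 / r\<^sup>2))"
    by (intro Ck_on_diff Ck_on_const Ck_on_mult Ck_on_inner Ck_on_bounded_linear[OF bounded_linear_ident] open_UNIV)
  then have "Ck_on 2 UNIV (\<lambda>x. 1 - (max 0 (1 - (max 0 ((r\<^sup>2 - (x - a) \<bullet> (x - a)) * (2 / r\<^sup>2))) ^ 3)) ^ 3)"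
    by (intro Ck_on_diff Ck_on_const cube open_UNIV)
  then show ?thesis by (simp add: bump_def[abs_def])
qed

lemma bump_bounds: "0 \<le> bump a r x" "bump a r x \<le> 1"
proof -
  have "0 \<le> (max 0 (1 - (max 0 ((r\<^sup>2 - (x - a) \<bullet> (x - a)) * (2 / r\<^sup>2))) ^ 3)) ^ 3" by simp
  moreover have "(max 0 (1 - (max 0 ((r\<^sup>2 - (x - a) \<bullet> (x - a)) * (2 / r\<^sup>2))) ^ 3)) ^ 3 \<le> 1"
    by (rule power_le_one) auto
  ultimately show "0 \<le> bump a r x" "bump a r x \<le> 1" unfolding bump_def by linarith+
qed

lemma bump_eq_0: "0 < r \<Longrightarrow> r \<le> dist a x \<Longrightarrow> bump a r x = 0"
proof -
  assume "0 < r" "r \<le> dist a x"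
  then have "r\<^sup>2 \<le> (dist a x)\<^sup>2" by (intro power_mono) auto
  moreover have "(x - a) \<bullet> (x - a) = (dist a x)\<^sup>2"
    by (metis dist_commute dist_norm power2_norm_eq_inner)
  ultimately have "(r\<^sup>2 - (x - a) \<bullet> (x - a)) * (2 / r\<^sup>2) \<le> 0"
    by (intro mult_nonpos_nonneg) simp_all
  then have m: "max 0 ((r\<^sup>2 - (x - a) \<bullet> (x - a)) * (2 / r\<^sup>2)) = 0" by (rule max_absorb1)
  show ?thesis unfolding bump_def m by simp
qed

text \<open>The factor \<open>2 / r\<^sup>2\<close> makes the inner argument at least 1 once the
  squared distance is at most half of \<open>r\<^sup>2\<close>, which covers the ball of half the
  radius; the inner cube is then at least 1 and the outer positive part vanishes.\<close>

lemma bump_eq_1: "0 < r \<Longrightarrow> dist a x \<le> r / 2 \<Longrightarrow> bump a r x = 1"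
proof -
  assume r: "0 < r" "dist a x \<le> r / 2"
  then have "(dist a x)\<^sup>2 \<le> (r / 2)\<^sup>2" by (intro power_mono) auto
  moreover have "(x - a) \<bullet> (x - a) = (dist a x)\<^sup>2"
    by (metis dist_commute dist_norm power2_norm_eq_inner)
  ultimately have "(x - a) \<bullet> (x - a) \<le> r\<^sup>2 / 4"
    by (simp add: power_divide)
  then have "r\<^sup>2 / 2 \<le> r\<^sup>2 - (x - a) \<bullet> (x - a)"
    using zero_le_power2[of r] by linarith
  then have "r\<^sup>2 / 2 * (2 / r\<^sup>2) \<le> (r\<^sup>2 - (x - a) \<bullet> (x - a)) * (2 / r\<^sup>2)"
    by (rule mult_right_mono) simp
  moreover have "r\<^sup>2 / 2 * (2 / r\<^sup>2) = 1" using r by simp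
  ultimately have "1 \<le> max 0 ((r\<^sup>2 - (x - a) \<bullet> (x - a)) * (2 / r\<^sup>2))" by linarith
  then have "1 \<le> (max 0 ((r\<^sup>2 - (x - a) \<bullet> (x - a)) * (2 / r\<^sup>2))) ^ 3" by (rule one_le_power)
  then have m: "max 0 (1 - (max 0 ((r\<^sup>2 - (x - a) \<bullet> (x - a)) * (2 / r\<^sup>2))) ^ 3) = 0"
    by (intro max_absorb1) linarith
  show ?thesis unfolding bump_def m by simp
qed

section \<open>Change of variables\<close>

text \<open>The change of variables theorem of the library needs a well-ordered index type. Every finite
  type has a well-ordered copy, and the theorem is transported along the reindexing.\<close>

typedef 'a wo_copy = "UNIV :: 'a set" by auto

instance wo_copy :: (finite) finite
proof
  have "(UNIV :: 'a wo_copy set) = range Abs_wo_copy"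
    by (metis Rep_wo_copy_inverse UNIV_eq_I rangeI)
  then show "finite (UNIV :: 'a wo_copy set)" by (metis finite finite_imageI)
qed

instantiation wo_copy :: (finite) wellorder
begin

definition less_eq_wo_copy_def: "(x :: 'a wo_copy) \<le> y \<longleftrightarrow> to_nat (Rep_wo_copy x) \<le> to_nat (Rep_wo_copy y)"
definition less_wo_copy_def: "(x :: 'a wo_copy) < y \<longleftrightarrow> to_nat (Rep_wo_copy x) < to_nat (Rep_wo_copy y)"

instance
proof
  fix x y z :: "'a wo_copy"
  show "(x < y) = (x \<le> y \<and> \<not> y \<le> x)" "x \<le> x" "x \<le> y \<or> y \<le> x"
    unfolding less_eq_wo_copy_def less_wo_copy_def by linarith+
  show "x \<le> y \<Longrightarrow> y \<le> z \<Longrightarrow> x \<le> z" unfolding less_eq_wo_copy_def by linarith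
  show "x \<le> y \<Longrightarrow> y \<le> x \<Longrightarrow> x = y"
    unfolding less_eq_wo_copy_def using Rep_wo_copy_inject inj_to_nat by (metis inj_eq order_antisym)
next
  fix P :: "'a wo_copy \<Rightarrow> bool" and a
  assume step: "\<And>x. (\<And>y. y < x \<Longrightarrow> P y) \<Longrightarrow> P x"
  show "P a"
  proof (induction "to_nat (Rep_wo_copy a)" arbitrary: a rule: less_induct)
    case less
    show ?case by (rule step, rule less) (simp add: less_wo_copy_def)
  qed
qed

end

lemma prod_Basis_vec: "(\<Prod>b\<in>Basis. f (x \<bullet> b)) = (\<Prod>i\<in>UNIV. f ((x :: real^'n) $ i))"
proof -
  have B: "(Basis :: (real^'n) set) = (\<lambda>i. axis i 1) ` UNIV" by (auto simp: Basis_vec_def)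
  show ?thesis unfolding B
    by (subst prod.reindex) (auto simp: inj_on_def axis_eq_axis inner_axis)
qed

definition reindex_vec :: "('m::finite \<Rightarrow> 'n::finite) \<Rightarrow> real^'n \<Rightarrow> real^'m" where
  "reindex_vec \<sigma> x = (\<chi> i. x $ \<sigma> i)"

lemma reindex_vec_nth [simp]: "reindex_vec \<sigma> x $ i = x $ \<sigma> i"
  by (simp add: reindex_vec_def)

lemma linear_reindex_vec: "linear (reindex_vec \<sigma>)"
  by (intro linearI) (auto simp: vec_eq_iff)

lemma reindex_vec_inverse: "bij \<sigma> \<Longrightarrow> reindex_vec \<sigma> (reindex_vec (inv \<sigma>) x) = x"
  "bij \<sigma> \<Longrightarrow> reindex_vec (inv \<sigma>) (reindex_vec \<sigma> y) = y"
  by (simp_all add: vec_eq_iff bij_is_inj bij_is_surj surj_f_inv_f)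

lemma measurable_reindex_vec [measurable]: "reindex_vec \<sigma> \<in> borel_measurable borel"
  using linear_reindex_vec linear_continuous_on linear_conv_bounded_linear
  by (blast intro: borel_measurable_continuous_onI)

text \<open>Lebesgue measure is determined by the volumes of boxes, and relabelling the coordinates
  takes boxes to boxes with the same side lengths.\<close>

lemma lborel_reindex_vec:
  fixes \<sigma> :: "'m::finite \<Rightarrow> 'n::finite"
  assumes \<sigma>: "bij \<sigma>"
  shows "distr lborel borel (reindex_vec \<sigma>) = lborel"
proof (rule lborel_eqI[symmetric])
  fix l u :: "real^'m" assume le: "\<And>b. b \<in> Basis \<Longrightarrow> l \<bullet> b \<le> u \<bullet> b"
  have le': "l $ i \<le> u $ i" for i
    using le[of "axis i 1"] by (auto simp: inner_axis Basis_vec_def)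
  have "reindex_vec \<sigma> -` box l u = box (reindex_vec (inv \<sigma>) l) (reindex_vec (inv \<sigma>) u)"
  proof (intro set_eqI iffI)
    fix x assume "x \<in> reindex_vec \<sigma> -` box l u"
    then have *: "l $ i < x $ \<sigma> i \<and> x $ \<sigma> i < u $ i" for i by (auto simp: mem_box_cart)
    show "x \<in> box (reindex_vec (inv \<sigma>) l) (reindex_vec (inv \<sigma>) u)"
      using *[of "inv \<sigma> _"] \<sigma> by (simp add: mem_box_cart bij_is_surj surj_f_inv_f)
  next
    fix x assume "x \<in> box (reindex_vec (inv \<sigma>) l) (reindex_vec (inv \<sigma>) u)"
    then have *: "l $ inv \<sigma> i < x $ i \<and> x $ i < u $ inv \<sigma> i" for i by (auto simp: mem_box_cart)
    show "x \<in> reindex_vec \<sigma> -` box l u"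
      using *[of "\<sigma> _"] \<sigma> by (simp add: mem_box_cart bij_is_inj)
  qed
  then have "emeasure (distr lborel borel (reindex_vec \<sigma>)) (box l u) =
     emeasure lborel (box (reindex_vec (inv \<sigma>) l) (reindex_vec (inv \<sigma>) u))"
    by (simp add: emeasure_distr)
  also have "\<dots> = (\<Prod>b\<in>Basis. (reindex_vec (inv \<sigma>) u - reindex_vec (inv \<sigma>) l) \<bullet> b)"
    by (rule emeasure_lborel_box) (auto simp: Basis_vec_def inner_axis le')
  also have "\<dots> = (\<Prod>i\<in>UNIV. u $ inv \<sigma> i - l $ inv \<sigma> i)"
    using prod_Basis_vec[of "\<lambda>t. t" "reindex_vec (inv \<sigma>) u - reindex_vec (inv \<sigma>) l"] by simp
  also have "(\<Prod>i\<in>UNIV. u $ inv \<sigma> i - l $ inv \<sigma> i) = (\<Prod>i\<in>UNIV. u $ i - l $ i)"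
    using prod.reindex_bij_betw[of "inv \<sigma>" UNIV UNIV "\<lambda>i. u $ i - l $ i"] \<sigma> by (simp add: bij_imp_bij_inv)
  also have "\<dots> = (\<Prod>b\<in>Basis. (u - l) \<bullet> b)"
    using prod_Basis_vec[of "\<lambda>t. t" "u - l"] by simp
  finally show "emeasure (distr lborel borel (reindex_vec \<sigma>)) (box l u) = (\<Prod>b\<in>Basis. (u - l) \<bullet> b)" .
qed simp

text \<open>In the Leibniz formula, permutations of the two index types correspond by conjugation
  with \<open>\<sigma>\<close>, which is a bijection and preserves the sign.\<close>

lemma det_reindex:
  fixes \<sigma> :: "'m::finite \<Rightarrow> 'n::finite" and A :: "real^'n^'n"
  assumes \<sigma>: "bij \<sigma>"
  shows "det ((\<chi> i j. A $ \<sigma> i $ \<sigma> j) :: real^'m^'m) = det A"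
proof -
  let ?F = "map_permutation UNIV \<sigma>" and ?G = "map_permutation UNIV (inv \<sigma>)"
  have bs: "bij_betw \<sigma> UNIV UNIV" "bij_betw (inv \<sigma>) UNIV UNIV" using \<sigma> by (auto intro: bij_imp_bij_inv)
  have "(\<Sum>p\<in>{p. p permutes (UNIV :: 'n set)}. of_int (sign p) * (\<Prod>i\<in>UNIV. A $ i $ p i)) =
     (\<Sum>p\<in>{p. p permutes (UNIV :: 'm set)}. of_int (sign p) * (\<Prod>i\<in>UNIV. A $ \<sigma> i $ \<sigma> (p i)))"
  proof (rule sum.reindex_bij_witness[of _ ?F ?G])
    fix p :: "'n \<Rightarrow> 'n" assume p: "p \<in> {p. p permutes UNIV}"
    show "?F (?G p) = p"
      using p \<sigma> by (intro map_permutation_compose_inv[OF bs(2)]) (auto simp: bij_is_surj surj_f_inv_f)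
    show "?G p \<in> {p. p permutes UNIV}" using map_permutation_permutes[OF bs(2)] p by auto
    have "sign (?G p) = sign p" using p \<sigma> by (intro sign_map_permutation) (auto intro: bij_is_inj bij_imp_bij_inv)
    moreover have "\<sigma> (?G p i) = p (\<sigma> i)" for i
    proof -
      have "?G p (inv \<sigma> (\<sigma> i)) = inv \<sigma> (p (\<sigma> i))"
        using \<sigma> by (intro map_permutation_apply) (auto intro: bij_is_inj bij_imp_bij_inv)
      then show ?thesis using \<sigma> by (simp add: bij_is_inj bij_is_surj surj_f_inv_f)
    qed
    then have "(\<Prod>i\<in>UNIV. A $ \<sigma> i $ \<sigma> (?G p i)) = (\<Prod>i\<in>UNIV. A $ i $ p i)"
      using prod.reindex_bij_betw[OF bs(1), of "\<lambda>i. A $ i $ p i"] by simp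
    ultimately show "of_int (sign (?G p)) * (\<Prod>i\<in>UNIV. A $ \<sigma> i $ \<sigma> (?G p i)) = of_int (sign p) * (\<Prod>i\<in>UNIV. A $ i $ p i)"
      by simp
  next
    fix p :: "'m \<Rightarrow> 'm" assume p: "p \<in> {p. p permutes UNIV}"
    show "?G (?F p) = p"
      using p \<sigma> by (intro map_permutation_compose_inv[OF bs(1)]) (auto simp: bij_is_inj)
    show "?F p \<in> {p. p permutes UNIV}" using map_permutation_permutes[OF bs(1)] p by auto
  qed
  then show ?thesis by (simp add: det_def)
qed

text \<open>\<open>has_measure_differentiable_image\<close> is an equivalence between finite measure
  of the image and integrability of the Jacobian. One direction serves when the integral is finite,
  the other excludes a finite image measure when the integral is infinite.\<close>

lemma emeasure_differentiable_image_wellorder: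
  fixes T :: "real^'n::{finite,wellorder} \<Rightarrow> real^'n::_"
  assumes S: "S \<in> sets borel" and TS: "T ` S \<in> sets borel"
    and der: "\<And>x. x \<in> S \<Longrightarrow> (T has_derivative T' x) (at x within S)"
    and inj: "inj_on T S"
    and meas: "(\<lambda>x. indicator S x * \<bar>det (matrix (T' x))\<bar>) \<in> borel_measurable borel"
  shows "emeasure lborel (T ` S) = (\<integral>\<^sup>+x. ennreal (indicator S x * \<bar>det (matrix (T' x))\<bar>) \<partial>lborel)"
proof -
  let ?h = "\<lambda>x. indicator S x * \<bar>det (matrix (T' x))\<bar>"
  have Sl: "S \<in> sets lebesgue" using S by simp
  note key = has_measure_differentiable_image[OF Sl der inj]
  show ?thesis
  proof (cases "(\<integral>\<^sup>+x. ennreal (?h x) \<partial>lborel) = \<infinity>")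
    case False
    then obtain r where r: "0 \<le> r" "(\<integral>\<^sup>+x. ennreal (?h x) \<partial>lborel) = ennreal r"
      by (cases "\<integral>\<^sup>+x. ennreal (?h x) \<partial>lborel" rule: ennreal_cases) auto
    have "?h \<in> lebesgue \<rightarrow>\<^sub>M borel"
      by (rule measurable_completion) (use meas in simp)
    moreover have "integral\<^sup>N lebesgue ?h = r" unfolding nn_integral_completion by (rule r(2))
    ultimately have "(?h has_integral r) UNIV"
      using r(1) by (subst has_integral_iff_nn_integral_lebesgue) simp_all
    moreover have "?h = (\<lambda>x. if x \<in> S then \<bar>det (matrix (T' x))\<bar> else 0)"
      by (rule ext) simp
    ultimately have "((\<lambda>x. if x \<in> S then \<bar>det (matrix (T' x))\<bar> else 0) has_integral r) UNIV" by simp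
    then have "((\<lambda>x. \<bar>det (matrix (T' x))\<bar>) has_integral r) S"
      by (simp only: has_integral_restrict_UNIV)
    then have "T ` S \<in> lmeasurable" "measure lebesgue (T ` S) = r" using key by auto
    then have "emeasure lebesgue (T ` S) = ennreal r" by (simp add: emeasure_eq_measure2)
    then show ?thesis using TS r by simp
  next
    case True
    have "emeasure lborel (T ` S) = \<infinity>"
    proof (rule ccontr)
      assume "emeasure lborel (T ` S) \<noteq> \<infinity>"
      then have "T ` S \<in> lmeasurable"
        using TS by (auto intro!: fmeasurableI simp: less_top)
      then have "((\<lambda>x. \<bar>det (matrix (T' x))\<bar>) has_integral (measure lebesgue (T ` S))) S" using key by auto
      then have "(\<integral>\<^sup>+x. ennreal (?h x) \<partial>lborel) = ennreal (measure lebesgue (T ` S))"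
        by (intro nn_integral_has_integral_lebesgue) auto
      then show False using True by simp
    qed
    then show ?thesis using True by simp
  qed
qed

text \<open>Conjugation by the relabelling of coordinates carries the statement over from the
  well-ordered copy; neither Lebesgue measure nor the determinant of the derivative changes.\<close>

lemma emeasure_differentiable_image:
  fixes T :: "real^'n::finite \<Rightarrow> real^'n"
  assumes S: "S \<in> sets borel" and TS: "T ` S \<in> sets borel"
    and der: "\<And>x. x \<in> S \<Longrightarrow> (T has_derivative T' x) (at x within S)"
    and inj: "inj_on T S"
    and meas: "(\<lambda>x. indicator S x * \<bar>det (matrix (T' x))\<bar>) \<in> borel_measurable borel"
  shows "emeasure lborel (T ` S) = (\<integral>\<^sup>+x. ennreal (indicator S x * \<bar>det (matrix (T' x))\<bar>) \<partial>lborel)"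
proof -
  let ?\<sigma> = "Rep_wo_copy :: 'n wo_copy \<Rightarrow> 'n"
  have \<sigma>: "bij ?\<sigma>"
    by (metis Abs_wo_copy_inverse Rep_wo_copy_inverse UNIV_I bij_iff)
  let ?P = "reindex_vec ?\<sigma>" and ?Q = "reindex_vec (inv ?\<sigma>) :: real^'n wo_copy \<Rightarrow> real^'n"
  note PQ = reindex_vec_inverse[OF \<sigma>]
  have img: "?P ` X = ?Q -` X" for X
  proof (intro set_eqI iffI)
    fix y assume "y \<in> ?Q -` X"
    then have "?P (?Q y) \<in> ?P ` X" by (intro imageI) simp
    then show "y \<in> ?P ` X" by (simp add: PQ)
  qed (auto simp: PQ)
  have em: "emeasure lborel (?P ` X) = emeasure lborel X" if "X \<in> sets borel" for X
  proof -
    have "?P ` X \<in> sets borel" unfolding img using that measurable_sets[OF measurable_reindex_vec] by auto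
    then have "emeasure (distr lborel borel ?P) (?P ` X) = emeasure lborel (?P -` ?P ` X)"
      by (simp add: emeasure_distr)
    also have "?P -` ?P ` X = X" unfolding img by (auto simp: PQ)
    finally show ?thesis by (simp add: lborel_reindex_vec[OF \<sigma>])
  qed
  define T2 where "T2 = (\<lambda>y. ?P (T (?Q y)))"
  define T2' where "T2' = (\<lambda>y v. ?P (T' (?Q y) (?Q v)))"
  have T2S: "T2 ` ?P ` S = ?P ` T ` S" by (simp add: image_image T2_def PQ)
  have detT2: "det (matrix (T2' y)) = det (matrix (T' (?Q y)))" for y
  proof -
    have "inv ?\<sigma> i = j \<longleftrightarrow> i = ?\<sigma> j" for i j
      using \<sigma> by (metis bij_inv_eq_iff)
    then have Qa: "?Q (axis j 1) = axis (?\<sigma> j) 1" for j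
      by (simp add: vec_eq_iff axis_def)
    have "matrix (T2' y) = (\<chi> i j. matrix (T' (?Q y)) $ ?\<sigma> i $ ?\<sigma> j)"
      unfolding matrix_def T2'_def Qa by (simp add: vec_eq_iff)
    then show ?thesis by (simp only: det_reindex[OF \<sigma>])
  qed
  have hPQ: "(?P has_derivative ?P) F" "(?Q has_derivative ?Q) F2" for F F2
    using linear_reindex_vec by (auto intro: linear_imp_has_derivative)
  have "emeasure lborel (T ` S) = emeasure lborel (T2 ` ?P ` S)" unfolding T2S using em[OF TS] by simp
  also have "\<dots> = (\<integral>\<^sup>+y. ennreal (indicator (?P ` S) y * \<bar>det (matrix (T2' y))\<bar>) \<partial>lborel)"
  proof (rule emeasure_differentiable_image_wellorder)
    show "?P ` S \<in> sets borel" "T2 ` ?P ` S \<in> sets borel"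
      unfolding T2S unfolding img using S TS measurable_sets[OF measurable_reindex_vec] by auto
    show "inj_on T2 (?P ` S)"
    proof (rule inj_onI)
      fix a b assume "a \<in> ?P ` S" "b \<in> ?P ` S" and eq: "T2 a = T2 b"
      then obtain s t where st: "s \<in> S" "t \<in> S" "a = ?P s" "b = ?P t" by auto
      then have "?Q (?P (T s)) = ?Q (?P (T t))" using eq by (simp add: T2_def PQ)
      then have "T s = T t" by (simp only: PQ)
      then show "a = b" using st inj by (simp add: inj_on_eq_iff)
    qed
    show "(T2 has_derivative T2' y) (at y within ?P ` S)" if "y \<in> ?P ` S" for y
    proof -
      have "?Q y \<in> S" using that by (auto simp: PQ)
      have "?Q ` ?P ` S = S" by (simp add: image_image PQ)
      then have "(T has_derivative T' (?Q y)) (at (?Q y) within ?Q ` ?P ` S)" using der[OF \<open>?Q y \<in> S\<close>] by simp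
      then have "(T \<circ> ?Q has_derivative T' (?Q y) \<circ> ?Q) (at y within ?P ` S)"
        by (rule diff_chain_within[OF hPQ(2)])
      then have "(?P \<circ> (T \<circ> ?Q) has_derivative ?P \<circ> (T' (?Q y) \<circ> ?Q)) (at y within ?P ` S)"
        by (rule diff_chain_within[OF _ hPQ(1)])
      then show ?thesis by (simp add: T2_def T2'_def o_def)
    qed
    have "(\<lambda>y. indicator S (?Q y) * \<bar>det (matrix (T' (?Q y)))\<bar>) \<in> borel_measurable borel"
      using measurable_compose[OF measurable_reindex_vec meas] .
    moreover have "indicator (?P ` S) y = (indicator S (?Q y) :: real)" for y unfolding img by (simp add: indicator_def)
    ultimately show "(\<lambda>y. indicator (?P ` S) y * \<bar>det (matrix (T2' y))\<bar>) \<in> borel_measurable borel"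
      by (simp add: detT2)
  qed
  also have "\<dots> = (\<integral>\<^sup>+y. ennreal (indicator S (?Q y) * \<bar>det (matrix (T' (?Q y)))\<bar>) \<partial>distr lborel borel ?P)"
    unfolding lborel_reindex_vec[OF \<sigma>] img by (simp add: detT2 indicator_def)
  also have "\<dots> = (\<integral>\<^sup>+x. ennreal (indicator S (?Q (?P x)) * \<bar>det (matrix (T' (?Q (?P x))))\<bar>) \<partial>lborel)"
    by (rule nn_integral_distr) (auto intro!: measurable_compose[OF measurable_reindex_vec measurable_compose[OF meas]])
  finally show ?thesis by (simp add: PQ)
qed

text \<open>Proved as an equality of measures: \<open>T\<close> pushes the density
  \<open>\<bar>det T'\<bar>\<close> on \<open>U\<close> forward to Lebesgue measure on
  \<open>V\<close>. Once this is known on Borel sets it holds for all nonnegative Borel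
  integrands.\<close>

lemma nn_integral_change_of_variables:
  fixes T :: "real^'n::finite \<Rightarrow> real^'n" and f :: "real^'n \<Rightarrow> ennreal"
  assumes U: "open U" and V: "open V" and hom: "homeomorphism U V T Ti"
    and der: "\<And>x. x \<in> U \<Longrightarrow> (T has_derivative T' x) (at x)"
    and cont: "continuous_on U (\<lambda>x. det (matrix (T' x)))"
    and f [measurable]: "f \<in> borel_measurable borel"
  shows "(\<integral>\<^sup>+y. f y * indicator V y \<partial>lborel) =
    (\<integral>\<^sup>+x. f (T x) * ennreal \<bar>det (matrix (T' x))\<bar> * indicator U x \<partial>lborel)"
proof -
  define h where "h = (\<lambda>x. if x \<in> U then \<bar>det (matrix (T' x))\<bar> else 0)"
  \<comment> \<open>\<open>T\<close> is controlled on \<open>U\<close> only. Setting it to 0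
    elsewhere gives a map that is Borel on the whole space; the density \<open>h\<close> vanishes
    off \<open>U\<close>, so this value is never seen.\<close>
  define T0 where "T0 = (\<lambda>x. if x \<in> U then T x else 0)"
  have [measurable]: "U \<in> sets borel" "V \<in> sets borel" using U V by auto
  have [measurable]: "h \<in> borel_measurable borel" unfolding h_def
    by (intro borel_measurable_continuous_on_if cont continuous_intros) auto
  have [measurable]: "T0 \<in> borel_measurable borel" unfolding T0_def
    using hom by (intro borel_measurable_continuous_on_if continuous_intros) (auto simp: homeomorphism_def)
  have TV: "T x \<in> V" "Ti (T x) = x" if "x \<in> U" for x using hom that by (auto simp: homeomorphism_def)
  have TU: "Ti y \<in> U" "T (Ti y) = y" if "y \<in> V" for y using hom that by (auto simp: homeomorphism_def)
  have eq: "distr (density lborel (\<lambda>x. ennreal (h x))) borel T0 = density lborel (indicator V)"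
  proof (rule measure_eqI)
    fix B assume "B \<in> sets (distr (density lborel (\<lambda>x. ennreal (h x))) borel T0)"
    then have B [measurable]: "B \<in> sets borel" by simp
    define S where "S = U \<inter> T0 -` B"
    have S [measurable]: "S \<in> sets borel" unfolding S_def
      using measurable_sets[of T0 borel borel B] by auto
    have TS: "T ` S = V \<inter> B"
    proof
      show "T ` S \<subseteq> V \<inter> B" by (auto simp: S_def T0_def TV)
      show "V \<inter> B \<subseteq> T ` S"
      proof
        fix y assume "y \<in> V \<inter> B"
        then have "Ti y \<in> S" "T (Ti y) = y" by (auto simp: S_def T0_def TU)
        then show "y \<in> T ` S" by (metis imageI)
      qed
    qed
    have SU: "S \<subseteq> U" by (auto simp: S_def)
    have hS: "(\<lambda>x. indicator S x * \<bar>det (matrix (T' x))\<bar>) = (\<lambda>x. indicator S x * h x)"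
      by (rule ext) (use SU in \<open>auto simp: h_def indicator_def\<close>)
    have "emeasure lborel (V \<inter> B) = (\<integral>\<^sup>+x. ennreal (indicator S x * \<bar>det (matrix (T' x))\<bar>) \<partial>lborel)"
      unfolding TS[symmetric]
    proof (rule emeasure_differentiable_image)
      show "T ` S \<in> sets borel" unfolding TS by measurable
      show "(T has_derivative T' x) (at x within S)" if "x \<in> S" for x
        using der[of x] SU that by (auto intro: has_derivative_at_withinI)
      show "inj_on T S" using SU TV(2) by (metis inj_on_inverseI subsetD)
      show "(\<lambda>x. indicator S x * \<bar>det (matrix (T' x))\<bar>) \<in> borel_measurable borel"
        unfolding hS by measurable
    qed (rule S)
    also have "\<dots> = (\<integral>\<^sup>+x. ennreal (h x) * indicator (T0 -` B) x \<partial>lborel)"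
      unfolding hS by (intro nn_integral_cong) (auto simp: S_def h_def indicator_def)
    also have "\<dots> = emeasure (distr (density lborel (\<lambda>x. ennreal (h x))) borel T0) B"
      using measurable_sets[of T0 borel borel B] by (simp add: emeasure_distr emeasure_density)
    also have "emeasure lborel (V \<inter> B) = (\<integral>\<^sup>+x. indicator (V \<inter> B) x \<partial>lborel)" by simp
    also have "\<dots> = (\<integral>\<^sup>+x. indicator V x * indicator B x \<partial>lborel)"
      by (simp only: indicator_inter_arith)
    also have "\<dots> = emeasure (density lborel (indicator V)) B"
      by (rule emeasure_density[symmetric]) auto
    finally show "emeasure (distr (density lborel (\<lambda>x. ennreal (h x))) borel T0) B = emeasure (density lborel (indicator V)) B"
      by simp
  qed simp
  have "(\<integral>\<^sup>+y. f y * indicator V y \<partial>lborel) = (\<integral>\<^sup>+y. f y \<partial>density lborel (indicator V))"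
    by (simp add: nn_integral_density mult.commute)
  also have "\<dots> = (\<integral>\<^sup>+x. f (T0 x) \<partial>density lborel (\<lambda>x. ennreal (h x)))"
    unfolding eq[symmetric] by (simp add: nn_integral_distr)
  also have "\<dots> = (\<integral>\<^sup>+x. ennreal (h x) * f (T0 x) \<partial>lborel)"
    by (simp add: nn_integral_density)
  also have "\<dots> = (\<integral>\<^sup>+x. f (T x) * ennreal \<bar>det (matrix (T' x))\<bar> * indicator U x \<partial>lborel)"
    by (intro nn_integral_cong) (auto simp: h_def T0_def indicator_def mult.commute)
  finally show ?thesis .
qed

section \<open>The divergence theorem in a half space\<close>

abbreviation hyper_PiM :: "'n::finite \<Rightarrow> ('n \<Rightarrow> real) measure" where
  "hyper_PiM k \<equiv> \<Pi>\<^sub>M i\<in>UNIV - {k}. lborel"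

lemma insert_zero_nth: "insert_zero k y $ i = (if i = k then 0 else y i)"
  by (simp add: insert_zero_def)

lemma measurable_insert_zero [measurable]:
  fixes k :: "'n::finite"
  shows "insert_zero k \<in> borel_measurable (hyper_PiM k)"
proof (subst borel_measurable_euclidean_space, intro ballI)
  fix b :: "real^'n" assume "b \<in> Basis"
  then obtain i where b: "b = axis i 1" by (auto simp: Basis_vec_def)
  show "(\<lambda>y. insert_zero k y \<bullet> b) \<in> borel_measurable (hyper_PiM k)"
  proof (cases "i = k")
    case False
    then have "(\<lambda>y. y i) \<in> borel_measurable (hyper_PiM k)"
      using measurable_component_singleton[of i "UNIV - {k}" "\<lambda>_. lborel :: real measure"] by simp
    then show ?thesis using False by (simp add: b inner_axis insert_zero_nth)
  qed (simp add: b inner_axis insert_zero_nth)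
qed

lemma measurable_nth_vec [measurable]: "(\<lambda>x. x $ i) \<in> borel_measurable (borel :: (real^'n) measure)"
  by (intro borel_measurable_continuous_onI continuous_intros)

lemma continuous_on_insert_zero: "continuous_on S (\<lambda>x :: real^'n. insert_zero k (($) x))"
  unfolding insert_zero_def
proof (rule continuous_on_vec_lambda)
  show "continuous_on S (\<lambda>x :: real^'n. if i = k then 0 else x $ i)" for i
    by (cases "i = k") (auto intro!: continuous_intros)
qed

lemma measurable_insert_zero_vec [measurable]:
  "(\<lambda>x :: real^'n. insert_zero k (($) x)) \<in> borel_measurable borel"
  by (rule borel_measurable_continuous_onI[OF continuous_on_insert_zero])

lemma sigma_finite_hyper_PiM: "sigma_finite_measure (hyper_PiM k)"
  by (rule product_sigma_finite.sigma_finite) (auto simp: product_sigma_finite_def lborel.sigma_finite_measure_axioms)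

lemma pair_sigma_finite_hyper: "pair_sigma_finite (lborel :: real measure) (hyper_PiM k)"
  by (intro pair_sigma_finite.intro lborel.sigma_finite_measure_axioms sigma_finite_hyper_PiM)

text \<open>A box is an interval in the \<open>k\<close>-th coordinate times a product over the
  remaining ones, and boxes determine Lebesgue measure. This gives Fubini along lines parallel to
  the \<open>k\<close>-th axis, with the product measure that also occurs in
  \<open>boundary_volume\<close>.\<close>

lemma lborel_eq_distr_hyper:
  fixes k :: "'n::finite"
  shows "(lborel :: (real^'n) measure) =
    distr (lborel \<Otimes>\<^sub>M hyper_PiM k) borel (\<lambda>(t, y). insert_zero k y + t *\<^sub>R axis k 1)"
proof (rule lborel_eqI)
  interpret pair_sigma_finite "lborel :: real measure" "hyper_PiM k" by (rule pair_sigma_finite_hyper)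
  interpret P: product_sigma_finite "\<lambda>_ :: 'n. lborel :: real measure"
    by (auto simp: product_sigma_finite_def lborel.sigma_finite_measure_axioms)
  fix l u :: "real^'n" assume le: "\<And>b. b \<in> Basis \<Longrightarrow> l \<bullet> b \<le> u \<bullet> b"
  have le': "l $ i \<le> u $ i" for i using le[of "axis i 1"] by (auto simp: inner_axis Basis_vec_def)
  let ?f = "\<lambda>(t, y). insert_zero k y + t *\<^sub>R axis k (1::real)"
  let ?E = "Pi\<^sub>E (UNIV - {k}) (\<lambda>i. {l $ i <..< u $ i})"
  have pre: "?f -` box l u \<inter> space (lborel \<Otimes>\<^sub>M hyper_PiM k) = {l $ k <..< u $ k} \<times> ?E"
  proof (intro set_eqI iffI)
    fix p assume p: "p \<in> ?f -` box l u \<inter> space (lborel \<Otimes>\<^sub>M hyper_PiM k)"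
    obtain t y where ty: "p = (t, y)" by (cases p)
    have *: "l $ i < (if i = k then t else y i) \<and> (if i = k then t else y i) < u $ i" for i
      using p by (auto simp: ty mem_box_cart insert_zero_nth axis_def dest: spec[of _ i])
    have "t \<in> {l $ k <..< u $ k}" using *[of k] by simp
    moreover have "y i \<in> {l $ i <..< u $ i}" if "i \<noteq> k" for i using *[of i] that by simp
    ultimately show "p \<in> {l $ k <..< u $ k} \<times> ?E"
      using p by (auto simp: ty space_pair_measure space_PiM PiE_def extensional_def)
  next
    fix p assume p: "p \<in> {l $ k <..< u $ k} \<times> ?E"
    obtain t y where ty: "p = (t, y)" by (cases p)
    show "p \<in> ?f -` box l u \<inter> space (lborel \<Otimes>\<^sub>M hyper_PiM k)"
      using p by (auto simp: ty mem_box_cart insert_zero_nth axis_def space_pair_measure space_PiM PiE_def Pi_def extensional_def)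
  qed
  have E: "?E \<in> sets (hyper_PiM k)" by (rule sets_PiM_I_finite) auto
  have "emeasure (distr (lborel \<Otimes>\<^sub>M hyper_PiM k) borel ?f) (box l u) =
     emeasure (lborel \<Otimes>\<^sub>M hyper_PiM k) ({l $ k <..< u $ k} \<times> ?E)"
    unfolding pre[symmetric] by (rule emeasure_distr) auto
  also have "\<dots> = emeasure lborel {l $ k <..< u $ k} * emeasure (hyper_PiM k) ?E"
    using E by (intro M2.emeasure_pair_measure_Times) auto
  also have "emeasure (hyper_PiM k) ?E = (\<Prod>i\<in>UNIV - {k}. emeasure lborel {l $ i <..< u $ i})"
    by (rule P.emeasure_PiM) auto
  also have "emeasure lborel {l $ k <..< u $ k} * \<dots> = (\<Prod>i\<in>UNIV. emeasure lborel {l $ i <..< u $ i})"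
    by (rule prod.remove[symmetric]) auto
  also have "\<dots> = (\<Prod>i\<in>UNIV. ennreal (u $ i - l $ i))" using le' by simp
  also have "\<dots> = ennreal (\<Prod>i\<in>UNIV. u $ i - l $ i)" using le' by (intro prod_ennreal) simp
  also have "(\<Prod>i\<in>UNIV. u $ i - l $ i) = (\<Prod>b\<in>Basis. (u - l) \<bullet> b)"
    using prod_Basis_vec[of "\<lambda>t. t" "u - l"] by simp
  finally show "emeasure (distr (lborel \<Otimes>\<^sub>M hyper_PiM k) borel ?f) (box l u) = (\<Prod>b\<in>Basis. (u - l) \<bullet> b)" .
qed simp

lemma insert_zero_insert_at:
  "insert_zero k (($) (insert_zero k y + t *\<^sub>R axis k 1)) = insert_zero k y"
  "(insert_zero k y + t *\<^sub>R axis k 1) $ i = (if i = k then t else y i)"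
  by (auto simp: vec_eq_iff insert_zero_nth axis_def)

text \<open>On the slab the integrand does not depend on the \<open>k\<close>-th coordinate and the
  slab has thickness 1, so the extra integration contributes a factor 1. Hyperplane integrals thus
  become integrals over \<open>lborel\<close>.\<close>

lemma nn_integral_insert_zero:
  fixes F :: "real^'n \<Rightarrow> ennreal"
  assumes [measurable]: "F \<in> borel_measurable borel"
  shows "(\<integral>\<^sup>+y. F (insert_zero k y) \<partial>hyper_PiM k) =
    (\<integral>\<^sup>+x. F (insert_zero k (($) x)) * indicator {x. 0 < x $ k \<and> x $ k < 1} x \<partial>lborel)"
proof -
  interpret pair_sigma_finite "lborel :: real measure" "hyper_PiM k" by (rule pair_sigma_finite_hyper)
  let ?f = "\<lambda>(t, y). insert_zero k y + t *\<^sub>R axis k (1::real)"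
  let ?G = "\<lambda>x. F (insert_zero k (($) x)) * indicator {x. 0 < x $ k \<and> x $ k < 1} x"
  have "(\<integral>\<^sup>+x. ?G x \<partial>lborel) = (\<integral>\<^sup>+p. ?G (?f p) \<partial>(lborel \<Otimes>\<^sub>M hyper_PiM k))"
    unfolding lborel_eq_distr_hyper[of k] by (rule nn_integral_distr) measurable
  also have "\<dots> = (\<integral>\<^sup>+p. F (insert_zero k (snd p)) * indicator {0<..<1::real} (fst p) \<partial>(lborel \<Otimes>\<^sub>M hyper_PiM k))"
    by (intro nn_integral_cong) (auto simp: insert_zero_insert_at insert_zero_nth split: prod.split split_indicator)
  also have "\<dots> = (\<integral>\<^sup>+y. \<integral>\<^sup>+t. F (insert_zero k y) * indicator {0<..<1::real} t \<partial>lborel \<partial>hyper_PiM k)"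
    by (subst nn_integral_snd[symmetric]) (auto intro!: measurable_compose[OF measurable_snd] borel_measurable_times_ennreal)
  also have "\<dots> = (\<integral>\<^sup>+y. F (insert_zero k y) \<partial>hyper_PiM k)"
    by (simp add: nn_integral_cmult)
  finally show ?thesis by simp
qed

lemma integral_eq_iterated:
  fixes F :: "real^'n \<Rightarrow> real"
  assumes F: "integrable lborel F"
  shows "(LINT x|lborel. F x) = (LINT y|hyper_PiM k. LINT t|lborel. F (insert_zero k y + t *\<^sub>R axis k 1))"
proof -
  interpret pair_sigma_finite "lborel :: real measure" "hyper_PiM k" by (rule pair_sigma_finite_hyper)
  let ?f = "\<lambda>(t, y). insert_zero k y + t *\<^sub>R axis k (1::real)"
  have [measurable]: "F \<in> borel_measurable borel" using F by auto
  have "integrable (distr (lborel \<Otimes>\<^sub>M hyper_PiM k) borel ?f) F"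
    using F unfolding lborel_eq_distr_hyper[of k, symmetric] .
  then have "integrable (lborel \<Otimes>\<^sub>M hyper_PiM k) (\<lambda>p. F (?f p))"
    by (subst (asm) integrable_distr_eq) auto
  then have i: "integrable (lborel \<Otimes>\<^sub>M hyper_PiM k) (\<lambda>(t, y). F (insert_zero k y + t *\<^sub>R axis k 1))"
    by (simp add: split_beta')
  have "(LINT x|lborel. F x) = (LINT p|(lborel \<Otimes>\<^sub>M hyper_PiM k). F (?f p))"
    by (subst lborel_eq_distr_hyper[of k], rule integral_distr) auto
  also have "\<dots> = (LINT y|hyper_PiM k. LINT t|lborel. F (insert_zero k y + t *\<^sub>R axis k 1))"
    using integral_snd[OF i] by (simp add: split_beta')
  finally show ?thesis .
qed

lemma integrable_bounded_support:
  fixes F :: "'a::euclidean_space \<Rightarrow> real"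
  assumes [measurable]: "F \<in> borel_measurable borel" and "\<And>x. \<bar>F x\<bar> \<le> B" and "\<And>x. R < norm x \<Longrightarrow> F x = 0"
  shows "integrable lborel F"
proof (rule integrableI_bounded_set[of "cball 0 R" _ _ B])
  show "emeasure lborel (cball (0::'a) R) < \<infinity>"
    using emeasure_lborel_cbox_finite bounded_cball emeasure_bounded_finite by blast
qed (use assms in auto)

abbreviation hyper_proj :: "'n::finite \<Rightarrow> real^'n \<Rightarrow> real^'n" where
  "hyper_proj k x \<equiv> insert_zero k (($) x)"

lemma hyper_proj_split: "hyper_proj k x + (x $ k) *\<^sub>R axis k 1 = x"
  by (simp add: vec_eq_iff insert_zero_nth axis_def)

lemma compact_support_bounded:
  assumes "continuous_on UNIV F" "\<And>x. R < norm x \<Longrightarrow> F x = 0"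
  obtains B where "\<And>x :: real^'n. \<bar>F x :: real\<bar> \<le> B" "0 \<le> B"
proof -
  have "compact (F ` cball 0 R)"
    using assms(1) by (intro compact_continuous_image) (auto intro: continuous_on_subset)
  then obtain B where B: "0 < B" "\<forall>y\<in>F ` cball 0 R. norm y \<le> B" using compact_imp_bounded bounded_pos by blast
  then have "0 \<le> B" by simp
  moreover have "\<bar>F x\<bar> \<le> B" for x
    using B assms(2)[of x] \<open>0 \<le> B\<close> by (cases "R < norm x") auto
  ultimately show ?thesis using that by blast
qed

text \<open>\<open>h\<close> composed with the projection need not have bounded support, but the
  slab bounds the missing coordinate by 1; hence the radius \<open>R + 1\<close>.\<close>

lemma integrable_slab:
  fixes h :: "real^'n \<Rightarrow> real"
  assumes cont: "continuous_on UNIV h" and supp: "\<And>x. R < norm x \<Longrightarrow> h x = 0"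
  shows "integrable lborel (\<lambda>x. indicator {x. 0 < x $ k \<and> x $ k < 1} x * h (hyper_proj k x))"
proof -
  obtain B where B: "\<And>x. \<bar>h x\<bar> \<le> B" "0 \<le> B" using compact_support_bounded[OF cont supp] by blast
  have [measurable]: "h \<in> borel_measurable borel" by (rule borel_measurable_continuous_onI[OF cont])
  show ?thesis
  proof (rule integrable_bounded_support[of _ B "R + 1"])
    fix x :: "real^'n" assume x: "R + 1 < norm x"
    have "norm x \<le> norm (hyper_proj k x) + \<bar>x $ k\<bar>"
      using norm_triangle_ineq[of "hyper_proj k x" "(x $ k) *\<^sub>R axis k 1"] by (simp add: hyper_proj_split)
    then have "R < norm (hyper_proj k x) \<or> \<not> \<bar>x $ k\<bar> < 1" using x by linarith
    then show "indicator {x. 0 < x $ k \<and> x $ k < 1} x * h (hyper_proj k x) = 0" using supp by (auto simp: indicator_def)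
  qed (use B in \<open>auto simp: indicator_def\<close>)
qed

context
  fixes h :: "real^'n \<Rightarrow> real" and Dh :: "real^'n \<Rightarrow> real^'n \<Rightarrow> real" and R :: real and j :: 'n
  assumes der: "\<And>x. (h has_derivative Dh x) (at x)"
    and cont: "continuous_on UNIV (\<lambda>x. Dh x (axis j 1))"
    and supp: "\<And>x. R < norm x \<Longrightarrow> h x = 0"
    and R: "0 \<le> R"
begin

lemma compact_support_derivative_zero: "R < norm x \<Longrightarrow> Dh x v = 0"
proof -
  assume x: "R < norm x"
  have "open {x :: real^'n. R < norm x}" by (intro open_Collect_less continuous_intros)
  then have "((\<lambda>_. 0) has_derivative Dh x) (at x)"
    by (rule has_derivative_transform_within_open[OF der]) (use x supp in auto)
  then have "Dh x = (\<lambda>_. 0)" using has_derivative_const has_derivative_unique by blast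
  then show ?thesis by simp
qed

lemma h_continuous: "continuous_on UNIV h"
  using der by (meson has_derivative_at_withinI has_derivative_continuous_on)

lemma integrable_partial:
  assumes [measurable]: "S \<in> sets borel"
  shows "integrable lborel (\<lambda>x. indicator S x * Dh x (axis j 1))"
proof -
  obtain B where B: "\<And>x. \<bar>Dh x (axis j 1)\<bar> \<le> B" "0 \<le> B"
    using compact_support_bounded[OF cont compact_support_derivative_zero] by blast
  have [measurable]: "(\<lambda>x. Dh x (axis j 1)) \<in> borel_measurable borel"
    by (rule borel_measurable_continuous_onI[OF cont])
  show ?thesis
    by (rule integrable_bounded_support[of _ B R])
      (use B in \<open>auto simp: compact_support_derivative_zero indicator_def\<close>)
qed

lemma line_derivative:
  "((\<lambda>t. h (p + t *\<^sub>R axis j 1)) has_field_derivative Dh (p + t *\<^sub>R axis j 1) (axis j 1)) (at t)"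
proof -
  have "((\<lambda>t. h (p + t *\<^sub>R axis j 1)) has_derivative (\<lambda>s. Dh (p + t *\<^sub>R axis j 1) (s *\<^sub>R axis j 1))) (at t)"
    by (rule has_derivative_compose[OF _ der]) (auto intro!: derivative_eq_intros)
  moreover have "Dh x (s *\<^sub>R v) = Dh x v * s" for x s v
    using has_derivative_linear[OF der] linear_scale[of "Dh x" s v] by (simp add: mult.commute)
  ultimately show ?thesis by (simp add: has_field_derivative_def)
qed

lemma line_integral:
  assumes "a \<le> b"
  shows "has_bochner_integral lborel (\<lambda>t. Dh (p + t *\<^sub>R axis j 1) (axis j 1) * indicator {a..b} t)
     (h (p + b *\<^sub>R axis j 1) - h (p + a *\<^sub>R axis j 1))"
proof (rule has_bochner_integral_FTC_Icc_real[OF assms])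
  show "isCont (\<lambda>t. Dh (p + t *\<^sub>R axis j 1) (axis j 1)) t" for t
    by (rule isCont_o2[where g = "\<lambda>x. Dh x (axis j 1)"])
      (use cont in \<open>auto simp: continuous_on_eq_continuous_at intro!: continuous_intros\<close>)
qed (rule line_derivative)

lemma norm_insert_at: "\<bar>t\<bar> \<le> norm (insert_zero j y + t *\<^sub>R axis j (1::real))"
  using component_le_norm_cart[of "insert_zero j y + t *\<^sub>R axis j (1::real)" j]
  by (simp add: insert_zero_nth)

text \<open>Fundamental theorem along a complete line. The interval reaches \<open>R + 1\<close> in
  both directions because \<open>h\<close> is known to vanish only where the norm exceeds
  \<open>R\<close>.\<close>

lemma line_integral_UNIV: "(LINT t|lborel. Dh (insert_zero j y + t *\<^sub>R axis j 1) (axis j 1)) = 0"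
proof -
  let ?p = "insert_zero j y"
  have "(LINT t|lborel. Dh (?p + t *\<^sub>R axis j 1) (axis j 1)) =
    (LINT t|lborel. Dh (?p + t *\<^sub>R axis j 1) (axis j 1) * indicator {-(R + 1)..R + 1} t)"
  proof (rule Bochner_Integration.integral_cong[OF refl])
    fix t
    show "Dh (?p + t *\<^sub>R axis j 1) (axis j 1) = Dh (?p + t *\<^sub>R axis j 1) (axis j 1) * indicator {-(R + 1)..R + 1} t"
      using compact_support_derivative_zero[of "?p + t *\<^sub>R axis j 1"] norm_insert_at[of t y]
      by (cases "\<bar>t\<bar> \<le> R + 1") (auto simp: indicator_def abs_le_iff)
  qed
  also have "\<dots> = h (?p + (R + 1) *\<^sub>R axis j 1) - h (?p + (- (R + 1)) *\<^sub>R axis j 1)"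
    by (rule has_bochner_integral_integral_eq[OF line_integral]) (use R in auto)
  also have "\<dots> = 0"
    using supp[of "?p + (R + 1) *\<^sub>R axis j 1"] supp[of "?p + (- (R + 1)) *\<^sub>R axis j 1"]
      norm_insert_at[of "R + 1" y] norm_insert_at[of "- (R + 1)" y] R by linarith
  finally show ?thesis .
qed

lemma line_integral_half: "(LINT t|lborel. indicator {..<0} t * Dh (insert_zero j y + t *\<^sub>R axis j 1) (axis j 1)) = h (insert_zero j y)"
proof -
  let ?p = "insert_zero j y"
  have m [measurable]: "(\<lambda>t. Dh (?p + t *\<^sub>R axis j 1) (axis j 1)) \<in> borel_measurable borel"
    by (rule borel_measurable_continuous_onI, rule continuous_on_compose2[OF cont]) (auto intro!: continuous_intros)
  have "(LINT t|lborel. indicator {..<0} t * Dh (?p + t *\<^sub>R axis j 1) (axis j 1)) =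
    (LINT t|lborel. Dh (?p + t *\<^sub>R axis j 1) (axis j 1) * indicator {-(R + 1)..0} t)"
  proof (rule integral_cong_AE)
    \<comment> \<open>Within the support the open half-line and the closed interval differ in the
      point 0 only, a null set.\<close>
    show "AE t in lborel. indicator {..<0} t * Dh (?p + t *\<^sub>R axis j 1) (axis j 1) =
       Dh (?p + t *\<^sub>R axis j 1) (axis j 1) * indicator {-(R + 1)..0} t"
      using AE_lborel_singleton[of 0]
    proof eventually_elim
      case (elim t)
      show ?case using elim compact_support_derivative_zero[of "?p + t *\<^sub>R axis j 1"] norm_insert_at[of t y]
        by (cases "\<bar>t\<bar> \<le> R + 1") (auto simp: indicator_def abs_le_iff)
    qed
  qed (use m in auto)
  also have "\<dots> = h (?p + 0 *\<^sub>R axis j 1) - h (?p + (- (R + 1)) *\<^sub>R axis j 1)"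
    by (rule has_bochner_integral_integral_eq[OF line_integral]) (use R in auto)
  also have "\<dots> = h ?p"
    using supp[of "?p + (- (R + 1)) *\<^sub>R axis j 1"] norm_insert_at[of "- (R + 1)" y] R by simp
  finally show ?thesis .
qed

lemma integral_partial_zero: "(LINT x|lborel. Dh x (axis j 1)) = 0"
  using integral_eq_iterated[of "\<lambda>x. Dh x (axis j 1)" j] integrable_partial[of UNIV]
  by (simp add: line_integral_UNIV)

text \<open>Lines parallel to the axis \<open>j\<close> stay on one side of the hyperplane, so the
  indicator is constant along them and each line contributes 0.\<close>

lemma half_space_partial_tangential:
  assumes "j \<noteq> k"
  shows "(LINT x|lborel. indicator {x. x $ k < 0} x * Dh x (axis j 1)) = 0"
proof -
  have "indicator {x. x $ k < 0} (insert_zero j y + t *\<^sub>R axis j 1) = (indicator {y. y k < 0} y :: real)" for y t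
    using assms by (simp add: insert_zero_nth axis_def indicator_def)
  then show ?thesis
    using integral_eq_iterated[OF integrable_partial[of "{x. x $ k < 0}"], of j]
    by (simp add: line_integral_UNIV)
qed

text \<open>On each half-line in the direction \<open>j\<close> the fundamental theorem leaves the
  value of \<open>h\<close> on the hyperplane. The right-hand side is the integral of these values,
  written over the unit slab.\<close>

lemma half_space_partial_normal:
  "(LINT x|lborel. indicator {x. x $ j < 0} x * Dh x (axis j 1)) =
   (LINT x|lborel. indicator {x. 0 < x $ j \<and> x $ j < 1} x * h (hyper_proj j x))"
proof -
  have "indicator {x. x $ j < 0} (insert_zero j y + t *\<^sub>R axis j 1) = (indicator {..<0} t :: real)" for y t
    by (simp add: insert_zero_nth indicator_def)
  then have 1: "(LINT x|lborel. indicator {x. x $ j < 0} x * Dh x (axis j 1)) = (LINT y|hyper_PiM j. h (insert_zero j y))"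
    using integral_eq_iterated[OF integrable_partial[of "{x. x $ j < 0}"], of j]
    by (simp add: line_integral_half)
  let ?F = "\<lambda>x. indicator {x. 0 < x $ j \<and> x $ j < 1} x * h (hyper_proj j x)"
  have "integrable lborel ?F" by (rule integrable_slab[OF h_continuous supp])
  from integral_eq_iterated[OF this, of j]
  have "(LINT x|lborel. ?F x) = (LINT y|hyper_PiM j. LINT t|lborel. indicator {0<..<1::real} t * h (insert_zero j y))"
    by (simp add: insert_zero_insert_at insert_zero_nth indicator_def)
  also have "\<dots> = (LINT y|hyper_PiM j. h (insert_zero j y))" by simp
  finally show ?thesis using 1 by simp
qed

end

section \<open>Measures prescribed in charts\<close>

text \<open>Both measures of the theorem are defined by \<open>THE\<close> from their values in
  charts, so unique existence is what gives them meaning. Second countability yields a countable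
  subcover, which is made disjoint; the measure is the sum of the local ones over the pieces, and
  compatibility makes it agree with every \<open>m c\<close>.\<close>

lemma glue_measures:
  fixes D :: "'i \<Rightarrow> 'm::second_countable_topology set" and m :: "'i \<Rightarrow> 'm measure"
  assumes op: "\<And>c. c \<in> C \<Longrightarrow> open (D c)" and cover: "\<Union>(D ` C) = UNIV"
    and sets_m: "\<And>c. c \<in> C \<Longrightarrow> sets (m c) = sets borel"
    and compat: "\<And>c c' B. c \<in> C \<Longrightarrow> c' \<in> C \<Longrightarrow> B \<in> sets borel \<Longrightarrow> B \<subseteq> D c \<inter> D c' \<Longrightarrow>
      emeasure (m c) B = emeasure (m c') B"
  shows "\<exists>!\<mu>. sets \<mu> = sets borel \<and>
    (\<forall>c\<in>C. \<forall>B\<in>sets borel. B \<subseteq> D c \<longrightarrow> emeasure \<mu> B = emeasure (m c) B)"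
proof -
  obtain F' where F': "F' \<subseteq> D ` C" "countable F'" "\<Union>F' = \<Union>(D ` C)"
    using Lindelof[of "D ` C"] op by blast
  obtain C0 where C0: "C0 \<subseteq> C" "countable C0" "F' = D ` C0"
    using F' countable_subset_image[of F' D C] by metis
  have C0_ne: "C0 \<noteq> {}" using F'(3) C0(3) cover by auto
  define c where "c = from_nat_into C0"
  have c: "c n \<in> C" for n using C0(1) from_nat_into[OF C0_ne] by (auto simp: c_def)
  have cov: "(\<Union>n. D (c n)) = UNIV"
    using F'(3) C0 cover range_from_nat_into[OF C0_ne C0(2)] by (metis c_def image_image)
  define E where "E = disjointed (\<lambda>n. D (c n))"
  have ED: "E n \<subseteq> D (c n)" for n unfolding E_def by (rule disjointed_subset)
  have Ed: "disjoint_family E" unfolding E_def by (rule disjoint_family_disjointed)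
  have EU: "(\<Union>n. E n) = UNIV" unfolding E_def UN_disjointed_eq by (rule cov)
  have E [measurable]: "E n \<in> sets borel" for n
  proof -
    have "range (disjointed (\<lambda>n. D (c n))) \<subseteq> sets borel"
      by (rule sets.range_disjointed_sets) (use op c in auto)
    then show ?thesis unfolding E_def by auto
  qed
  have split: "emeasure M B = (\<Sum>n. emeasure M (B \<inter> E n))" if "sets M = sets borel" "B \<in> sets borel" for M B
  proof -
    have "(\<Sum>n. emeasure M (B \<inter> E n)) = emeasure M (\<Union>n. B \<inter> E n)"
      by (rule suminf_emeasure) (use that Ed in \<open>auto simp: disjoint_family_on_def\<close>)
    also have "(\<Union>n. B \<inter> E n) = B" using EU by auto
    finally show ?thesis by simp
  qed
  define \<mu> where "\<mu> = measure_of UNIV (sets borel) (\<lambda>B. \<Sum>n. emeasure (m (c n)) (B \<inter> E n))"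
  have sets_\<mu>: "sets \<mu> = sets borel" unfolding \<mu>_def
    by (metis sets.sets_measure_of_eq space_borel)
  have em: "emeasure \<mu> B = (\<Sum>n. emeasure (m (c n)) (B \<inter> E n))" if "B \<in> sets borel" for B
  proof (rule emeasure_measure_of[OF \<mu>_def])
    show "sets borel \<subseteq> Pow UNIV" by simp
    show "B \<in> sets \<mu>" using that sets_\<mu> by simp
    show "positive (sets \<mu>) (\<lambda>B. \<Sum>n. emeasure (m (c n)) (B \<inter> E n))"
      by (simp add: positive_def)
    show "countably_additive (sets \<mu>) (\<lambda>B. \<Sum>n. emeasure (m (c n)) (B \<inter> E n))"
    proof (rule countably_additiveI)
      fix S :: "nat \<Rightarrow> 'm set"
      assume S: "range S \<subseteq> sets \<mu>" "disjoint_family S"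
      \<comment> \<open>Countable additivity needs the two sums interchanged, which is allowed for
        nonnegative terms; one sum is read as an integral for the counting measure.\<close>
      have "(\<Sum>i. \<Sum>n. emeasure (m (c n)) (S i \<inter> E n)) =
          (\<Sum>i. \<integral>\<^sup>+n. emeasure (m (c n)) (S i \<inter> E n) \<partial>count_space UNIV)"
        by (simp add: nn_integral_count_space_nat)
      also have "\<dots> = (\<integral>\<^sup>+n. (\<Sum>i. emeasure (m (c n)) (S i \<inter> E n)) \<partial>count_space UNIV)"
        by (rule nn_integral_suminf[symmetric]) simp
      also have "\<dots> = (\<Sum>n. \<Sum>i. emeasure (m (c n)) (S i \<inter> E n))"
        by (rule nn_integral_count_space_nat)
      also have "\<dots> = (\<Sum>n. emeasure (m (c n)) (\<Union>i. S i \<inter> E n))"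
        using S sets_\<mu> sets_m[OF c]
        by (intro suminf_cong suminf_emeasure) (auto simp: disjoint_family_on_def)
      finally show "(\<Sum>i. \<Sum>n. emeasure (m (c n)) (S i \<inter> E n)) = (\<Sum>n. emeasure (m (c n)) (\<Union>(range S) \<inter> E n))"
        by (simp add: Int_commute)
    qed
  qed
  show ?thesis
  proof (rule ex1I[of _ \<mu>], intro conjI ballI impI)
    fix a B assume a: "a \<in> C" and B: "B \<in> sets borel" "B \<subseteq> D a"
    have "emeasure \<mu> B = (\<Sum>n. emeasure (m (c n)) (B \<inter> E n))" by (rule em[OF B(1)])
    also have "\<dots> = (\<Sum>n. emeasure (m a) (B \<inter> E n))"
      using ED B a c by (intro suminf_cong compat) auto
    also have "\<dots> = emeasure (m a) B" using split[OF sets_m[OF a] B(1)] by simp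
    finally show "emeasure \<mu> B = emeasure (m a) B" .
  next
    fix \<mu>' :: "'m measure"
    assume \<mu>': "sets \<mu>' = sets borel \<and> (\<forall>c\<in>C. \<forall>B\<in>sets borel. B \<subseteq> D c \<longrightarrow> emeasure \<mu>' B = emeasure (m c) B)"
    show "\<mu>' = \<mu>"
    proof (rule measure_eqI)
      fix B assume "B \<in> sets \<mu>'"
      then have B: "B \<in> sets borel" using \<mu>' by simp
      have "emeasure \<mu>' B = (\<Sum>n. emeasure \<mu>' (B \<inter> E n))" using split B \<mu>' by blast
      also have "\<dots> = (\<Sum>n. emeasure (m (c n)) (B \<inter> E n))"
      proof (rule suminf_cong)
        fix n
        have "\<forall>B\<in>sets borel. B \<subseteq> D (c n) \<longrightarrow> emeasure \<mu>' B = emeasure (m (c n)) B"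
          using \<mu>' c by blast
        moreover have "B \<inter> E n \<in> sets borel" using B by measurable
        ultimately show "emeasure \<mu>' (B \<inter> E n) = emeasure (m (c n)) (B \<inter> E n)" using ED[of n] by blast
      qed
      also have "\<dots> = emeasure \<mu> B" by (rule em[OF B, symmetric])
      finally show "emeasure \<mu>' B = emeasure \<mu> B" .
    qed (use \<mu>' sets_\<mu> in simp)
  qed (rule sets_\<mu>)
qed

text \<open>On the chart domain the measure is the image of a density under \<open>\<psi>\<close>,
  and \<open>F\<close> vanishes elsewhere. Only where \<open>w\<close> is nonzero must
  \<open>\<psi>\<close> land in the domain, so it can be a parametrisation with arbitrary Borel
  values elsewhere.\<close>

lemma integral_by_chart:
  fixes F :: "'m::topological_space \<Rightarrow> real" and w :: "'a::euclidean_space \<Rightarrow> real"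
  assumes sets: "sets \<mu> = sets borel" and D: "open D"
    and w [measurable]: "w \<in> borel_measurable borel" and w0: "\<And>x. 0 \<le> w x"
    and \<psi> [measurable]: "\<psi> \<in> borel_measurable borel" and wD: "\<And>x. w x \<noteq> 0 \<Longrightarrow> \<psi> x \<in> D"
    and eq: "\<And>B. B \<in> sets borel \<Longrightarrow> B \<subseteq> D \<Longrightarrow>
      emeasure \<mu> B = emeasure (distr (density lborel (\<lambda>x. ennreal (w x))) borel \<psi>) B"
    and F [measurable]: "F \<in> borel_measurable borel" and F0: "\<And>p. p \<notin> D \<Longrightarrow> F p = 0"
  shows "integrable \<mu> F \<longleftrightarrow> integrable lborel (\<lambda>x. w x * F (\<psi> x))"
    and "(LINT p|\<mu>. F p) = (LINT x|lborel. w x * F (\<psi> x))"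
proof -
  let ?m = "distr (density lborel (\<lambda>x. ennreal (w x))) borel \<psi>"
  note sets [measurable_cong]
  have [measurable]: "D \<in> sets borel" using D by simp
  have w_0: "w x = 0" if "\<psi> x \<notin> D" for x using wD that by blast
  have dens: "density \<mu> (\<lambda>p. ennreal (indicator D p)) = ?m"
  proof (rule measure_eqI)
    fix B assume "B \<in> sets (density \<mu> (\<lambda>p. ennreal (indicator D p)))"
    then have B [measurable]: "B \<in> sets borel" using sets by simp
    have "emeasure (density \<mu> (\<lambda>p. ennreal (indicator D p))) B = (\<integral>\<^sup>+p. ennreal (indicator D p) * indicator B p \<partial>\<mu>)"
      by (rule emeasure_density) (use sets in auto)
    also have "\<dots> = (\<integral>\<^sup>+p. indicator (B \<inter> D) p \<partial>\<mu>)"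
      by (intro nn_integral_cong) (simp split: split_indicator)
    also have "\<dots> = emeasure \<mu> (B \<inter> D)" by (rule nn_integral_indicator) (use sets in simp)
    also have "\<dots> = emeasure ?m (B \<inter> D)" by (rule eq) auto
    also have "\<dots> = (\<integral>\<^sup>+x. ennreal (w x) * indicator (\<psi> -` (B \<inter> D)) x \<partial>lborel)"
      using measurable_sets[of \<psi> borel borel "B \<inter> D"] by (simp add: emeasure_distr emeasure_density)
    also have "\<dots> = (\<integral>\<^sup>+x. ennreal (w x) * indicator (\<psi> -` B) x \<partial>lborel)"
      by (intro nn_integral_cong) (auto simp: w_0 split: split_indicator)
    also have "\<dots> = emeasure ?m B"
      using measurable_sets[of \<psi> borel borel B] by (simp add: emeasure_distr emeasure_density)
    finally show "emeasure (density \<mu> (\<lambda>p. ennreal (indicator D p))) B = emeasure ?m B" .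
  qed (use sets in simp)
  have indF: "(\<lambda>p. indicator D p *\<^sub>R F p) = F" using F0 by (auto simp: indicator_def fun_eq_iff)
  have F\<mu>: "F \<in> borel_measurable \<mu>" by measurable
  have "integrable \<mu> F \<longleftrightarrow> integrable (density \<mu> (\<lambda>p. ennreal (indicator D p))) F"
    by (subst integrable_density) (auto simp: indF[unfolded real_scaleR_def] F\<mu>)
  also have "\<dots> \<longleftrightarrow> integrable (density lborel (\<lambda>x. ennreal (w x))) (\<lambda>x. F (\<psi> x))"
    unfolding dens by (rule integrable_distr_eq) auto
  also have "\<dots> \<longleftrightarrow> integrable lborel (\<lambda>x. w x * F (\<psi> x))"
    by (subst integrable_density) (auto simp: w0)
  finally show "integrable \<mu> F \<longleftrightarrow> integrable lborel (\<lambda>x. w x * F (\<psi> x))" .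
  have "(LINT p|\<mu>. F p) = (LINT p|density \<mu> (\<lambda>p. ennreal (indicator D p)). F p)"
    by (subst integral_density) (auto simp: indF[unfolded real_scaleR_def] F\<mu>)
  also have "\<dots> = (LINT x|density lborel (\<lambda>x. ennreal (w x)). F (\<psi> x))"
    unfolding dens by (rule integral_distr) auto
  also have "\<dots> = (LINT x|lborel. w x * F (\<psi> x))"
    by (subst integral_density) (auto simp: w0)
  finally show "(LINT p|\<mu>. F p) = (LINT x|lborel. w x * F (\<psi> x))" .
qed

lemma positive_definite_det_pos:
  fixes G :: "real^'n^'n"
  assumes pos: "\<And>w. w \<noteq> 0 \<Longrightarrow> w \<bullet> (G *v w) > 0"
  shows "det G > 0"
proof (rule ccontr)
  assume neg: "\<not> det G > 0"
  \<comment> \<open>Straight path from \<open>G\<close> at 0 to the identity at 1. All its matrices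
    are positive definite, hence invertible, so the determinant cannot change sign on the
    way.\<close>
  define P where "P = (\<lambda>t::real. t *\<^sub>R mat 1 + (1 - t) *\<^sub>R G)"
  have "continuous_on {0..1} (\<lambda>t. det (P t))"
    unfolding P_def det_def by (intro continuous_intros)
  moreover have "det (P 0) \<le> 0" "0 \<le> det (P 1)" using neg by (auto simp: P_def)
  ultimately obtain t where t: "0 \<le> t" "t \<le> 1" "det (P t) = 0"
    using IVT'[of "\<lambda>t. det (P t)" 0 0 1] by auto
  then have "\<not> invertible (P t)" by (simp add: invertible_det_nz)
  then obtain w where w: "w \<noteq> 0" "P t *v w = 0"
    unfolding invertible_left_inverse matrix_left_invertible_ker by auto
  have "P t *v w = t *\<^sub>R (mat 1 *v w) + (1 - t) *\<^sub>R (G *v w)"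
    unfolding P_def matrix_vector_mult_add_rdistrib
    by (simp only: matrix_vector_mult_def vec_eq_iff vector_scaleR_component vec_lambda_beta
      vector_add_component sum_distrib_left mult.assoc real_scaleR_def simp_thms)
  then have "t *\<^sub>R w + (1 - t) *\<^sub>R (G *v w) = 0" using w(2) by simp
  then have "w \<bullet> (t *\<^sub>R w + (1 - t) *\<^sub>R (G *v w)) = 0" by simp
  then have "0 = t * (w \<bullet> w) + (1 - t) * (w \<bullet> (G *v w))"
    by (simp add: inner_add_right)
  moreover have "w \<bullet> w > 0" "w \<bullet> (G *v w) > 0" using w pos by auto
  moreover have "t * (w \<bullet> w) + (1 - t) * (w \<bullet> (G *v w)) > 0"
  proof (cases "t = 0")
    case False
    then have "t * (w \<bullet> w) > 0" using t \<open>w \<bullet> w > 0\<close> by simp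
    moreover have "(1 - t) * (w \<bullet> (G *v w)) \<ge> 0" using t \<open>w \<bullet> (G *v w) > 0\<close> by simp
    ultimately show ?thesis by linarith
  qed (use \<open>w \<bullet> (G *v w) > 0\<close> in simp)
  ultimately show False by simp
qed

section \<open>Riemannian manifolds\<close>

lemma inner_transpose_mult: "v \<bullet> (transpose M *v w) = (M *v v) \<bullet> (w :: real^'n)" for M :: "real^'m^'n"
  by (metis dot_lmul_matrix inner_commute transpose_matrix_vector)

locale riemannian_manifold =
  fixes A :: "('m::{t2_space,second_countable_topology}, 'n::finite) chart set"
    and g :: "('m, 'n) chart \<Rightarrow> real^'n \<Rightarrow> real^'n^'n"
  assumes smooth_structure: "smooth_structure A"
    and metric: "riemannian_metric A g"
begin

abbreviation overlap :: "('m, 'n) chart \<Rightarrow> ('m, 'n) chart \<Rightarrow> (real^'n) set" where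
  "overlap c c' \<equiv> cmap c ` (cdom c \<inter> cdom c')"

lemma topological_chart: "c \<in> A \<Longrightarrow> topological_chart c"
  and compatible: "c \<in> A \<Longrightarrow> c' \<in> A \<Longrightarrow> compatible c c'"
  and ex_chart: "\<exists>c\<in>A. p \<in> cdom c"
  using smooth_structure unfolding smooth_structure_def by blast+

lemma chart_homeomorphism: "c \<in> A \<Longrightarrow> homeomorphism (cdom c) (crange c) (cmap c) (cinv c)"
  and open_cdom: "c \<in> A \<Longrightarrow> open (cdom c)" and open_crange: "c \<in> A \<Longrightarrow> open (crange c)"
  using topological_chart unfolding topological_chart_def by blast+

lemma chart_at_mem: "chart_at A p \<in> A" "p \<in> cdom (chart_at A p)"
proof -
  have "chart_at A p \<in> A \<and> p \<in> cdom (chart_at A p)"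
    unfolding chart_at_def by (rule someI_ex) (use ex_chart in blast)
  then show "chart_at A p \<in> A" "p \<in> cdom (chart_at A p)" by auto
qed

lemma cinv_cmap: "c \<in> A \<Longrightarrow> p \<in> cdom c \<Longrightarrow> cinv c (cmap c p) = p"
  using chart_homeomorphism by (auto simp: homeomorphism_def)

lemma cmap_cinv: "x \<in> crange c \<Longrightarrow> cmap c (cinv c x) = x"
  by (rule f_inv_into_f)

lemma cinv_cdom: "x \<in> crange c \<Longrightarrow> cinv c x \<in> cdom c"
  by (rule inv_into_into)

lemma continuous_on_cmap: "c \<in> A \<Longrightarrow> continuous_on (cdom c) (cmap c)"
  and continuous_on_cinv: "c \<in> A \<Longrightarrow> continuous_on (crange c) (cinv c)"
  using chart_homeomorphism by (auto simp: homeomorphism_def)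

lemma cmap_image_eq: "c \<in> A \<Longrightarrow> B \<subseteq> cdom c \<Longrightarrow> cmap c ` B = crange c \<inter> cinv c -` B"
proof (intro set_eqI iffI)
  assume c: "c \<in> A" and B: "B \<subseteq> cdom c"
  fix x
  show "x \<in> crange c \<inter> cinv c -` B" if "x \<in> cmap c ` B"
    using that B cinv_cmap[OF c] by auto
  show "x \<in> cmap c ` B" if "x \<in> crange c \<inter> cinv c -` B"
  proof -
    have "cmap c (cinv c x) \<in> cmap c ` B" using that by (intro imageI) auto
    then show ?thesis using cmap_cinv[of x c] that by auto
  qed
qed

lemma open_cmap_image: "c \<in> A \<Longrightarrow> open U \<Longrightarrow> U \<subseteq> cdom c \<Longrightarrow> open (cmap c ` U)"
  by (subst cmap_image_eq) (simp_all only: continuous_open_preimage[OF continuous_on_cinv open_crange])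

lemma overlap_iff: "c \<in> A \<Longrightarrow> x \<in> overlap c c' \<longleftrightarrow> x \<in> crange c \<and> cinv c x \<in> cdom c'"
  using cmap_image_eq[of c "cdom c \<inter> cdom c'"] cinv_cdom[of x c] by blast

lemma open_overlap: "c \<in> A \<Longrightarrow> c' \<in> A \<Longrightarrow> open (overlap c c')"
  by (intro open_cmap_image) (auto intro: open_cdom)

lemma transition_overlap:
  assumes "c \<in> A" "c' \<in> A" "x \<in> overlap c c'"
  shows "transition c c' x \<in> overlap c' c" "transition c' c (transition c c' x) = x"
    "cinv c' (transition c c' x) = cinv c x"
  using assms by (auto simp: transition_def cinv_cmap)

lemma Ck_on_transition: "c \<in> A \<Longrightarrow> c' \<in> A \<Longrightarrow> Ck_on k (overlap c c') (transition c c')"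
  using compatible unfolding compatible_def by (blast intro: smooth_on_imp_Ck_on)

lemma homeomorphism_transition:
  assumes "c \<in> A" "c' \<in> A"
  shows "homeomorphism (overlap c c') (overlap c' c) (transition c c') (transition c' c)"
proof (rule homeomorphismI)
  show "continuous_on (overlap c c') (transition c c')" "continuous_on (overlap c' c) (transition c' c)"
    using Ck_on_continuous[OF Ck_on_transition[OF assms, of 0]] Ck_on_continuous[OF Ck_on_transition[OF assms(2,1), of 0]] .
  show "transition c c' ` overlap c c' \<subseteq> overlap c' c" "transition c' c ` overlap c' c \<subseteq> overlap c c'"
    using transition_overlap(1)[OF assms] transition_overlap(1)[OF assms(2,1)] by (blast+)
  show "transition c' c (transition c c' x) = x" if "x \<in> overlap c c'" for x
    by (rule transition_overlap(2)[OF assms that])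
  show "transition c c' (transition c' c y) = y" if "y \<in> overlap c' c" for y
    by (rule transition_overlap(2)[OF assms(2,1) that])
qed

lemma transition_has_derivative:
  assumes "c \<in> A" "c' \<in> A" "x \<in> overlap c c'"
  shows "(transition c c' has_derivative (*v) (jacobian c c' x)) (at x)"
proof -
  have "(transition c c' has_derivative frechet_derivative (transition c c') (at x)) (at x)"
    using Ck_on_has_derivative[OF Ck_on_transition[OF assms(1,2), of 1]] assms(3) by simp
  moreover from this have "frechet_derivative (transition c c') (at x) = (*v) (jacobian c c' x)"
    unfolding jacobian_def by (intro matrix_vector_mul(2)[symmetric] has_derivative_linear)
  ultimately show ?thesis by simp
qed

lemma jacobian_inverse:
  assumes "c \<in> A" "c' \<in> A" "x \<in> overlap c c'"
  shows "jacobian c' c (transition c c' x) ** jacobian c c' x = mat 1"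
proof -
  have "((\<lambda>x. transition c' c (transition c c' x)) has_derivative
      (\<lambda>v. jacobian c' c (transition c c' x) *v (jacobian c c' x *v v))) (at x)"
    using has_derivative_compose[OF transition_has_derivative[OF assms]
        transition_has_derivative[OF assms(2,1) transition_overlap(1)[OF assms]]] .
  moreover have "((\<lambda>x. transition c' c (transition c c' x)) has_derivative (\<lambda>v. v)) (at x)"
    by (rule has_derivative_transform_within_open[OF has_derivative_ident open_overlap[OF assms(1,2)] assms(3)])
      (simp add: transition_overlap(2)[OF assms(1,2)])
  ultimately have "(\<lambda>v. jacobian c' c (transition c c' x) *v (jacobian c c' x *v v)) = (\<lambda>v. v)"
    by (rule has_derivative_unique)
  then have "(jacobian c' c (transition c c' x) ** jacobian c c' x) *v v = mat 1 *v v" for v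
    by (simp add: matrix_vector_mul_assoc[symmetric] fun_eq_iff)
  then show ?thesis unfolding matrix_eq by simp
qed

lemma det_jacobian: "c \<in> A \<Longrightarrow> c' \<in> A \<Longrightarrow> x \<in> overlap c c' \<Longrightarrow> det (jacobian c c' x) \<noteq> 0"
proof
  assume a: "c \<in> A" "c' \<in> A" "x \<in> overlap c c'" and "det (jacobian c c' x) = 0"
  then have "det (jacobian c' c (transition c c' x) ** jacobian c c' x) = 0" by (simp add: det_mul)
  then show False unfolding jacobian_inverse[OF a] by simp
qed

lemma Ck_on_metric: "c \<in> A \<Longrightarrow> Ck_on k (crange c) (\<lambda>x. g c x $ i $ j)"
  using metric unfolding riemannian_metric_def by (blast intro: smooth_on_imp_Ck_on)

lemma metric_pos: "c \<in> A \<Longrightarrow> x \<in> crange c \<Longrightarrow> w \<noteq> 0 \<Longrightarrow> w \<bullet> (g c x *v w) > 0"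
  and metric_sym: "c \<in> A \<Longrightarrow> x \<in> crange c \<Longrightarrow> transpose (g c x) = g c x"
  and metric_transform: "c \<in> A \<Longrightarrow> c' \<in> A \<Longrightarrow> x \<in> overlap c c' \<Longrightarrow>
    g c x = transpose (jacobian c c' x) ** g c' (transition c c' x) ** jacobian c c' x"
  using metric unfolding riemannian_metric_def by blast+

lemma metric_inner_commute:
  assumes "c \<in> A" "x \<in> crange c" shows "v \<bullet> (g c x *v w) = w \<bullet> (g c x *v v)"
proof -
  have "v \<bullet> (transpose (g c x) *v w) = (g c x *v v) \<bullet> w" by (rule inner_transpose_mult)
  then show ?thesis unfolding metric_sym[OF assms] by (simp only: inner_commute)
qed

lemma metric_transform_inner:
  assumes "c \<in> A" "c' \<in> A" "x \<in> overlap c c'"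
  shows "v \<bullet> (g c x *v w) = (jacobian c c' x *v v) \<bullet> (g c' (transition c c' x) *v (jacobian c c' x *v w))"
  unfolding metric_transform[OF assms] matrix_vector_mul_assoc[symmetric] inner_transpose_mult ..

lemma det_metric_pos: "c \<in> A \<Longrightarrow> x \<in> crange c \<Longrightarrow> det (g c x) > 0"
  using positive_definite_det_pos metric_pos by blast

lemma Ck_on_sqrt_det: "c \<in> A \<Longrightarrow> Ck_on k (crange c) (\<lambda>x. sqrt (det (g c x)))"
  by (rule Ck_on_compose[OF open_crange _ _ Ck_on_sqrt]) (auto simp: det_metric_pos intro!: Ck_on_det open_crange Ck_on_metric)

lemma Ck_on_inverse_metric: "c \<in> A \<Longrightarrow> Ck_on k (crange c) (\<lambda>x. matrix_inv (g c x) $ i $ j)"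
  using det_metric_pos by (intro Ck_on_matrix_inv open_crange Ck_on_metric) (auto simp: less_imp_neq[THEN not_sym])

text \<open>Determinants in the transformation law give the square of the Jacobian determinant; its
  root is exactly the factor in the change of variables formula, which is why the volume does not
  depend on the chart.\<close>

lemma sqrt_det_transform:
  assumes "c \<in> A" "c' \<in> A" "x \<in> overlap c c'"
  shows "sqrt (det (g c x)) = \<bar>det (jacobian c c' x)\<bar> * sqrt (det (g c' (transition c c' x)))"
proof -
  let ?d = "det (jacobian c c' x)" and ?e = "det (g c' (transition c c' x))"
  have "det (g c x) = ?d\<^sup>2 * ?e"
    unfolding metric_transform[OF assms] det_mul det_transpose power2_eq_square by (simp only: mult_ac)
  then have "sqrt (det (g c x)) = sqrt (?d\<^sup>2) * sqrt ?e" by (simp only: real_sqrt_mult)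
  then show ?thesis by (simp only: real_sqrt_abs)
qed

text \<open>\<open>smooth_fun_on\<close> provides an extension in some chart of its own choice.
  Composition with the transition map moves it to a chart prescribed in advance, such as a boundary
  chart.\<close>

lemma local_extension:
  assumes u: "smooth_fun_on A S u" and p: "p \<in> S" "p \<in> cdom c" and c: "c \<in> A"
  obtains W F where "open W" "cmap c p \<in> W" "W \<subseteq> crange c" "\<And>k. Ck_on k W F"
    "\<And>x. x \<in> W \<Longrightarrow> cinv c x \<in> S \<Longrightarrow> F x = u (cinv c x)"
proof -
  obtain c1 W1 F1 where c1: "c1 \<in> A" "p \<in> cdom c1" "open W1" "cmap c1 p \<in> W1" "smooth_on W1 F1"
    and F1: "\<And>x. x \<in> W1 \<inter> crange c1 \<Longrightarrow> cinv c1 x \<in> S \<Longrightarrow> F1 x = u (cinv c1 x)"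
    using u p(1) unfolding smooth_fun_on_def by blast
  define W where "W = overlap c c1 \<inter> transition c c1 -` W1"
  define F where "F = (\<lambda>x. F1 (transition c c1 x))"
  have T: "transition c c1 x \<in> overlap c1 c" "cinv c1 (transition c c1 x) = cinv c x" if "x \<in> W" for x
    using that transition_overlap[OF c c1(1)] by (auto simp: W_def)
  have W: "open W" unfolding W_def
    by (rule continuous_open_preimage[OF Ck_on_continuous[OF Ck_on_transition[OF c c1(1), of 0]] open_overlap[OF c c1(1)] c1(3)])
  show ?thesis
  proof (rule that[of W F])
    show "cmap c p \<in> W" using p c c1 by (auto simp: W_def transition_def cinv_cmap)
    show "W \<subseteq> crange c" by (auto simp: W_def)
    show "Ck_on k W F" for k unfolding F_def
      by (rule Ck_on_compose[OF W c1(3) _ smooth_on_imp_Ck_on[OF c1(5)] Ck_on_subset[OF Ck_on_transition[OF c c1(1)]]])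
        (auto simp: W_def)
    show "F x = u (cinv c x)" if "x \<in> W" "cinv c x \<in> S" for x
    proof -
      have "transition c c1 x \<in> W1 \<inter> crange c1" using that(1) T(1)[OF that(1)] by (auto simp: W_def)
      then show ?thesis using F1[of "transition c c1 x"] T(2)[OF that(1)] that(2) by (simp add: F_def)
    qed
  qed (rule W)
qed

text \<open>The analogue for families, with prescribed charts at the source and at the target: the
  extension is composed with a transition map on each side, and the parameter is left alone.\<close>

lemma local_family_extension:
  assumes f: "smooth_family_on A I S f" and s: "s \<in> I" and p: "p \<in> S" "p \<in> cdom c" and c: "c \<in> A"
    and q: "f s p \<in> cdom c'" and c': "c' \<in> A"
  obtains W F where "open W" "(s, cmap c p) \<in> W" "\<And>t x. (t, x) \<in> W \<Longrightarrow> x \<in> crange c" "\<And>k. Ck_on k W F"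
    "\<And>t x. (t, x) \<in> W \<Longrightarrow> F (t, x) \<in> crange c'"
    "\<And>t x. (t, x) \<in> W \<Longrightarrow> t \<in> I \<Longrightarrow> cinv c x \<in> S \<Longrightarrow> f t (cinv c x) \<in> cdom c' \<and> F (t, x) = cmap c' (f t (cinv c x))"
proof -
  obtain c1 c2 W1 F1 where c1: "c1 \<in> A" "c2 \<in> A" "p \<in> cdom c1" "f s p \<in> cdom c2"
      "open W1" "(s, cmap c1 p) \<in> W1" "smooth_on W1 F1"
    and all: "\<forall>(t, x)\<in>W1. t \<in> I \<and> x \<in> crange c1 \<and> cinv c1 x \<in> S \<longrightarrow>
       f t (cinv c1 x) \<in> cdom c2 \<and> F1 (t, x) = cmap c2 (f t (cinv c1 x))"
    using f[unfolded smooth_family_on_def, rule_format, OF s p(1)] by blast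
  have F1: "f t (cinv c1 x) \<in> cdom c2 \<and> F1 (t, x) = cmap c2 (f t (cinv c1 x))"
    if "(t, x) \<in> W1" "t \<in> I" "x \<in> crange c1" "cinv c1 x \<in> S" for t x
    using bspec[OF all that(1)] that(2-4) by simp
  define h where "h = (\<lambda>z :: real \<times> (real^'n). (fst z, transition c c1 (snd z)))"
  define U where "U = (UNIV :: real set) \<times> overlap c c1"
  have oU: "open U" unfolding U_def using open_overlap[OF c c1(1)] by (intro open_Times) auto
  have "Ck_on k U (\<lambda>z. transition c c1 (snd z))" for k
    by (rule Ck_on_compose[OF oU open_overlap[OF c c1(1)] _ Ck_on_transition[OF c c1(1)] Ck_on_bounded_linear[OF bounded_linear_snd]])
      (auto simp: U_def)
  then have "Ck_on k U (\<lambda>z. fst z *\<^sub>R (1::real, 0) + (0, transition c c1 (snd z)))" for k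
    by (intro Ck_on_add oU Ck_on_scaleR Ck_on_const Ck_on_bounded_linear[OF bounded_linear_fst]
        Ck_on_compose[OF oU open_UNIV subset_UNIV Ck_on_bounded_linear[of "\<lambda>y. (0, y)"]])
      (auto intro!: bounded_linear_intros bounded_linear_Pair)
  then have hC: "Ck_on k U h" for k by (simp add: h_def)
  define U1 where "U1 = U \<inter> h -` W1"
  have oU1: "open U1" unfolding U1_def
    by (rule continuous_open_preimage[OF Ck_on_continuous[OF hC[of 0]] oU c1(5)])
  have F1h: "Ck_on k U1 (\<lambda>z. F1 (h z))" for k
    by (rule Ck_on_compose[OF oU1 c1(5) _ smooth_on_imp_Ck_on[OF c1(7)] Ck_on_subset[OF hC]]) (auto simp: U1_def)
  define W where "W = U1 \<inter> (\<lambda>z. F1 (h z)) -` overlap c2 c'"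
  have oW: "open W" unfolding W_def
    by (rule continuous_open_preimage[OF Ck_on_continuous[OF F1h[of 0]] oU1 open_overlap[OF c1(2) c']])
  define F where "F = (\<lambda>z. transition c2 c' (F1 (h z)))"
  have Wx: "x \<in> overlap c c1" "(t, transition c c1 x) \<in> W1" "F1 (t, transition c c1 x) \<in> overlap c2 c'"
    if "(t, x) \<in> W" for t x using that by (auto simp: W_def U1_def U_def h_def)
  show ?thesis
  proof (rule that[of W F])
    have "cinv c1 (cmap c1 p) = p" using c1 cinv_cmap by simp
    then have "F1 (s, cmap c1 p) = cmap c2 (f s p)" using F1[OF c1(6) s] c1(3) p(1) by auto
    then show "(s, cmap c p) \<in> W" using p c1 q c
      by (auto simp: W_def U1_def U_def h_def transition_def cinv_cmap)
    show "x \<in> crange c" if "(t, x) \<in> W" for t x using Wx(1)[OF that] by auto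
    show "Ck_on k W F" for k unfolding F_def
      by (rule Ck_on_compose[OF oW open_overlap[OF c1(2) c'] _ Ck_on_transition[OF c1(2) c'] Ck_on_subset[OF F1h]])
        (auto simp: W_def)
    show "F (t, x) \<in> crange c'" if "(t, x) \<in> W" for t x
      using transition_overlap(1)[OF c1(2) c' Wx(3)[OF that]] by (auto simp: F_def h_def)
    show "f t (cinv c x) \<in> cdom c' \<and> F (t, x) = cmap c' (f t (cinv c x))"
      if "(t, x) \<in> W" "t \<in> I" "cinv c x \<in> S" for t x
    proof -
      note w = Wx[OF that(1)]
      note T = transition_overlap[OF c c1(1) w(1)]
      have *: "f t (cinv c x) \<in> cdom c2" "F1 (t, transition c c1 x) = cmap c2 (f t (cinv c x))"
        using F1[OF w(2) that(2)] T that(3) by auto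
      then have "f t (cinv c x) \<in> cdom c'"
        using w(3) overlap_iff[OF c1(2)] cinv_cmap[OF c1(2)] by metis
      then show ?thesis using * by (simp add: F_def h_def transition_def cinv_cmap[OF c1(2)])
    qed
  qed (rule oW)
qed

lemma measurable_cinv: "c \<in> A \<Longrightarrow> cinv c \<in> borel_measurable borel"
proof -
  assume c: "c \<in> A"
  have "(\<lambda>x. if x \<in> crange c then cinv c x else (SOME p. False)) \<in> borel_measurable borel"
    using open_crange[OF c] continuous_on_cinv[OF c]
    by (intro borel_measurable_continuous_on_if) auto
  \<comment> \<open>Off \<open>crange c\<close> the predicate inside \<open>inv_into\<close> is
    unsatisfiable, so all these points share one default value: \<open>cinv c\<close> is continuous
    on an open set and constant on the complement.\<close>
  moreover have "cinv c x = (SOME p. False)" if "x \<notin> crange c" for x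
  proof -
    have "(\<lambda>p. p \<in> cdom c \<and> cmap c p = x) = (\<lambda>p. False)" using that by (auto simp: fun_eq_iff)
    then show ?thesis unfolding inv_into_def by simp
  qed
  then have "(\<lambda>x. if x \<in> crange c then cinv c x else (SOME p. False)) = cinv c" by (auto simp: fun_eq_iff)
  ultimately show ?thesis by simp
qed

section \<open>The Riemannian volume in charts\<close>

definition vol_weight :: "('m, 'n) chart \<Rightarrow> real^'n \<Rightarrow> real" where
  "vol_weight c x = (if x \<in> crange c then sqrt (det (g c x)) else 0)"

lemma measurable_vol_weight: "c \<in> A \<Longrightarrow> vol_weight c \<in> borel_measurable borel"
  unfolding vol_weight_def[abs_def] using open_crange Ck_on_continuous[OF Ck_on_sqrt_det]
  by (intro borel_measurable_continuous_on_if) auto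

lemma vol_weight_nonneg: "c \<in> A \<Longrightarrow> 0 \<le> vol_weight c x"
  using det_metric_pos[of c x] by (auto simp: vol_weight_def)

abbreviation vol_chart :: "('m, 'n) chart \<Rightarrow> 'm measure" where
  "vol_chart c \<equiv> distr (density lborel (\<lambda>x. ennreal (vol_weight c x))) borel (cinv c)"

lemma emeasure_vol_chart:
  assumes c: "c \<in> A" and B: "B \<in> sets borel"
  shows "emeasure (vol_chart c) B = (\<integral>\<^sup>+x. ennreal (vol_weight c x) * indicator B (cinv c x) \<partial>lborel)"
proof -
  note measurable_cinv[OF c, measurable] measurable_vol_weight[OF c, measurable]
  have "emeasure (vol_chart c) B = (\<integral>\<^sup>+x. ennreal (vol_weight c x) * indicator (cinv c -` B) x \<partial>lborel)"
    using measurable_sets[OF measurable_cinv[OF c] B] B by (simp add: emeasure_distr emeasure_density)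
  then show ?thesis by (simp add: indicator_def)
qed

lemma vol_chart_compatible:
  assumes c: "c \<in> A" "c' \<in> A" and B [measurable]: "B \<in> sets borel" and Bc: "B \<subseteq> cdom c \<inter> cdom c'"
  shows "emeasure (vol_chart c) B = emeasure (vol_chart c') B"
proof -
  note measurable_cinv[OF c(2), measurable] measurable_vol_weight[OF c(2), measurable]
  let ?f = "\<lambda>y. ennreal (vol_weight c' y) * indicator B (cinv c' y)"
  have "emeasure (vol_chart c') B = (\<integral>\<^sup>+y. ?f y * indicator (overlap c' c) y \<partial>lborel)"
    unfolding emeasure_vol_chart[OF c(2) B]
    by (intro nn_integral_cong) (use Bc overlap_iff[OF c(2)] in \<open>auto simp: vol_weight_def indicator_def\<close>)
  also have "\<dots> = (\<integral>\<^sup>+x. ?f (transition c c' x) * ennreal \<bar>det (matrix ((*v) (jacobian c c' x)))\<bar> * indicator (overlap c c') x \<partial>lborel)"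
  proof (rule nn_integral_change_of_variables[OF open_overlap[OF c] open_overlap[OF c(2,1)] homeomorphism_transition[OF c]])
    show "(transition c c' has_derivative (*v) (jacobian c c' x)) (at x)" if "x \<in> overlap c c'" for x
      by (rule transition_has_derivative[OF c that])
    have "Ck_on 0 (overlap c c') (\<lambda>x. frechet_derivative (transition c c') (at x) (axis j 1) $ i)" for i j
      by (rule Ck_on_component[OF open_overlap[OF c] Ck_on_frechet[OF Ck_on_transition[OF c]]])
    then have "continuous_on (overlap c c') (\<lambda>x. det (jacobian c c' x))"
      using Ck_on_det[OF open_overlap[OF c], of 0 "jacobian c c'"]
      by (simp add: jacobian_def matrix_def del: Ck_on.simps(1)) simp
    then show "continuous_on (overlap c c') (\<lambda>x. det (matrix ((*v) (jacobian c c' x))))" by simp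
    show "?f \<in> borel_measurable borel" by measurable
  qed
  also have "\<dots> = (\<integral>\<^sup>+x. ennreal (vol_weight c x) * indicator B (cinv c x) \<partial>lborel)"
  proof (rule nn_integral_cong)
    fix x
    show "?f (transition c c' x) * ennreal \<bar>det (matrix ((*v) (jacobian c c' x)))\<bar> * indicator (overlap c c') x =
       ennreal (vol_weight c x) * indicator B (cinv c x)"
    proof (cases "x \<in> overlap c c'")
      case True
      note T = transition_overlap[OF c True]
      have "vol_weight c x = vol_weight c' (transition c c' x) * \<bar>det (jacobian c c' x)\<bar>"
        using sqrt_det_transform[OF c True] True T(1) by (auto simp: vol_weight_def)
      then have "ennreal (vol_weight c x) = ennreal (vol_weight c' (transition c c' x)) * ennreal \<bar>det (jacobian c c' x)\<bar>"
        using vol_weight_nonneg[OF c(2)] by (simp add: ennreal_mult)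
      then show ?thesis using True T(3) by (simp add: mult_ac)
    next
      case False
      then show ?thesis using Bc overlap_iff[OF c(1)] by (auto simp: vol_weight_def indicator_def)
    qed
  qed
  also have "\<dots> = emeasure (vol_chart c) B" using emeasure_vol_chart[OF c(1) B] by simp
  finally show ?thesis by simp
qed

abbreviation vol :: "'m measure" where "vol \<equiv> riemannian_volume A g"

text \<open>Resolves the definite description once and for all; afterwards the volume is used only
  through its chart measures.\<close>

lemma riemannian_volume_spec:
  "sets vol = sets borel \<and> (\<forall>c\<in>A. \<forall>B\<in>sets borel. B \<subseteq> cdom c \<longrightarrow> emeasure vol B = emeasure (vol_chart c) B)"
proof -
  have eq: "(\<integral>\<^sup>+x\<in>cmap c ` B. ennreal (sqrt (det (g c x))) \<partial>lborel) = emeasure (vol_chart c) B"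
    if "c \<in> A" "B \<in> sets borel" "B \<subseteq> cdom c" for c B
    unfolding emeasure_vol_chart[OF that(1,2)] cmap_image_eq[OF that(1,3)]
    by (intro nn_integral_cong) (auto simp: vol_weight_def indicator_def)
  have "\<exists>!\<mu>. sets \<mu> = sets borel \<and> (\<forall>c\<in>A. \<forall>B\<in>sets borel. B \<subseteq> cdom c \<longrightarrow> emeasure \<mu> B = emeasure (vol_chart c) B)"
    using ex_chart by (intro glue_measures open_cdom vol_chart_compatible) auto
  moreover have "riemannian_volume A g = (THE \<mu>. sets \<mu> = sets borel \<and> (\<forall>c\<in>A. \<forall>B\<in>sets borel. B \<subseteq> cdom c \<longrightarrow> emeasure \<mu> B = emeasure (vol_chart c) B))"
    unfolding riemannian_volume_def using eq by (intro arg_cong[where f = The] ext) auto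
  ultimately show ?thesis by (simp only:) (rule theI')
qed

lemma integral_vol:
  assumes c: "c \<in> A" and F: "F \<in> borel_measurable borel" "\<And>p. p \<notin> cdom c \<Longrightarrow> F p = (0::real)"
  shows "integrable vol F \<longleftrightarrow> integrable lborel (\<lambda>x. vol_weight c x * F (cinv c x))"
    and "(LINT p|vol. F p) = (LINT x|lborel. vol_weight c x * F (cinv c x))"
proof -
  have wD: "cinv c x \<in> cdom c" if "vol_weight c x \<noteq> 0" for x
    using that by (auto simp: vol_weight_def intro: cinv_cdom split: if_splits)
  have "emeasure vol B = emeasure (vol_chart c) B" if "B \<in> sets borel" "B \<subseteq> cdom c" for B
    using riemannian_volume_spec c that by blast
  note * = integral_by_chart[OF conjunct1[OF riemannian_volume_spec] open_cdom[OF c] measurable_vol_weight[OF c]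
      vol_weight_nonneg[OF c] measurable_cinv[OF c] wD this F]
  show "integrable vol F \<longleftrightarrow> integrable lborel (\<lambda>x. vol_weight c x * F (cinv c x))"
    "(LINT p|vol. F p) = (LINT x|lborel. vol_weight c x * F (cinv c x))" by (rule *; assumption)+
qed

end

section \<open>Regular domains and the boundary measure\<close>

lemma linear_hyper_proj: "linear (hyper_proj k)"
  by (intro linearI) (auto simp: vec_eq_iff insert_zero_nth)

lemma hyper_proj_has_derivative: "(hyper_proj k has_derivative hyper_proj k) F"
  by (rule linear_imp_has_derivative[OF linear_hyper_proj])

lemma inner_hyper_proj: "v \<bullet> hyper_proj k w = hyper_proj k v \<bullet> w"
  by (auto simp: inner_vec_def insert_zero_nth intro: sum.cong)

lemma induced_gram_mult: "induced_gram k G *v w = hyper_proj k (G *v hyper_proj k w) + (w $ k) *\<^sub>R axis k 1"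
proof -
  have "(induced_gram k G *v w) $ i = (if i = k then w $ k else (G *v hyper_proj k w) $ i)" for i
  proof (cases "i = k")
    case True
    have "(\<Sum>j\<in>UNIV. (if j = k then 1 else 0) * w $ j) = w $ k"
      by (subst sum.remove[of _ k]) auto
    then show ?thesis using True by (simp add: induced_gram_def matrix_vector_mult_def eq_commute[of k] if_distrib[of "\<lambda>t. t * _"] cong: if_cong)
  next
    case False
    have "(\<Sum>j\<in>UNIV. (if j = k then 0 else G $ i $ j) * w $ j) = (\<Sum>j\<in>UNIV. G $ i $ j * hyper_proj k w $ j)"
      by (rule sum.cong) (auto simp: insert_zero_nth)
    then show ?thesis using False by (simp add: induced_gram_def matrix_vector_mult_def cong: if_cong)
  qed
  then show ?thesis by (simp add: vec_eq_iff insert_zero_nth axis_def)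
qed

text \<open>The padded matrix is the metric on the hyperplane plus the product of the
  \<open>k\<close>-th coordinates. In this form positivity and the behaviour under coordinate
  changes can be read off.\<close>

lemma induced_gram_inner:
  "v \<bullet> (induced_gram k G *v w) = hyper_proj k v \<bullet> (G *v hyper_proj k w) + v $ k * w $ k"
  unfolding induced_gram_mult inner_add_right inner_hyper_proj by (simp add: inner_axis)

lemma det_induced_gram_pos:
  assumes pos: "\<And>w. w \<noteq> 0 \<Longrightarrow> w \<bullet> (G *v w) > 0"
  shows "det (induced_gram k G) > 0"
proof (rule positive_definite_det_pos)
  fix w :: "real^'a" assume w: "w \<noteq> 0"
  show "w \<bullet> (induced_gram k G *v w) > 0"
  proof (cases "hyper_proj k w = 0")
    case True
    then have "w $ k \<noteq> 0" using w hyper_proj_split[of k w] by auto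
    then have "w $ k * w $ k > 0" unfolding zero_less_mult_iff by linarith
    then show ?thesis by (simp add: induced_gram_inner True)
  next
    case False
    then show ?thesis using pos[OF False] zero_le_square[of "w $ k"] unfolding induced_gram_inner by linarith
  qed
qed

text \<open>A diagonal entry of the inverse is a cofactor divided by \<open>det G\<close>, and the
  cofactor is the determinant of the padded matrix. This links the boundary density with the
  interior one.\<close>

lemma det_induced_gram:
  fixes G :: "real^'n^'n"
  assumes "det G \<noteq> 0" shows "det (induced_gram k G) = det G * matrix_inv G $ k $ k"
proof -
  let ?c = "\<lambda>i. (\<chi> b. if b = k then 0 else G $ i $ b)" and ?e = "\<lambda>i::'n. axis k 1 :: real^'n"
    and ?r = "\<lambda>i. (\<chi> b. if b = k then 0 else G $ i $ b)"
  have M: "(\<chi> a b. if b = k then (axis k 1 :: real^'n) $ a else G $ a $ b) = (\<chi> i. if i = k then ?e i + ?r i else ?c i)"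
    by (auto simp: vec_eq_iff axis_def)
  \<comment> \<open>Row \<open>k\<close> of Cramer's matrix is a unit row plus a remainder. With the
    remainder in its place the whole column \<open>k\<close> is zero, so that part contributes
    nothing.\<close>
  have "det (\<chi> i. if i = k then ?r i else ?c i) = 0"
    by (rule det_zero_column(1)[of k]) (simp add: column_def vec_eq_iff)
  then have "det (\<chi> a b. if b = k then (axis k 1 :: real^'n) $ a else G $ a $ b) = det (\<chi> i. if i = k then ?e i else ?c i)"
    unfolding M by (subst det_row_add) simp
  also have "(\<chi> i. if i = k then ?e i else ?c i) = induced_gram k G"
    by (auto simp: vec_eq_iff axis_def induced_gram_def)
  finally show ?thesis using matrix_inv_cramer[OF assms, of k k] assms by simp
qed

lemma matrix_eq_inner:
  fixes M N :: "real^'n^'m"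
  assumes "\<And>v w. v \<bullet> (M *v w) = v \<bullet> (N *v w)" shows "M = N"
proof -
  have "M *v w = N *v w" for w
  proof -
    have "(M *v w - N *v w) \<bullet> (M *v w - N *v w) = 0"
      using assms[of "M *v w - N *v w" w] by (simp only: inner_diff_right)
    then show ?thesis by simp
  qed
  then show ?thesis unfolding matrix_eq by simp
qed

locale regular_domain = riemannian_manifold A g
  for A :: "('m::{t2_space,second_countable_topology}, 'n::finite) chart set"
    and g :: "('m, 'n) chart \<Rightarrow> real^'n \<Rightarrow> real^'n^'n" +
  fixes \<Omega> :: "'m set"
  assumes regular: "bounded_regular_domain A \<Omega>"
begin

lemma open_\<Omega>: "open \<Omega>" and compact_closure: "compact (closure \<Omega>)"
  and ex_boundary_chart: "p \<in> frontier \<Omega> \<Longrightarrow> \<exists>c k. boundary_chart A \<Omega> c k \<and> p \<in> cdom c"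
  using regular unfolding bounded_regular_domain_def by blast+

lemma boundary_chart_A: "boundary_chart A \<Omega> c k \<Longrightarrow> c \<in> A"
  and boundary_chart_\<Omega>: "boundary_chart A \<Omega> c k \<Longrightarrow> p \<in> cdom c \<Longrightarrow> p \<in> \<Omega> \<longleftrightarrow> cmap c p $ k < 0"
  unfolding boundary_chart_def by blast+

lemma boundary_chart_closure:
  assumes bc: "boundary_chart A \<Omega> c k" and p: "p \<in> cdom c"
  shows "p \<in> closure \<Omega> \<longleftrightarrow> cmap c p $ k \<le> 0"
proof
  note c = boundary_chart_A[OF bc]
  assume pc: "p \<in> closure \<Omega>"
  show "cmap c p $ k \<le> 0"
  proof (rule ccontr)
    assume "\<not> cmap c p $ k \<le> 0"
    then have "p \<in> cdom c \<inter> cmap c -` {x. 0 < x $ k}" using p by simp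
    moreover have "open (cdom c \<inter> cmap c -` {x. 0 < x $ k})"
      by (rule continuous_open_preimage[OF continuous_on_cmap[OF c] open_cdom[OF c]])
        (intro open_Collect_less continuous_intros)
    ultimately have "(cdom c \<inter> cmap c -` {x. 0 < x $ k}) \<inter> \<Omega> \<noteq> {}"
      using pc open_Int_closure_eq_empty by blast
    then show False using boundary_chart_\<Omega>[OF bc] by force
  qed
next
  note c = boundary_chart_A[OF bc]
  assume le: "cmap c p $ k \<le> 0"
  show "p \<in> closure \<Omega>"
  proof (rule ccontr)
    assume np: "p \<notin> closure \<Omega>"
    let ?N = "cdom c \<inter> - closure \<Omega>"
    have "open (cmap c ` ?N)" by (rule open_cmap_image[OF c]) (auto intro: open_cdom[OF c])
    moreover have "cmap c p \<in> cmap c ` ?N" using p np by blast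
    ultimately obtain e where e: "e > 0" "ball (cmap c p) e \<subseteq> cmap c ` ?N" by (meson open_contains_ball)
    \<comment> \<open>A point pushed slightly into the half space: its \<open>k\<close>-th
      coordinate is negative, so it represents a point of \<Omega>, yet it stays in the
      neighbourhood that avoids the closure.\<close>
    define y where "y = cmap c p - (e / 2) *\<^sub>R axis k 1"
    have "y \<in> ball (cmap c p) e" using e by (simp add: y_def dist_norm)
    then obtain q where q: "q \<in> ?N" "y = cmap c q" using e by blast
    have "y $ k < 0" using le e by (simp add: y_def)
    then have "q \<in> \<Omega>" using boundary_chart_\<Omega>[OF bc, of q] q by auto
    then show False using q closure_subset by blast
  qed
qed

lemma boundary_chart_frontier:
  assumes bc: "boundary_chart A \<Omega> c k" and p: "p \<in> cdom c"
  shows "p \<in> frontier \<Omega> \<longleftrightarrow> cmap c p $ k = 0"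
proof -
  have "p \<in> frontier \<Omega> \<longleftrightarrow> p \<in> closure \<Omega> \<and> p \<notin> \<Omega>"
    using open_\<Omega> by (simp add: frontier_def interior_open)
  then show ?thesis using boundary_chart_closure[OF bc p] boundary_chart_\<Omega>[OF bc p] by force
qed

lemma closure_eq: "closure \<Omega> = \<Omega> \<union> frontier \<Omega>"
  using closure_subset open_\<Omega> by (auto simp: frontier_def interior_open)

lemma boundary_cinv:
  assumes bc: "boundary_chart A \<Omega> c k" and x: "x \<in> crange c"
  shows "cinv c x \<in> \<Omega> \<longleftrightarrow> x $ k < 0" "cinv c x \<in> closure \<Omega> \<longleftrightarrow> x $ k \<le> 0" "cinv c x \<in> frontier \<Omega> \<longleftrightarrow> x $ k = 0"
  using boundary_chart_\<Omega>[OF bc cinv_cdom[OF x]] boundary_chart_closure[OF bc cinv_cdom[OF x]]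
    boundary_chart_frontier[OF bc cinv_cdom[OF x]] cmap_cinv[OF x] by simp_all

text \<open>Both charts turn the boundary into a coordinate hyperplane, so the transition map sends
  one hyperplane into the other; differentiating along a line inside the first shows the same for
  the derivative.\<close>

lemma jacobian_tangential:
  assumes bc: "boundary_chart A \<Omega> c k" and bc': "boundary_chart A \<Omega> c' k'"
    and x: "x \<in> overlap c c'" "x $ k = 0" and w: "w $ k = 0"
  shows "(jacobian c c' x *v w) $ k' = 0"
proof -
  note c = boundary_chart_A[OF bc] and c' = boundary_chart_A[OF bc']
  let ?\<gamma> = "\<lambda>t::real. x + t *\<^sub>R w"
  have T: "(transition c c' has_derivative (*v) (jacobian c c' x)) (at (?\<gamma> 0))"
    using transition_has_derivative[OF c c' x(1)] by simp
  have "((\<lambda>t. transition c c' (?\<gamma> t)) has_derivative (\<lambda>t. jacobian c c' x *v (t *\<^sub>R w))) (at 0)"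
    by (rule has_derivative_compose[of ?\<gamma> "\<lambda>t. t *\<^sub>R w" 0 UNIV, OF _ T]) (auto intro!: derivative_eq_intros)
  then have d: "((\<lambda>t. transition c c' (?\<gamma> t) $ k') has_derivative (\<lambda>t. (jacobian c c' x *v (t *\<^sub>R w)) $ k')) (at 0)"
    by (rule bounded_linear.has_derivative[OF bounded_linear_vec_nth])
  have op: "open (?\<gamma> -` overlap c c')"
    by (rule open_vimage[OF open_overlap[OF c c']]) (intro continuous_intros)
  have "((\<lambda>_. 0) has_derivative (\<lambda>t. (jacobian c c' x *v (t *\<^sub>R w)) $ k')) (at 0)"
  proof (rule has_derivative_transform_within_open[OF d op])
    fix t assume t: "t \<in> ?\<gamma> -` overlap c c'"
    then have r: "?\<gamma> t \<in> crange c" and o: "?\<gamma> t \<in> overlap c c'" by auto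
    have "?\<gamma> t $ k = 0" using x(2) w by simp
    then have "cinv c (?\<gamma> t) \<in> frontier \<Omega>" using boundary_cinv(3)[OF bc r] by simp
    moreover have "cinv c (?\<gamma> t) \<in> cdom c'" using o overlap_iff[OF c] by blast
    ultimately show "transition c c' (?\<gamma> t) $ k' = 0"
      unfolding transition_def using boundary_chart_frontier[OF bc'] by blast
  qed (use x in simp)
  then have "(\<lambda>t. (jacobian c c' x *v (t *\<^sub>R w)) $ k') = (\<lambda>_. 0)"
    using has_derivative_const has_derivative_unique by blast
  then have "(jacobian c c' x *v (1 *\<^sub>R w)) $ k' = 0" by metis
  then show ?thesis by simp
qed

text \<open>Boundary integrals are written over the full-dimensional slab \<open>0 < x\<^sub>k < 1\<close>, with an integrand
  that does not depend on \<open>x\<^sub>k\<close>, so that the change of variables formula of \<open>real^'n\<close> applies.\<close>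

definition bd_weight :: "('m, 'n) chart \<Rightarrow> 'n \<Rightarrow> real^'n \<Rightarrow> real" where
  "bd_weight c k x = (if 0 < x $ k \<and> x $ k < 1 \<and> hyper_proj k x \<in> crange c
     then sqrt (det (induced_gram k (g c (hyper_proj k x)))) else 0)"

definition bd_map :: "('m, 'n) chart \<Rightarrow> 'n \<Rightarrow> real^'n \<Rightarrow> 'm" where
  "bd_map c k x = cinv c (hyper_proj k x)"

abbreviation bd_chart :: "('m, 'n) chart \<Rightarrow> 'n \<Rightarrow> 'm measure" where
  "bd_chart c k \<equiv> distr (density lborel (\<lambda>x. ennreal (bd_weight c k x))) borel (bd_map c k)"

lemma continuous_on_hyper_proj: "continuous_on S (hyper_proj k)"
  by (rule continuous_on_insert_zero)

lemma open_slab: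
  assumes "open U" shows "open {x :: real^'n. 0 < x $ k \<and> x $ k < 1 \<and> hyper_proj k x \<in> U}"
proof -
  have "open (hyper_proj k -` U)" by (rule open_vimage[OF assms continuous_on_hyper_proj])
  moreover have "open {x :: real^'n. 0 < x $ k}" "open {x :: real^'n. x $ k < 1}"
    by (intro open_Collect_less continuous_intros)+
  ultimately have "open ({x. 0 < x $ k} \<inter> {x. x $ k < 1} \<inter> hyper_proj k -` U)" by blast
  then show ?thesis by (simp add: Int_def vimage_def conj_assoc)
qed

lemma continuous_on_sqrt_induced:
  assumes c: "c \<in> A" shows "continuous_on (crange c) (\<lambda>x. sqrt (det (induced_gram k (g c x))))"
proof -
  have "Ck_on 0 (crange c) (\<lambda>x. induced_gram k (g c x) $ i $ j)" for i j
    by (cases "i = k \<or> j = k") (auto simp: induced_gram_def Ck_on_continuous[OF Ck_on_metric[OF c]])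
  then have "continuous_on (crange c) (\<lambda>x. det (induced_gram k (g c x)))"
    using Ck_on_det[OF open_crange[OF c], of 0 "\<lambda>x. induced_gram k (g c x)"] by simp
  then show ?thesis by (intro continuous_intros)
qed

lemma measurable_bd_weight: "c \<in> A \<Longrightarrow> bd_weight c k \<in> borel_measurable borel"
proof -
  assume c: "c \<in> A"
  let ?U = "{x. 0 < x $ k \<and> x $ k < 1 \<and> hyper_proj k x \<in> crange c}"
  have "continuous_on ?U (\<lambda>x. sqrt (det (induced_gram k (g c (hyper_proj k x)))))"
    by (rule continuous_on_compose2[OF continuous_on_sqrt_induced[OF c] continuous_on_hyper_proj]) auto
  then have "(\<lambda>x. if x \<in> ?U then sqrt (det (induced_gram k (g c (hyper_proj k x)))) else 0) \<in> borel_measurable borel"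
    using open_slab[OF open_crange[OF c]] by (intro borel_measurable_continuous_on_if) auto
  then show ?thesis unfolding bd_weight_def[abs_def] by simp
qed

lemma measurable_bd_map: "c \<in> A \<Longrightarrow> bd_map c k \<in> borel_measurable borel"
  unfolding bd_map_def[abs_def] by (rule measurable_compose[OF measurable_insert_zero_vec measurable_cinv])

lemma det_induced_pos: "c \<in> A \<Longrightarrow> x \<in> crange c \<Longrightarrow> det (induced_gram k (g c x)) > 0"
  by (rule det_induced_gram_pos) (rule metric_pos)

lemma bd_weight_nonneg: "c \<in> A \<Longrightarrow> 0 \<le> bd_weight c k x"
  using det_induced_pos[of c "hyper_proj k x" k] by (auto simp: bd_weight_def)

lemma bd_map_mem:
  assumes bc: "boundary_chart A \<Omega> c k" and "bd_weight c k x \<noteq> 0"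
  shows "hyper_proj k x \<in> crange c" "bd_map c k x \<in> cdom c" "bd_map c k x \<in> frontier \<Omega>"
proof -
  show r: "hyper_proj k x \<in> crange c" using assms(2) by (auto simp: bd_weight_def split: if_splits)
  then show "bd_map c k x \<in> cdom c" unfolding bd_map_def by (rule cinv_cdom)
  show "bd_map c k x \<in> frontier \<Omega>" unfolding bd_map_def
    using boundary_cinv(3)[OF bc r] by (simp add: insert_zero_nth)
qed

lemma emeasure_bd_chart:
  assumes c: "c \<in> A" and B: "B \<in> sets borel"
  shows "emeasure (bd_chart c k) B = (\<integral>\<^sup>+x. ennreal (bd_weight c k x) * indicator B (bd_map c k x) \<partial>lborel)"
proof -
  note measurable_bd_map[OF c, measurable] measurable_bd_weight[OF c, measurable]
  have "emeasure (bd_chart c k) B = (\<integral>\<^sup>+x. ennreal (bd_weight c k x) * indicator (bd_map c k -` B) x \<partial>lborel)"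
    using measurable_sets[OF measurable_bd_map[OF c, of k] B] B by (simp add: emeasure_distr emeasure_density)
  then show ?thesis by (simp add: indicator_def)
qed

section \<open>The boundary measure under change of boundary chart\<close>

definition slab_overlap :: "('m, 'n) chart \<Rightarrow> 'n \<Rightarrow> ('m, 'n) chart \<Rightarrow> (real^'n) set" where
  "slab_overlap c k c' = {x. 0 < x $ k \<and> x $ k < 1 \<and> hyper_proj k x \<in> overlap c c'}"

text \<open>The boundary transition is thickened to full dimension by carrying the coordinate
  \<open>x $ k\<close> along unchanged as the new coordinate \<open>k'\<close>.\<close>

definition slab_transition :: "('m, 'n) chart \<Rightarrow> 'n \<Rightarrow> ('m, 'n) chart \<Rightarrow> 'n \<Rightarrow> real^'n \<Rightarrow> real^'n" where
  "slab_transition c k c' k' x = transition c c' (hyper_proj k x) + (x $ k) *\<^sub>R axis k' 1"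

definition slab_derivative :: "('m, 'n) chart \<Rightarrow> 'n \<Rightarrow> ('m, 'n) chart \<Rightarrow> 'n \<Rightarrow> real^'n \<Rightarrow> real^'n \<Rightarrow> real^'n" where
  "slab_derivative c k c' k' x v = jacobian c c' (hyper_proj k x) *v hyper_proj k v + (v $ k) *\<^sub>R axis k' 1"

context
  fixes c k c' k'
  assumes bc: "boundary_chart A \<Omega> c k" and bc': "boundary_chart A \<Omega> c' k'"
begin

lemma transition_boundary: "z \<in> overlap c c' \<Longrightarrow> z $ k = 0 \<Longrightarrow> transition c c' z $ k' = 0"
  using boundary_cinv(3)[OF bc, of z] overlap_iff[OF boundary_chart_A[OF bc], of z c']
    boundary_chart_frontier[OF bc', of "cinv c z"] unfolding transition_def by blast

lemma slab_transition_nth: "x \<in> (slab_overlap c k c') \<Longrightarrow> (slab_transition c k c' k') x $ k' = x $ k"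
  and hyper_proj_slab_transition: "x \<in> (slab_overlap c k c') \<Longrightarrow> hyper_proj k' ((slab_transition c k c' k') x) = transition c c' (hyper_proj k x)"
  using transition_boundary[of "hyper_proj k x"]
  by (auto simp: slab_overlap_def slab_transition_def insert_zero_nth axis_def vec_eq_iff)

lemma open_slab_overlap: "open (slab_overlap c k c')"
  unfolding slab_overlap_def by (intro open_slab open_overlap boundary_chart_A[OF bc] boundary_chart_A[OF bc'])

lemma continuous_on_slab_transition: "continuous_on (slab_overlap c k c') (slab_transition c k c' k')"
  unfolding slab_transition_def[abs_def]
  by (intro continuous_intros continuous_on_compose2[OF Ck_on_continuous[OF
        Ck_on_transition[OF boundary_chart_A[OF bc] boundary_chart_A[OF bc'], of 0]] continuous_on_hyper_proj])
    (auto simp: slab_overlap_def)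

lemma slab_transition_has_derivative:
  assumes "x \<in> (slab_overlap c k c')" shows "((slab_transition c k c' k') has_derivative (slab_derivative c k c' k') x) (at x)"
proof -
  have "(transition c c' has_derivative (*v) (jacobian c c' (hyper_proj k x))) (at (hyper_proj k x))"
    using assms by (intro transition_has_derivative boundary_chart_A[OF bc] boundary_chart_A[OF bc']) (simp add: slab_overlap_def)
  from has_derivative_compose[OF hyper_proj_has_derivative this]
  have "((\<lambda>x. transition c c' (hyper_proj k x)) has_derivative (\<lambda>v. jacobian c c' (hyper_proj k x) *v hyper_proj k v)) (at x)" .
  moreover have "((\<lambda>x. (x $ k) *\<^sub>R (axis k' 1 :: real^'n)) has_derivative (\<lambda>v. (v $ k) *\<^sub>R axis k' 1)) (at x)"
    by (intro has_derivative_scaleR_left bounded_linear.has_derivative[OF bounded_linear_vec_nth] has_derivative_ident)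
  ultimately show ?thesis unfolding slab_transition_def[abs_def] slab_derivative_def[abs_def]
    by (rule has_derivative_add)
qed

text \<open>The derivative of the thickened transition is the tangential Jacobian together with the
  identity in the extra direction. It therefore pulls the padded matrix of the second chart back to
  that of the first, and determinants give the claim.\<close>

lemma slab_derivative_det:
  assumes x: "x \<in> (slab_overlap c k c')"
  shows "det (induced_gram k (g c (hyper_proj k x))) =
    (det (matrix ((slab_derivative c k c' k') x)))\<^sup>2 * det (induced_gram k' (g c' (transition c c' (hyper_proj k x))))"
proof -
  note c = boundary_chart_A[OF bc] and c' = boundary_chart_A[OF bc']
  let ?z = "hyper_proj k x" and ?P = "matrix ((slab_derivative c k c' k') x)"
  have z: "?z \<in> overlap c c'" "?z $ k = 0" using x by (auto simp: slab_overlap_def insert_zero_nth)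
  have P: "?P *v v = (slab_derivative c k c' k') x v" for v
    using matrix_vector_mul(2)[OF has_derivative_linear[OF slab_transition_has_derivative[OF x]]] by metis
  have t0: "(jacobian c c' ?z *v hyper_proj k v) $ k' = 0" for v
    by (rule jacobian_tangential[OF bc bc' z]) (simp add: insert_zero_nth)
  have h: "hyper_proj k' ((slab_derivative c k c' k') x v) = jacobian c c' ?z *v hyper_proj k v" "(slab_derivative c k c' k') x v $ k' = v $ k" for v
    using t0[of v] by (auto simp: slab_derivative_def vec_eq_iff insert_zero_nth axis_def)
  have "induced_gram k (g c ?z) = transpose ?P ** induced_gram k' (g c' (transition c c' ?z)) ** ?P"
  proof (rule matrix_eq_inner)
    fix v w
    show "v \<bullet> (induced_gram k (g c ?z) *v w) = v \<bullet> (transpose ?P ** induced_gram k' (g c' (transition c c' ?z)) ** ?P *v w)"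
      unfolding matrix_vector_mul_assoc[symmetric] inner_transpose_mult P induced_gram_inner h
        metric_transform_inner[OF c c' z(1)] ..
  qed
  then show ?thesis by (simp only: det_mul det_transpose power2_eq_square mult_ac)
qed

lemma continuous_on_slab_derivative_det: "continuous_on (slab_overlap c k c') (\<lambda>x. det (matrix ((slab_derivative c k c' k') x)))"
proof -
  note c = boundary_chart_A[OF bc] and c' = boundary_chart_A[OF bc']
  have j: "continuous_on (overlap c c') (\<lambda>z. jacobian c c' z $ i $ j)" for i j
  proof -
    have "Ck_on 0 (overlap c c') (\<lambda>x. frechet_derivative (transition c c') (at x) (axis j 1) $ i)"
      by (rule Ck_on_component[OF open_overlap[OF c c'] Ck_on_frechet[OF Ck_on_transition[OF c c']]])
    then show ?thesis by (simp add: jacobian_def matrix_def)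
  qed
  have "continuous_on (slab_overlap c k c') (\<lambda>x. jacobian c c' (hyper_proj k x) $ i $ j)" for i j
    by (rule continuous_on_compose2[OF j continuous_on_hyper_proj]) (auto simp: slab_overlap_def)
  then have "Ck_on 0 (slab_overlap c k c') (\<lambda>x. jacobian c c' (hyper_proj k x) $ i $ j)" for i j by simp
  then have "Ck_on 0 (slab_overlap c k c') (\<lambda>x. (\<Sum>l\<in>UNIV. jacobian c c' (hyper_proj k x) $ i $ l * hyper_proj k (axis j 1) $ l) + (axis j 1 $ k) * axis k' 1 $ i)" for i j
    by (intro Ck_on_add Ck_on_sum Ck_on_mult Ck_on_const open_slab_overlap)
  then have "Ck_on 0 (slab_overlap c k c') (\<lambda>x. matrix ((slab_derivative c k c' k') x) $ i $ j)" for i j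
    by (simp add: matrix_def slab_derivative_def matrix_vector_mult_def)
  from Ck_on_det[OF open_slab_overlap this] show ?thesis by simp
qed

end

lemma homeomorphism_slab_transition:
  assumes bc: "boundary_chart A \<Omega> c k" and bc': "boundary_chart A \<Omega> c' k'"
  shows "homeomorphism (slab_overlap c k c') (slab_overlap c' k' c) (slab_transition c k c' k') (slab_transition c' k' c k)"
proof -
  have *: "slab_transition c k c' k' x \<in> slab_overlap c' k' c"
    "slab_transition c' k' c k (slab_transition c k c' k' x) = x"
    if bc: "boundary_chart A \<Omega> c k" and bc': "boundary_chart A \<Omega> c' k'" and x: "x \<in> slab_overlap c k c'" for c k c' k' x
  proof -
    note c = boundary_chart_A[OF bc] and c' = boundary_chart_A[OF bc']
    have z: "hyper_proj k x \<in> overlap c c'" using x by (simp add: slab_overlap_def)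
    note n = slab_transition_nth[OF bc bc' x] hyper_proj_slab_transition[OF bc bc' x]
    show "slab_transition c k c' k' x \<in> slab_overlap c' k' c"
      using x transition_overlap(1)[OF c c' z] unfolding slab_overlap_def[of c' k' c] n mem_Collect_eq
      by (simp add: n slab_overlap_def)
    show "slab_transition c' k' c k (slab_transition c k c' k' x) = x"
      unfolding slab_transition_def[of c' k' c k] n transition_overlap(2)[OF c c' z] by (rule hyper_proj_split)
  qed
  show ?thesis
    by (rule homeomorphismI[OF continuous_on_slab_transition[OF bc bc'] continuous_on_slab_transition[OF bc' bc]])
      (use *[OF bc bc'] *[OF bc' bc] in auto)
qed

text \<open>The argument of \<open>vol_chart_compatible\<close>, applied to the thickened
  transition.\<close>

lemma bd_chart_compatible:
  assumes bc: "boundary_chart A \<Omega> c k" and bc': "boundary_chart A \<Omega> c' k'"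
    and B [measurable]: "B \<in> sets borel" and Bc: "B \<subseteq> cdom c \<inter> cdom c'"
  shows "emeasure (bd_chart c k) B = emeasure (bd_chart c' k') B"
proof -
  note c = boundary_chart_A[OF bc] and c' = boundary_chart_A[OF bc']
  note measurable_bd_map[OF c', measurable] measurable_bd_weight[OF c', measurable]
  let ?f = "\<lambda>y. ennreal (bd_weight c' k' y) * indicator B (bd_map c' k' y)"
  let ?T = "slab_transition c k c' k'" and ?D = "slab_derivative c k c' k'"
  have "emeasure (bd_chart c' k') B = (\<integral>\<^sup>+y. ?f y * indicator (slab_overlap c' k' c) y \<partial>lborel)"
    unfolding emeasure_bd_chart[OF c' B]
    by (intro nn_integral_cong)
      (use Bc overlap_iff[OF c', of _ c] in \<open>auto simp: bd_weight_def bd_map_def slab_overlap_def indicator_def\<close>)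
  also have "\<dots> = (\<integral>\<^sup>+x. ?f (?T x) * ennreal \<bar>det (matrix (?D x))\<bar> * indicator (slab_overlap c k c') x \<partial>lborel)"
    by (rule nn_integral_change_of_variables[OF open_slab_overlap[OF bc bc'] open_slab_overlap[OF bc' bc]
          homeomorphism_slab_transition[OF bc bc'] slab_transition_has_derivative[OF bc bc']
          continuous_on_slab_derivative_det[OF bc bc']]) measurable
  also have "\<dots> = (\<integral>\<^sup>+x. ennreal (bd_weight c k x) * indicator B (bd_map c k x) \<partial>lborel)"
  proof (rule nn_integral_cong)
    fix x
    show "?f (?T x) * ennreal \<bar>det (matrix (?D x))\<bar> * indicator (slab_overlap c k c') x =
       ennreal (bd_weight c k x) * indicator B (bd_map c k x)"
    proof (cases "x \<in> slab_overlap c k c'")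
      case True
      note n = slab_transition_nth[OF bc bc' True] hyper_proj_slab_transition[OF bc bc' True]
      have z: "hyper_proj k x \<in> overlap c c'" using True by (simp add: slab_overlap_def)
      note T = transition_overlap[OF c c' z]
      have zr: "hyper_proj k x \<in> crange c" using z by blast
      have Tr: "transition c c' (hyper_proj k x) \<in> crange c'" using T(1) by blast
      have xk: "0 < x $ k" "x $ k < 1" using True by (auto simp: slab_overlap_def)
      have "bd_weight c k x = \<bar>det (matrix (?D x))\<bar> * bd_weight c' k' (?T x)"
        unfolding bd_weight_def n using zr Tr xk
        by (simp add: slab_derivative_det[OF bc bc' True] real_sqrt_mult)
      then have "ennreal (bd_weight c k x) = ennreal (bd_weight c' k' (?T x)) * ennreal \<bar>det (matrix (?D x))\<bar>"
        using bd_weight_nonneg[OF c'] by (simp add: ennreal_mult mult.commute)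
      moreover have "bd_map c' k' (?T x) = bd_map c k x" unfolding bd_map_def n T(3) ..
      ultimately show ?thesis using True by (simp add: mult_ac)
    next
      case False
      have "bd_weight c k x = 0 \<or> bd_map c k x \<notin> B"
        using False Bc overlap_iff[OF c, of "hyper_proj k x" c'] by (auto simp: bd_weight_def bd_map_def slab_overlap_def)
      then show ?thesis using False by auto
    qed
  qed
  also have "\<dots> = emeasure (bd_chart c k) B" using emeasure_bd_chart[OF c B] by simp
  finally show ?thesis by simp
qed

abbreviation bdvol :: "'m measure" where "bdvol \<equiv> boundary_volume A g \<Omega>"

lemma emeasure_bd_chart_interior:
  assumes bc: "boundary_chart A \<Omega> c k" and B: "B \<in> sets borel" "B \<subseteq> - frontier \<Omega>"
  shows "emeasure (bd_chart c k) B = 0"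
proof -
  have "ennreal (bd_weight c k x) * indicator B (bd_map c k x) = 0" for x
    using bd_map_mem(3)[OF bc, of x] B(2) by (cases "bd_weight c k x = 0") (auto simp: indicator_def)
  note 0 = this
  show ?thesis unfolding emeasure_bd_chart[OF boundary_chart_A[OF bc] B(1)] 0 by simp
qed

text \<open>The description in \<open>boundary_volume\<close> is brought into the form of
  \<open>glue_measures\<close>. Boundary charts need not cover the manifold, so the complement of
  the frontier joins the cover as the index \<open>None\<close> with the zero measure; this encodes
  that the boundary measure is concentrated on the frontier.\<close>

lemma boundary_volume_spec:
  "sets bdvol = sets borel" "emeasure bdvol (- frontier \<Omega>) = 0"
  "boundary_chart A \<Omega> c k \<Longrightarrow> B \<in> sets borel \<Longrightarrow> B \<subseteq> cdom c \<Longrightarrow> emeasure bdvol B = emeasure (bd_chart c k) B"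
proof -
  define C :: "(('m, 'n) chart \<times> 'n) option set" where "C = insert None (Some ` {(c, k). boundary_chart A \<Omega> c k})"
  define D where "D = (\<lambda>z :: (('m, 'n) chart \<times> 'n) option. case z of None \<Rightarrow> - frontier \<Omega> | Some (c, k) \<Rightarrow> cdom c)"
  define m where "m = (\<lambda>z :: (('m, 'n) chart \<times> 'n) option. case z of None \<Rightarrow> null_measure borel | Some (c, k) \<Rightarrow> bd_chart c k)"
  let ?Q = "\<lambda>\<sigma>. sets \<sigma> = sets borel \<and> (\<forall>z\<in>C. \<forall>B\<in>sets borel. B \<subseteq> D z \<longrightarrow> emeasure \<sigma> B = emeasure (m z) B)"
  have ofr: "open (- frontier \<Omega>)" by (simp add: frontier_closed open_Compl)
  have ex1: "\<exists>!\<sigma>. ?Q \<sigma>"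
  proof (rule glue_measures)
    show "open (D z)" if "z \<in> C" for z
    proof (cases z)
      case (Some q)
      obtain c k where q: "q = (c, k)" by (cases q)
      have "boundary_chart A \<Omega> c k" using that Some q by (auto simp: C_def)
      then show ?thesis unfolding Some q D_def using open_cdom[OF boundary_chart_A] by simp
    qed (simp add: D_def ofr)
    show "\<Union>(D ` C) = UNIV"
    proof (intro set_eqI iffI UNIV_I)
      fix p
      show "p \<in> \<Union>(D ` C)"
      proof (cases "p \<in> frontier \<Omega>")
        case True
        then obtain c k where "boundary_chart A \<Omega> c k" "p \<in> cdom c" using ex_boundary_chart by blast
        then have "Some (c, k) \<in> C" "p \<in> D (Some (c, k))" by (auto simp: C_def D_def)
        then show ?thesis by blast
      next
        case False
        then have "p \<in> D None" "None \<in> C" by (auto simp: C_def D_def)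
        then show ?thesis by blast
      qed
    qed
    show "sets (m z) = sets borel" if "z \<in> C" for z using that by (auto simp: C_def m_def)
    have interior: "emeasure (m z) B = 0" if "z \<in> C" "B \<in> sets borel" "B \<subseteq> - frontier \<Omega>" for z B
    proof (cases z)
      case (Some q)
      obtain c k where q: "q = (c, k)" by (cases q)
      have "boundary_chart A \<Omega> c k" using that Some q by (auto simp: C_def)
      then show ?thesis using emeasure_bd_chart_interior[of c k B] that by (simp add: m_def Some q)
    qed (simp add: m_def)
    show "emeasure (m z) B = emeasure (m z') B" if z: "z \<in> C" "z' \<in> C" and B: "B \<in> sets borel" "B \<subseteq> D z \<inter> D z'" for z z' B
    proof (cases "z = None \<or> z' = None")
      case True
      then have "B \<subseteq> - frontier \<Omega>" using B(2) by (auto simp: D_def)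
      then show ?thesis using interior z B by simp
    next
      case False
      then obtain c k c' k' where q: "z = Some (c, k)" "z' = Some (c', k')" by (metis not_None_eq surj_pair)
      have "boundary_chart A \<Omega> c k" "boundary_chart A \<Omega> c' k'" using z q by (auto simp: C_def)
      then show ?thesis using bd_chart_compatible[of c k c' k' B] B by (simp add: q m_def D_def)
    qed
  qed
  have formula: "(\<integral>\<^sup>+y. ennreal (sqrt (det (induced_gram k (g c (insert_zero k y))))) * indicator (cmap c ` B) (insert_zero k y) \<partial>hyper_PiM k) =
      emeasure (bd_chart c k) B" if bc: "boundary_chart A \<Omega> c k" and B: "B \<in> sets borel" "B \<subseteq> cdom c" for c k B
  proof -
    note c = boundary_chart_A[OF bc]
    define F where "F = (\<lambda>z. ennreal (if z \<in> crange c then sqrt (det (induced_gram k (g c z))) else 0) * indicator B (cinv c z))"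
    have [measurable]: "(\<lambda>z. if z \<in> crange c then sqrt (det (induced_gram k (g c z))) else 0) \<in> borel_measurable borel"
      using open_crange[OF c] continuous_on_sqrt_induced[OF c] by (intro borel_measurable_continuous_on_if) auto
    note measurable_cinv[OF c, measurable] B(1)[measurable]
    have [measurable]: "F \<in> borel_measurable borel" unfolding F_def by measurable
    have F: "ennreal (sqrt (det (induced_gram k (g c z)))) * indicator (cmap c ` B) z = F z" for z
      unfolding cmap_image_eq[OF c B(2)] by (auto simp: F_def indicator_def)
    have "(\<integral>\<^sup>+y. F (insert_zero k y) \<partial>hyper_PiM k) =
        (\<integral>\<^sup>+x. F (hyper_proj k x) * indicator {x. 0 < x $ k \<and> x $ k < 1} x \<partial>lborel)"
      by (rule nn_integral_insert_zero) measurable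
    also have "\<dots> = emeasure (bd_chart c k) B"
      unfolding emeasure_bd_chart[OF c B(1)]
      by (intro nn_integral_cong) (auto simp: F_def bd_weight_def bd_map_def indicator_def)
    finally show ?thesis unfolding F .
  qed
  \<comment> \<open>The description tests Borel sets inside the frontier, gluing tests all Borel
    sets in a chart. The two agree because both the candidate and the chart measures are null off
    the frontier.\<close>
  have Q: "?Q \<sigma> \<longleftrightarrow> sets \<sigma> = sets borel \<and> emeasure \<sigma> (- frontier \<Omega>) = 0 \<and>
     (\<forall>c k. boundary_chart A \<Omega> c k \<longrightarrow> (\<forall>B\<in>sets borel. B \<subseteq> cdom c \<inter> frontier \<Omega> \<longrightarrow>
       emeasure \<sigma> B = (\<integral>\<^sup>+y. ennreal (sqrt (det (induced_gram k (g c (insert_zero k y))))) * indicator (cmap c ` B) (insert_zero k y) \<partial>hyper_PiM k)))"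
    (is "?Q \<sigma> \<longleftrightarrow> ?R \<sigma>") for \<sigma>
  proof
    assume q: "?Q \<sigma>"
    have "emeasure \<sigma> (- frontier \<Omega>) = emeasure (m None) (- frontier \<Omega>)"
      using q[THEN conjunct2, rule_format, of None "- frontier \<Omega>"] ofr by (simp add: C_def D_def)
    moreover have "emeasure \<sigma> B = emeasure (bd_chart c k) B"
      if "boundary_chart A \<Omega> c k" "B \<in> sets borel" "B \<subseteq> cdom c" for c k B
    proof -
      have "Some (c, k) \<in> C" using that(1) by (auto simp: C_def)
      then have "emeasure \<sigma> B = emeasure (m (Some (c, k))) B"
        using q[THEN conjunct2, rule_format, of "Some (c, k)" B] that by (simp add: D_def)
      then show ?thesis by (simp add: m_def)
    qed
    ultimately show "?R \<sigma>" using q formula by (intro conjI allI impI ballI) (simp_all add: m_def)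
  next
    assume r: "?R \<sigma>"
    have None: "emeasure \<sigma> B = 0" if "B \<in> sets borel" "B \<subseteq> - frontier \<Omega>" for B
    proof -
      have "emeasure \<sigma> B \<le> emeasure \<sigma> (- frontier \<Omega>)"
        using r that ofr by (intro emeasure_mono) auto
      then show ?thesis using r by simp
    qed
    have some: "emeasure \<sigma> B = emeasure (bd_chart c k) B"
      if bc: "boundary_chart A \<Omega> c k" and B: "B \<in> sets borel" "B \<subseteq> cdom c" for c k B
    proof -
      have fr: "frontier \<Omega> \<in> sets borel" by (simp add: frontier_closed)
      have split: "emeasure \<mu> B = emeasure \<mu> (B \<inter> frontier \<Omega>) + emeasure \<mu> (B - frontier \<Omega>)"
        if "sets \<mu> = sets borel" for \<mu> :: "'m measure"
      proof -
        have "emeasure \<mu> (B \<inter> frontier \<Omega>) + emeasure \<mu> (B - frontier \<Omega>) = emeasure \<mu> ((B \<inter> frontier \<Omega>) \<union> (B - frontier \<Omega>))"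
          by (rule plus_emeasure) (use that B fr in auto)
        also have "(B \<inter> frontier \<Omega>) \<union> (B - frontier \<Omega>) = B" by blast
        finally show ?thesis by simp
      qed
      have "emeasure \<sigma> (B \<inter> frontier \<Omega>) = emeasure (bd_chart c k) (B \<inter> frontier \<Omega>)"
      proof -
        have *: "B \<inter> frontier \<Omega> \<in> sets borel" "B \<inter> frontier \<Omega> \<subseteq> cdom c" "B \<inter> frontier \<Omega> \<subseteq> cdom c \<inter> frontier \<Omega>"
          using B fr by auto
        show ?thesis
          using r[THEN conjunct2, THEN conjunct2, rule_format, OF bc *(1,3)] formula[OF bc *(1,2)] by (simp only:)
      qed
      moreover have "emeasure \<sigma> (B - frontier \<Omega>) = 0" "emeasure (bd_chart c k) (B - frontier \<Omega>) = 0"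
        using None[of "B - frontier \<Omega>"] emeasure_bd_chart_interior[OF bc, of "B - frontier \<Omega>"] B fr by auto
      ultimately show ?thesis using split[of \<sigma>] split[of "bd_chart c k"] r by simp
    qed
    show "?Q \<sigma>"
    proof (intro conjI ballI impI)
      fix z B assume z: "z \<in> C" "B \<in> sets borel" "B \<subseteq> D z"
      show "emeasure \<sigma> B = emeasure (m z) B"
      proof (cases z)
        case None
        then show ?thesis using \<open>\<And>B. B \<in> sets borel \<Longrightarrow> B \<subseteq> - frontier \<Omega> \<Longrightarrow> emeasure \<sigma> B = 0\<close> z by (simp add: D_def m_def)
      next
        case (Some q)
        obtain c k where q: "q = (c, k)" by (cases q)
        have "boundary_chart A \<Omega> c k" using z(1) Some q by (auto simp: C_def)
        then show ?thesis using some[of c k B] z(2,3) by (simp add: D_def m_def Some q)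
      qed
    qed (use r in simp)
  qed
  have "bdvol = (THE \<sigma>. ?Q \<sigma>)" unfolding boundary_volume_def using Q by (intro arg_cong[where f = The] ext) auto
  then have q: "?Q bdvol" using theI'[OF ex1] by simp
  then show "sets bdvol = sets borel" "emeasure bdvol (- frontier \<Omega>) = 0" using Q[of bdvol] by auto
  show "boundary_chart A \<Omega> c k \<Longrightarrow> B \<in> sets borel \<Longrightarrow> B \<subseteq> cdom c \<Longrightarrow> emeasure bdvol B = emeasure (bd_chart c k) B"
  proof -
    assume bc: "boundary_chart A \<Omega> c k" and B: "B \<in> sets borel" "B \<subseteq> cdom c"
    have "Some (c, k) \<in> C" using bc by (auto simp: C_def)
    then have "emeasure bdvol B = emeasure (m (Some (c, k))) B"
      using q[THEN conjunct2, rule_format, of "Some (c, k)" B] B by (simp add: D_def)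
    then show ?thesis by (simp add: m_def)
  qed
qed

lemma integral_bdvol:
  assumes bc: "boundary_chart A \<Omega> c k"
    and F: "F \<in> borel_measurable borel" "\<And>p. p \<notin> cdom c \<Longrightarrow> F p = (0::real)"
  shows "integrable bdvol F \<longleftrightarrow> integrable lborel (\<lambda>x. bd_weight c k x * F (bd_map c k x))"
    and "(LINT p|bdvol. F p) = (LINT x|lborel. bd_weight c k x * F (bd_map c k x))"
proof -
  note c = boundary_chart_A[OF bc]
  note * = integral_by_chart[OF boundary_volume_spec(1) open_cdom[OF c] measurable_bd_weight[OF c]
      bd_weight_nonneg[OF c] measurable_bd_map[OF c] bd_map_mem(2)[OF bc] boundary_volume_spec(3)[OF bc] F]
  show "integrable bdvol F \<longleftrightarrow> integrable lborel (\<lambda>x. bd_weight c k x * F (bd_map c k x))"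
    "(LINT p|bdvol. F p) = (LINT x|lborel. bd_weight c k x * F (bd_map c k x))" by (rule *; assumption)+
qed

end

section \<open>The outward normal in boundary charts\<close>

lemma has_derivative_transform_at_within:
  assumes f: "(f has_derivative f') (at x within S)"
    and ev: "\<forall>\<^sub>F y in at x within S. f y = g y" and x: "f x = g x"
  shows "(g has_derivative f') (at x within S)"
  unfolding has_derivative_within
proof
  show "bounded_linear f'" using f by (rule has_derivative_bounded_linear)
  have "((\<lambda>y. (1 / norm (y - x)) *\<^sub>R (f y - (f x + f' (y - x)))) \<longlongrightarrow> 0) (at x within S)"
    using f unfolding has_derivative_within by simp
  then show "((\<lambda>y. (1 / norm (y - x)) *\<^sub>R (g y - (g x + f' (y - x)))) \<longlongrightarrow> 0) (at x within S)"
    by (rule Lim_transform_eventually) (use ev in eventually_elim, simp add: x)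
qed

context regular_domain
begin

definition inv_nn :: "('m, 'n) chart \<Rightarrow> 'n \<Rightarrow> real^'n \<Rightarrow> real" where
  "inv_nn c k x = matrix_inv (g c x) $ k $ k"

text \<open>The gradient of the boundary-defining coordinate \<open>x $ k\<close> divided by its
  length, \<open>inv_nn\<close> being the squared length. It points outward since \<Omega> is the
  side where that coordinate is negative.\<close>

definition unit_normal :: "('m, 'n) chart \<Rightarrow> 'n \<Rightarrow> real^'n \<Rightarrow> real^'n" where
  "unit_normal c k x = (1 / sqrt (inv_nn c k x)) *\<^sub>R (matrix_inv (g c x) *v axis k 1)"

lemma metric_inv_mult:
  assumes "c \<in> A" "x \<in> crange c"
  shows "g c x *v (matrix_inv (g c x) *v v) = v" "matrix_inv (g c x) *v (g c x *v v) = v"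
  using matrix_inv_mult[of "g c x"] det_metric_pos[OF assms] by (simp_all add: matrix_vector_mul_assoc)

lemma inv_nn_eq: "(matrix_inv (g c x) *v axis k 1) $ k = inv_nn c k x"
  by (simp add: inv_nn_def matrix_vector_mult_basis column_def)

lemma inv_nn_pos:
  assumes "c \<in> A" "x \<in> crange c" shows "0 < inv_nn c k x"
proof -
  let ?n = "matrix_inv (g c x) *v axis k 1"
  have "?n \<noteq> 0" using metric_inv_mult(1)[OF assms, of "axis k 1"]
    by (metis axis_eq_0_iff matrix_vector_mult_0_right zero_neq_one)
  then have "0 < ?n \<bullet> (g c x *v ?n)" by (rule metric_pos[OF assms])
  then show ?thesis unfolding metric_inv_mult(1)[OF assms] by (simp add: inner_axis inv_nn_eq)
qed

lemma metric_unit_normal: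
  assumes "c \<in> A" "x \<in> crange c"
  shows "w \<bullet> (g c x *v unit_normal c k x) = w $ k / sqrt (inv_nn c k x)"
  unfolding unit_normal_def matrix_vector_mult_scaleR metric_inv_mult(1)[OF assms]
  by (simp add: inner_axis)

lemma unit_normal_nth:
  assumes "c \<in> A" "x \<in> crange c" shows "unit_normal c k x $ k = sqrt (inv_nn c k x)"
  using inv_nn_pos[OF assms, of k] by (simp add: unit_normal_def inv_nn_eq real_div_sqrt)

lemma unit_normal_norm:
  assumes "c \<in> A" "x \<in> crange c" shows "unit_normal c k x \<bullet> (g c x *v unit_normal c k x) = 1"
  unfolding metric_unit_normal[OF assms] unit_normal_nth[OF assms] using inv_nn_pos[OF assms, of k] by simp

context
  fixes c k c0 p
  assumes bc: "boundary_chart A \<Omega> c k" and c0: "c0 \<in> A"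
    and p: "p \<in> cdom c" "p \<in> cdom c0" "p \<in> frontier \<Omega>"
begin

lemma pt_facts:
  shows "c \<in> A" "cmap c p \<in> overlap c c0" "cmap c0 p \<in> overlap c0 c" "cmap c p \<in> crange c"
    "transition c c0 (cmap c p) = cmap c0 p" "transition c0 c (cmap c0 p) = cmap c p" "cmap c p $ k = 0"
  using boundary_chart_A[OF bc] c0 p boundary_chart_frontier[OF bc p(1)]
  by (auto simp: transition_def cinv_cmap)

lemma jacobian_cancel:
  "jacobian c0 c (cmap c0 p) *v (jacobian c c0 (cmap c p) *v v) = v"
  "jacobian c c0 (cmap c p) *v (jacobian c0 c (cmap c0 p) *v v) = v"
  using jacobian_inverse[OF pt_facts(1) c0 pt_facts(2)] jacobian_inverse[OF c0 pt_facts(1,3)]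
  by (simp_all add: pt_facts(5,6) matrix_vector_mul_assoc)

lemma metric_at_pt: "v \<bullet> (g c (cmap c p) *v w) =
    (jacobian c c0 (cmap c p) *v v) \<bullet> (g c0 (cmap c0 p) *v (jacobian c c0 (cmap c p) *v w))"
  using metric_transform_inner[OF pt_facts(1) c0 pt_facts(2)] by (simp add: pt_facts(5))

lemma line_in_overlap: "\<forall>\<^sub>F t in at 0 within S. cmap c0 p + t *\<^sub>R v \<in> overlap c0 c"
proof -
  have "((\<lambda>t::real. cmap c0 p + t *\<^sub>R v) \<longlongrightarrow> cmap c0 p + 0 *\<^sub>R v) (at 0 within S)"
    by (intro tendsto_intros)
  then show ?thesis
    using topological_tendstoD[OF _ open_overlap[OF c0 pt_facts(1)]] pt_facts(3) by fastforce
qed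

lemma line_derivative_component:
  "((\<lambda>t. transition c0 c (cmap c0 p + t *\<^sub>R v) $ k) has_real_derivative (jacobian c0 c (cmap c0 p) *v v) $ k) (at 0)"
proof -
  have T: "(transition c0 c has_derivative (*v) (jacobian c0 c (cmap c0 p))) (at (cmap c0 p + 0 *\<^sub>R v))"
    using transition_has_derivative[OF c0 pt_facts(1,3)] by simp
  have "((\<lambda>t. transition c0 c (cmap c0 p + t *\<^sub>R v)) has_derivative (\<lambda>t. jacobian c0 c (cmap c0 p) *v (t *\<^sub>R v))) (at 0)"
    by (rule has_derivative_compose[of "\<lambda>t. cmap c0 p + t *\<^sub>R v" "\<lambda>t. t *\<^sub>R v" 0 UNIV, OF _ T])
      (auto intro!: derivative_eq_intros)
  from bounded_linear.has_derivative[OF bounded_linear_vec_nth this, of k]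
  show ?thesis unfolding has_field_derivative_def
    by (rule has_derivative_eq_rhs) (simp add: matrix_vector_mult_scaleR fun_eq_iff mult.commute)
qed

text \<open>A velocity with positive \<open>k\<close>-component in the boundary chart leaves the
  closure forwards and enters \<Omega> backwards. The first half gives the outward condition on the
  normal; the second excludes the wrong sign and provides the interior points for the normal
  derivative from the left.\<close>

lemma line_side:
  assumes "(jacobian c0 c (cmap c0 p) *v v) $ k > 0"
  shows "\<forall>\<^sub>F t in at_right 0. cmap c0 p + t *\<^sub>R v \<in> overlap c0 c \<and> transition c0 c (cmap c0 p + t *\<^sub>R v) $ k > 0"
    and "\<forall>\<^sub>F t in at_left 0. cmap c0 p + t *\<^sub>R v \<in> overlap c0 c \<and> transition c0 c (cmap c0 p + t *\<^sub>R v) $ k < 0"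
proof -
  have h0: "transition c0 c (cmap c0 p + 0 *\<^sub>R v) $ k = 0" by (simp add: pt_facts(6,7))
  obtain d where d: "d > 0" "\<And>h. 0 < h \<Longrightarrow> h < d \<Longrightarrow> transition c0 c (cmap c0 p + h *\<^sub>R v) $ k > 0"
    using DERIV_pos_inc_right[OF line_derivative_component assms] unfolding h0 by auto
  have "\<forall>\<^sub>F t in at_right 0. transition c0 c (cmap c0 p + t *\<^sub>R v) $ k > 0"
    unfolding eventually_at_right_field using d by (intro exI[of _ d]) auto
  then show "\<forall>\<^sub>F t in at_right 0. cmap c0 p + t *\<^sub>R v \<in> overlap c0 c \<and> transition c0 c (cmap c0 p + t *\<^sub>R v) $ k > 0"
    by (intro eventually_conj line_in_overlap)
  obtain d where d: "d > 0" "\<And>h. 0 < h \<Longrightarrow> h < d \<Longrightarrow> transition c0 c (cmap c0 p + (0 - h) *\<^sub>R v) $ k < 0"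
    using DERIV_pos_inc_left[OF line_derivative_component assms] unfolding h0 by auto
  have "\<forall>\<^sub>F t in at_left 0. transition c0 c (cmap c0 p + t *\<^sub>R v) $ k < 0"
    unfolding eventually_at_left_field
  proof (intro exI[of _ "- d"] conjI allI impI)
    fix t :: real assume "- d < t" "t < 0"
    then show "transition c0 c (cmap c0 p + t *\<^sub>R v) $ k < 0" using d(2)[of "- t"] by simp
  qed (use d in simp)
  then show "\<forall>\<^sub>F t in at_left 0. cmap c0 p + t *\<^sub>R v \<in> overlap c0 c \<and> transition c0 c (cmap c0 p + t *\<^sub>R v) $ k < 0"
    by (intro eventually_conj line_in_overlap)
qed

lemma boundary_tangent_nth:
  assumes "w \<in> boundary_tangent c0 \<Omega> p"
  shows "(jacobian c0 c (cmap c0 p) *v w) $ k = 0"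
proof -
  obtain \<gamma> where \<gamma>: "\<gamma> 0 = cmap c0 p" "(\<gamma> has_vector_derivative w) (at 0)"
    "\<forall>\<^sub>F t in at 0. \<gamma> t \<in> cmap c0 ` (cdom c0 \<inter> frontier \<Omega>)"
    using assms unfolding boundary_tangent_def by blast
  have T: "(transition c0 c has_derivative (*v) (jacobian c0 c (cmap c0 p))) (at (\<gamma> 0))"
    using transition_has_derivative[OF c0 pt_facts(1,3)] \<gamma>(1) by simp
  have "((\<lambda>t. transition c0 c (\<gamma> t)) has_derivative (\<lambda>t. jacobian c0 c (cmap c0 p) *v (t *\<^sub>R w))) (at 0)"
    using has_derivative_compose[of \<gamma> "\<lambda>t. t *\<^sub>R w" 0 UNIV, OF _ T] \<gamma>(2) by (simp add: has_vector_derivative_def)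
  then have d: "((\<lambda>t. transition c0 c (\<gamma> t) $ k) has_derivative (\<lambda>t. (jacobian c0 c (cmap c0 p) *v (t *\<^sub>R w)) $ k)) (at 0)"
    by (rule bounded_linear.has_derivative[OF bounded_linear_vec_nth])
  have "(\<gamma> \<longlongrightarrow> \<gamma> 0) (at 0)"
    using has_vector_derivative_continuous[OF \<gamma>(2)] by (simp add: continuous_at)
  then have "\<forall>\<^sub>F t in at 0. \<gamma> t \<in> overlap c0 c"
    using topological_tendstoD[OF _ open_overlap[OF c0 pt_facts(1)]] pt_facts(3) \<gamma>(1) by fastforce
  then have "\<forall>\<^sub>F t in at 0. transition c0 c (\<gamma> t) $ k = 0"
    using \<gamma>(3)
  proof eventually_elim
    case (elim t)
    obtain q where q: "q \<in> cdom c0" "q \<in> frontier \<Omega>" "\<gamma> t = cmap c0 q" using elim(2) by blast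
    have "cinv c0 (\<gamma> t) = q" using q cinv_cmap[OF c0] by simp
    moreover have "cinv c0 (\<gamma> t) \<in> cdom c" using elim(1) overlap_iff[OF c0] by blast
    ultimately show ?case unfolding transition_def using boundary_chart_frontier[OF bc, of q] q(2) by simp
  qed
  then have "((\<lambda>t. 0) has_derivative (\<lambda>t. (jacobian c0 c (cmap c0 p) *v (t *\<^sub>R w)) $ k)) (at 0)"
    by (intro has_derivative_transform_eventually[OF d]) (auto simp: \<gamma>(1) pt_facts(6,7))
  then have "(\<lambda>t. (jacobian c0 c (cmap c0 p) *v (t *\<^sub>R w)) $ k) = (\<lambda>_. 0)"
    using has_derivative_const has_derivative_unique by blast
  then have "(jacobian c0 c (cmap c0 p) *v (1 *\<^sub>R w)) $ k = 0" by (rule fun_cong)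
  then show ?thesis by simp
qed

text \<open>Straight lines in the hyperplane of the boundary chart are boundary curves. With
  \<open>boundary_tangent_nth\<close> this identifies the tangent vectors, defined by curves, with
  the hyperplane \<open>w $ k = 0\<close>.\<close>

lemma boundary_tangent_mem:
  assumes w: "w $ k = 0" shows "jacobian c c0 (cmap c p) *v w \<in> boundary_tangent c0 \<Omega> p"
proof -
  let ?\<gamma> = "\<lambda>t::real. cmap c p + t *\<^sub>R w"
  have T: "(transition c c0 has_derivative (*v) (jacobian c c0 (cmap c p))) (at (?\<gamma> 0))"
    using transition_has_derivative[OF pt_facts(1) c0 pt_facts(2)] by simp
  have "((\<lambda>t. transition c c0 (?\<gamma> t)) has_derivative (\<lambda>t. jacobian c c0 (cmap c p) *v (t *\<^sub>R w))) (at 0)"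
    by (rule has_derivative_compose[of ?\<gamma> "\<lambda>t. t *\<^sub>R w" 0 UNIV, OF _ T]) (auto intro!: derivative_eq_intros)
  then have d: "((\<lambda>t. transition c c0 (?\<gamma> t)) has_vector_derivative jacobian c c0 (cmap c p) *v w) (at 0)"
    by (simp add: has_vector_derivative_def matrix_vector_mult_scaleR)
  have "(?\<gamma> \<longlongrightarrow> ?\<gamma> 0) (at 0)" by (intro tendsto_intros)
  then have "\<forall>\<^sub>F t in at 0. ?\<gamma> t \<in> overlap c c0"
    using topological_tendstoD[OF _ open_overlap[OF pt_facts(1) c0]] pt_facts(2) by fastforce
  then have "\<forall>\<^sub>F t in at 0. transition c c0 (?\<gamma> t) \<in> cmap c0 ` (cdom c0 \<inter> frontier \<Omega>)"
  proof eventually_elim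
    case (elim t)
    then have r: "?\<gamma> t \<in> crange c" "cinv c (?\<gamma> t) \<in> cdom c0" using overlap_iff[OF pt_facts(1)] by blast+
    have "?\<gamma> t $ k = 0" using w pt_facts(7) by simp
    then have "cinv c (?\<gamma> t) \<in> frontier \<Omega>" using boundary_cinv(3)[OF bc r(1)] by simp
    then show ?case unfolding transition_def using r(2) by blast
  qed
  then show ?thesis unfolding boundary_tangent_def
    using d by (intro CollectI exI[of _ "\<lambda>t. transition c c0 (?\<gamma> t)"]) (simp add: pt_facts(5))
qed

text \<open>The normal is defined in an arbitrary chart \<open>c0\<close>, which need not be a
  boundary chart; \<open>unit_normal\<close> is computed in a boundary chart and transported. For
  uniqueness, orthogonality fixes the line, the unit norm the length, and the condition on the side
  the sign.\<close>

lemma outward_normal_boundary_chart: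
  "outward_normal g c0 \<Omega> p = jacobian c c0 (cmap c p) *v unit_normal c k (cmap c p)"
proof -
  let ?x = "cmap c p" and ?z = "cmap c0 p"
  let ?J = "jacobian c c0 ?x" and ?J' = "jacobian c0 c ?z" and ?N = "unit_normal c k ?x"
  let ?n = "matrix_inv (g c ?x) *v axis k 1"
  note N = metric_unit_normal[OF pt_facts(1,4)] unit_normal_nth[OF pt_facts(1,4)] unit_normal_norm[OF pt_facts(1,4)]
  have npos: "0 < inv_nn c k ?x" by (rule inv_nn_pos[OF pt_facts(1,4)])
  show ?thesis unfolding outward_normal_def
  proof (rule the_equality, intro conjI ballI)
    show "(?J *v ?N) \<bullet> (g c0 ?z *v (?J *v ?N)) = 1"
      unfolding metric_at_pt[symmetric] by (rule N(3))
    show "(?J *v ?N) \<bullet> (g c0 ?z *v w) = 0" if "w \<in> boundary_tangent c0 \<Omega> p" for w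
    proof -
      have "(?J *v ?N) \<bullet> (g c0 ?z *v (?J *v (?J' *v w))) = ?N \<bullet> (g c ?x *v (?J' *v w))"
        by (rule metric_at_pt[symmetric])
      also have "\<dots> = (?J' *v w) \<bullet> (g c ?x *v ?N)" by (rule metric_inner_commute[OF pt_facts(1,4)])
      also have "\<dots> = 0" unfolding N(1) boundary_tangent_nth[OF that] by simp
      finally show ?thesis unfolding jacobian_cancel .
    qed
    have "(?J' *v (?J *v ?N)) $ k > 0" unfolding jacobian_cancel N(2) using npos by simp
    from line_side(1)[OF this]
    show "\<forall>\<^sub>F t in at_right 0. ?z + t *\<^sub>R (?J *v ?N) \<notin> cmap c0 ` (cdom c0 \<inter> closure \<Omega>)"
    proof eventually_elim
      case (elim t)
      show ?case
      proof
        assume "?z + t *\<^sub>R (?J *v ?N) \<in> cmap c0 ` (cdom c0 \<inter> closure \<Omega>)"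
        then obtain q where q: "q \<in> cdom c0" "q \<in> closure \<Omega>" "?z + t *\<^sub>R (?J *v ?N) = cmap c0 q" by blast
        have "cinv c0 (cmap c0 q) = q" using q cinv_cmap[OF c0] by simp
        moreover have "cinv c0 (cmap c0 q) \<in> cdom c" using elim overlap_iff[OF c0] q(3) by metis
        ultimately show False
          using elim boundary_chart_closure[OF bc, of q] q(2) unfolding q(3) transition_def by simp
      qed
    qed
  next
    fix \<nu> assume "\<nu> \<bullet> (g c0 ?z *v \<nu>) = 1 \<and> (\<forall>w\<in>boundary_tangent c0 \<Omega> p. \<nu> \<bullet> (g c0 ?z *v w) = 0) \<and>
      (\<forall>\<^sub>F t in at_right 0. ?z + t *\<^sub>R \<nu> \<notin> cmap c0 ` (cdom c0 \<inter> closure \<Omega>))"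
    then have \<nu>: "\<nu> \<bullet> (g c0 ?z *v \<nu>) = 1" "\<And>w. w \<in> boundary_tangent c0 \<Omega> p \<Longrightarrow> \<nu> \<bullet> (g c0 ?z *v w) = 0"
      "\<forall>\<^sub>F t in at_right 0. ?z + t *\<^sub>R \<nu> \<notin> cmap c0 ` (cdom c0 \<inter> closure \<Omega>)" by blast+
    define m where "m = ?J' *v \<nu>"
    have Jm: "?J *v m = \<nu>" unfolding m_def by (rule jacobian_cancel)
    have orth: "w \<bullet> (g c ?x *v m) = 0" if "w $ k = 0" for w
    proof -
      have "w \<bullet> (g c ?x *v m) = m \<bullet> (g c ?x *v w)" by (rule metric_inner_commute[OF pt_facts(1,4)])
      also have "\<dots> = \<nu> \<bullet> (g c0 ?z *v (?J *v w))" using metric_at_pt[of m w] unfolding Jm .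
      also have "\<dots> = 0" by (rule \<nu>(2)[OF boundary_tangent_mem[OF that]])
      finally show ?thesis .
    qed
    define l where "l = (g c ?x *v m) $ k"
    \<comment> \<open>Orthogonality to the unit vectors other than the \<open>k\<close>-th leaves
      \<open>g m\<close> only its \<open>k\<close>-th component; inverting the metric then
      determines \<open>m\<close> up to the factor \<open>l\<close>.\<close>
    have "(g c ?x *v m) $ i = (l *\<^sub>R axis k 1) $ i" for i
    proof (cases "i = k")
      case False
      then have "axis i 1 \<bullet> (g c ?x *v m) = 0" by (intro orth) (simp add: axis_def)
      then have "(g c ?x *v m) $ i = 0" by (simp only: inner_axis' inner_real_def mult_1)
      then show ?thesis using False by (simp add: axis_def)
    qed (simp add: l_def)
    then have Gm: "g c ?x *v m = l *\<^sub>R axis k 1" by (simp add: vec_eq_iff)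
    then have "matrix_inv (g c ?x) *v (g c ?x *v m) = l *\<^sub>R ?n" by (simp add: matrix_vector_mult_scaleR)
    then have m: "m = l *\<^sub>R ?n" unfolding metric_inv_mult[OF pt_facts(1,4)] .
    have mk: "m $ k = l * inv_nn c k ?x" unfolding m by (simp add: inv_nn_eq)
    have "1 = m \<bullet> (g c ?x *v m)" using \<nu>(1) metric_at_pt[of m m] unfolding Jm by simp
    also have "\<dots> = l * (l * inv_nn c k ?x)" unfolding Gm using mk by (simp add: inner_axis)
    finally have l2: "l * l * inv_nn c k ?x = 1" by (simp add: mult.assoc)
    have "l > 0"
    proof (rule ccontr)
      assume "\<not> l > 0"
      moreover have "l \<noteq> 0" using l2 by auto
      ultimately have "l < 0" by simp
      \<comment> \<open>With \<open>l\<close> negative, \<open>- \<nu>\<close> points to the side of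
        positive \<open>k\<close>-coordinate. Running its line backwards is running along
        \<open>\<nu>\<close> forwards, which would enter \<Omega>, against the third
        condition.\<close>
      then have "(?J' *v (- \<nu>)) $ k > 0"
        using npos mk matrix_vector_mult_scaleR[of ?J' "- 1" \<nu>] unfolding m_def by (simp add: mult_neg_pos)
      from line_side(2)[OF this]
      have ev: "\<forall>\<^sub>F t in at_right 0. ?z + (- t) *\<^sub>R (- \<nu>) \<in> overlap c0 c \<and> transition c0 c (?z + (- t) *\<^sub>R (- \<nu>)) $ k < 0"
        by (subst (asm) at_left_minus) (simp add: eventually_filtermap)
      have "\<forall>\<^sub>F t in at_right (0::real). False"
        using ev \<nu>(3)
      proof eventually_elim
        case (elim t)
        let ?y = "?z + t *\<^sub>R \<nu>"
        have y: "?y \<in> crange c0" "cinv c0 ?y \<in> cdom c" using elim(1) overlap_iff[OF c0, of ?y c] by auto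
        have "cinv c0 ?y \<in> \<Omega>" using boundary_chart_\<Omega>[OF bc y(2)] elim(1) by (simp add: transition_def)
        then have "cinv c0 ?y \<in> cdom c0 \<inter> closure \<Omega>" using cinv_cdom[OF y(1)] closure_subset by blast
        then have "cmap c0 (cinv c0 ?y) \<in> cmap c0 ` (cdom c0 \<inter> closure \<Omega>)" by (rule imageI)
        then show False using elim(2) cmap_cinv[OF y(1)] by simp
      qed
      then show False by simp
    qed
    have "l = 1 / sqrt (inv_nn c k ?x)"
    proof -
      have sq: "sqrt (inv_nn c k ?x) * sqrt (inv_nn c k ?x) = inv_nn c k ?x" "0 < sqrt (inv_nn c k ?x)" using npos by simp_all
      have "(l * sqrt (inv_nn c k ?x)) * (l * sqrt (inv_nn c k ?x)) = l * l * (sqrt (inv_nn c k ?x) * sqrt (inv_nn c k ?x))"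
        by (simp only: mult_ac)
      then have "(l * sqrt (inv_nn c k ?x))\<^sup>2 = 1" unfolding sq(1) l2 by (simp only: power2_eq_square)
      moreover have "0 < l * sqrt (inv_nn c k ?x)" using \<open>l > 0\<close> sq(2) by (rule mult_pos_pos)
      ultimately have "l * sqrt (inv_nn c k ?x) = 1" unfolding power2_eq_1_iff by linarith
      then show ?thesis using npos by (simp add: field_simps)
    qed
    then have "m = ?N" unfolding m unit_normal_def by simp
    then show "\<nu> = ?J *v ?N" using Jm by simp
  qed
qed

text \<open>Outside the closure \<open>u\<close> carries no information, so the one-sided derivative
  is computed from an extension \<open>F\<close>; at small negative parameters the normal line lies
  in \<Omega>, where the two agree.\<close>

lemma normal_derivative_aux:
  assumes W: "open W" "cmap c p \<in> W" and F: "Ck_on 1 W F"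
    and ext: "\<And>x. x \<in> W \<Longrightarrow> x \<in> crange c \<Longrightarrow> cinv c x \<in> closure \<Omega> \<Longrightarrow> F x = u (cinv c x)"
  shows "vector_derivative (\<lambda>t. u (cinv c0 (cmap c0 p + t *\<^sub>R outward_normal g c0 \<Omega> p))) (at_left 0) =
     frechet_derivative F (at (cmap c p)) (unit_normal c k (cmap c p))"
proof -
  let ?N = "unit_normal c k (cmap c p)" and ?\<nu> = "outward_normal g c0 \<Omega> p" and ?J' = "jacobian c0 c (cmap c0 p)"
  let ?y = "\<lambda>t. cmap c0 p + t *\<^sub>R ?\<nu>"
  have J\<nu>: "?J' *v ?\<nu> = ?N" unfolding outward_normal_boundary_chart jacobian_cancel ..
  have T: "(transition c0 c has_derivative (*v) ?J') (at (?y 0))"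
    using transition_has_derivative[OF c0 pt_facts(1,3)] by simp
  have dT: "((\<lambda>t. transition c0 c (?y t)) has_derivative (\<lambda>t. ?J' *v (t *\<^sub>R ?\<nu>))) (at 0)"
    by (rule has_derivative_compose[of ?y "\<lambda>t. t *\<^sub>R ?\<nu>" 0 UNIV, OF _ T]) (auto intro!: derivative_eq_intros)
  have y0: "transition c0 c (?y 0) = cmap c p" by (simp add: pt_facts(6))
  have dF: "(F has_derivative frechet_derivative F (at (cmap c p))) (at (transition c0 c (?y 0)))"
    using Ck_on_has_derivative[OF F _ W(2)] unfolding y0 by simp
  have "((\<lambda>t. F (transition c0 c (?y t))) has_derivative (\<lambda>t. frechet_derivative F (at (cmap c p)) (?J' *v (t *\<^sub>R ?\<nu>)))) (at 0)"
    by (rule has_derivative_compose[OF dT dF])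
  then have d: "((\<lambda>t. F (transition c0 c (?y t))) has_vector_derivative frechet_derivative F (at (cmap c p)) ?N) (at 0)"
    unfolding has_vector_derivative_def matrix_vector_mult_scaleR J\<nu>
    using linear_scale[OF has_derivative_linear[OF dF]] by simp
  then have dl: "((\<lambda>t. F (transition c0 c (?y t))) has_vector_derivative frechet_derivative F (at (cmap c p)) ?N) (at_left 0)"
    by (rule has_vector_derivative_at_within)
  have "((\<lambda>t. transition c0 c (?y t)) \<longlongrightarrow> cmap c p) (at_left 0)"
    using has_derivative_continuous[OF dT] tendsto_within_subset[OF _ subset_UNIV] y0 by (auto simp: continuous_at)
  then have inW: "\<forall>\<^sub>F t in at_left 0. transition c0 c (?y t) \<in> W" using topological_tendstoD W by blast
  have "(?J' *v ?\<nu>) $ k > 0"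
    unfolding J\<nu> unit_normal_nth[OF pt_facts(1,4)] using inv_nn_pos[OF pt_facts(1,4), of k] by simp
  from line_side(2)[OF this] inW
  have ev: "\<forall>\<^sub>F t in at_left 0. F (transition c0 c (?y t)) = u (cinv c0 (?y t))"
  proof eventually_elim
    case (elim t)
    then have o: "?y t \<in> overlap c0 c" by blast
    note T = transition_overlap[OF c0 pt_facts(1) o]
    have r: "transition c0 c (?y t) \<in> crange c" using T(1) by blast
    have "cinv c (transition c0 c (?y t)) \<in> closure \<Omega>" using boundary_cinv(2)[OF bc r] elim by simp
    then show ?case using ext[OF _ r] elim T(3) by simp
  qed
  have p0: "F (transition c0 c (?y 0)) = u (cinv c0 (?y 0))"
  proof -
    have "p \<in> closure \<Omega>" using p(3) by (simp add: closure_eq)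
    then show ?thesis using ext[OF W(2) pt_facts(4)] cinv_cmap[OF pt_facts(1) p(1)] cinv_cmap[OF c0 p(2)]
      by (simp add: pt_facts(6))
  qed
  have "((\<lambda>t. u (cinv c0 (?y t))) has_vector_derivative frechet_derivative F (at (cmap c p)) ?N) (at_left 0)"
    using dl unfolding has_vector_derivative_def
  proof (rule has_derivative_transform_at_within)
    show "\<forall>\<^sub>F t in at_left 0. F (transition c0 c (?y t)) = u (cinv c0 (?y t))" by (rule ev)
    show "F (transition c0 c (?y 0)) = u (cinv c0 (?y 0))" by (rule p0)
  qed
  then show ?thesis by (intro vector_derivative_within) simp_all
qed

text \<open>The normal component of \<open>V\<close> is its pairing with \<open>unit_normal\<close>;
  lowering the index of that vector leaves the \<open>k\<close>-th coordinate divided by the root of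
  \<open>inv_nn\<close>.\<close>

lemma normal_velocity_aux:
  assumes V: "((\<lambda>\<epsilon>. cmap c (f \<epsilon> p)) has_vector_derivative V) (at 0)" and f0: "f 0 p = p"
    and ev: "\<forall>\<^sub>F \<epsilon> in at 0. f \<epsilon> p \<in> cdom c"
  shows "vector_derivative (\<lambda>\<epsilon>. cmap c0 (f \<epsilon> p)) (at 0) \<bullet> (g c0 (cmap c0 p) *v outward_normal g c0 \<Omega> p) =
    V $ k / sqrt (inv_nn c k (cmap c p))"
proof -
  let ?J = "jacobian c c0 (cmap c p)"
  have T: "(transition c c0 has_derivative (*v) ?J) (at (cmap c (f 0 p)))"
    using transition_has_derivative[OF pt_facts(1) c0 pt_facts(2)] f0 by simp
  have "((\<lambda>\<epsilon>. transition c c0 (cmap c (f \<epsilon> p))) has_derivative (\<lambda>t. ?J *v (t *\<^sub>R V))) (at 0)"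
    using has_derivative_compose[of "\<lambda>\<epsilon>. cmap c (f \<epsilon> p)" "\<lambda>t. t *\<^sub>R V" 0 UNIV, OF _ T] V
    unfolding has_vector_derivative_def by simp
  then have "((\<lambda>\<epsilon>. transition c c0 (cmap c (f \<epsilon> p))) has_vector_derivative (?J *v V)) (at 0)"
    by (simp add: has_vector_derivative_def matrix_vector_mult_scaleR)
  moreover have "\<forall>\<^sub>F \<epsilon> in at 0. transition c c0 (cmap c (f \<epsilon> p)) = cmap c0 (f \<epsilon> p)"
    using ev by eventually_elim (simp add: transition_def cinv_cmap[OF pt_facts(1)])
  moreover have "transition c c0 (cmap c (f 0 p)) = cmap c0 (f 0 p)" by (simp add: f0 pt_facts(5))
  ultimately have "((\<lambda>\<epsilon>. cmap c0 (f \<epsilon> p)) has_vector_derivative (?J *v V)) (at 0)"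
    unfolding has_vector_derivative_def by (rule has_derivative_transform_at_within)
  then have "vector_derivative (\<lambda>\<epsilon>. cmap c0 (f \<epsilon> p)) (at 0) = ?J *v V" by (rule vector_derivative_at)
  then show ?thesis
    using metric_at_pt[of V "unit_normal c k (cmap c p)"] metric_unit_normal[OF pt_facts(1,4), of V k]
    by (simp add: outward_normal_boundary_chart)
qed

end

lemma normal_derivative_boundary_chart:
  assumes bc: "boundary_chart A \<Omega> c k" and p: "p \<in> cdom c" "p \<in> frontier \<Omega>"
    and W: "open W" "cmap c p \<in> W" and F: "Ck_on 1 W F"
    and ext: "\<And>x. x \<in> W \<Longrightarrow> x \<in> crange c \<Longrightarrow> cinv c x \<in> closure \<Omega> \<Longrightarrow> F x = u (cinv c x)"
  shows "normal_derivative A g \<Omega> u p = frechet_derivative F (at (cmap c p)) (unit_normal c k (cmap c p))"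
  unfolding normal_derivative_def Let_def
  by (rule normal_derivative_aux[OF bc chart_at_mem(1) p(1) chart_at_mem(2) p(2) W F ext])

lemma normal_velocity_boundary_chart:
  assumes bc: "boundary_chart A \<Omega> c k" and p: "p \<in> cdom c" "p \<in> frontier \<Omega>"
    and V: "((\<lambda>\<epsilon>. cmap c (f \<epsilon> p)) has_vector_derivative V) (at 0)" and f0: "f 0 p = p"
    and ev: "\<forall>\<^sub>F \<epsilon> in at 0. f \<epsilon> p \<in> cdom c"
  shows "normal_velocity A g \<Omega> f p = V $ k / sqrt (inv_nn c k (cmap c p))"
  unfolding normal_velocity_def Let_def
  by (rule normal_velocity_aux[where f = f, OF bc chart_at_mem(1) p(1) chart_at_mem(2) p(2) V f0 ev])

end

section \<open>Green's formula in charts\<close>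

lemma frechet_derivative_cong_open:
  assumes "open N" "x \<in> N" "\<And>y. y \<in> N \<Longrightarrow> f y = h y"
  shows "frechet_derivative f (at x) = frechet_derivative h (at x)"
proof -
  have "(f has_derivative D) (at x) \<longleftrightarrow> (h has_derivative D) (at x)" for D
    using has_derivative_transform_within_open[of f D x UNIV N h] has_derivative_transform_within_open[of h D x UNIV N f] assms
    by auto
  then show ?thesis unfolding frechet_derivative_def by simp
qed

lemma partial_cong:
  assumes "open N" "x \<in> N" "\<And>y. y \<in> N \<Longrightarrow> f y = h y" shows "partial i f x = partial i h x"
  unfolding partial_def by (simp only: frechet_derivative_cong_open[OF assms])

lemma partial_eq: "(f has_derivative D) (at x) \<Longrightarrow> partial i f x = D (axis i 1)"
  unfolding partial_def by (drule frechet_derivative_at) simp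

lemma Ck_on_partial: "Ck_on (Suc k) W F \<Longrightarrow> Ck_on k W (partial i F)"
  unfolding partial_def[abs_def] by (rule Ck_on_frechet)

lemma has_derivative_partial:
  fixes f :: "real^'n \<Rightarrow> real"
  assumes "f differentiable (at x)" shows "(f has_derivative (\<lambda>v. \<Sum>i\<in>UNIV. v $ i * partial i f x)) (at x)"
proof -
  have d: "(f has_derivative frechet_derivative f (at x)) (at x)" using assms frechet_derivative_works by blast
  have "frechet_derivative f (at x) v = (\<Sum>i\<in>UNIV. v $ i * partial i f x)" for v
  proof -
    have l: "linear (frechet_derivative f (at x))" by (rule has_derivative_linear[OF d])
    have "frechet_derivative f (at x) v = frechet_derivative f (at x) (\<Sum>i\<in>UNIV. v $ i *\<^sub>R axis i 1)"
      using basis_expansion[of v] by (simp add: scalar_mult_eq_scaleR)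
    also have "\<dots> = (\<Sum>i\<in>UNIV. v $ i * partial i f x)"
      by (simp add: linear_sum[OF l] linear_scale[OF l] partial_def)
    finally show ?thesis .
  qed
  then have "frechet_derivative f (at x) = (\<lambda>v. \<Sum>i\<in>UNIV. v $ i * partial i f x)" by (rule ext)
  then show ?thesis using d by simp
qed

lemma partial_mult:
  fixes f h :: "real^'n \<Rightarrow> real"
  assumes "f differentiable (at x)" "h differentiable (at x)"
  shows "partial i (\<lambda>y. f y * h y) x = partial i f x * h x + f x * partial i h x"
  using partial_eq[OF has_derivative_mult[OF assms[unfolded frechet_derivative_works]]]
  by (simp add: partial_def)

lemma partial_diff:
  fixes f h :: "real^'n \<Rightarrow> real"
  assumes "f differentiable (at x)" "h differentiable (at x)"
  shows "partial i (\<lambda>y. f y - h y) x = partial i f x - partial i h x"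
  using partial_eq[OF has_derivative_diff[OF assms[unfolded frechet_derivative_works]]]
  by (simp add: partial_def)

context
  fixes W K :: "(real^'n) set" and Y :: "'n \<Rightarrow> real^'n \<Rightarrow> real"
  assumes W: "open W" and K: "compact K" "K \<subseteq> W"
    and Y: "\<And>j. Ck_on 1 W (Y j)" and Y0: "\<And>j x. x \<in> W \<Longrightarrow> x \<notin> K \<Longrightarrow> Y j x = 0"
begin

lemma zero_extension:
  obtains R where "0 \<le> R" "\<And>j. Ck_on 1 UNIV (\<lambda>x. if x \<in> W then Y j x else 0)"
    "\<And>j x. R < norm x \<Longrightarrow> (if x \<in> W then Y j x else 0) = 0"
    "\<And>j i x. partial i (\<lambda>x. if x \<in> W then Y j x else 0) x = indicator W x * partial i (Y j) x"
proof -
  obtain R where R: "0 < R" "\<And>x. x \<in> K \<Longrightarrow> norm x \<le> R"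
    using bounded_pos[THEN iffD1, OF compact_imp_bounded[OF K(1)]] by blast
  have oK: "open (- K)" using K(1) by (simp add: compact_imp_closed open_Compl)
  let ?h = "\<lambda>j x. if x \<in> W then Y j x else 0"
  have h0: "?h j x = 0" if "x \<in> - K" for j x using Y0 that by auto
  have "Ck_on 1 UNIV (?h j)" for j
  proof (rule Ck_on_local)
    fix x
    show "\<exists>U. open U \<and> x \<in> U \<and> Ck_on 1 U (?h j)"
    proof (cases "x \<in> W")
      case True
      have "Ck_on 1 W (?h j)" by (rule Ck_on_cong[OF W _ Y]) simp
      then show ?thesis using True W by blast
    next
      case False
      have "Ck_on 1 (- K) (?h j)" by (rule Ck_on_cong[OF oK _ Ck_on_const[of 1 "- K" 0]]) (use h0 in simp)
      then show ?thesis using False K oK by blast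
    qed
  qed
  moreover have "partial i (?h j) x = indicator W x * partial i (Y j) x" for i j x
  proof (cases "x \<in> W")
    case True
    then show ?thesis using partial_cong[OF W True, of "?h j" "Y j"] by simp
  next
    case False
    then have "x \<in> - K" using K by blast
    from partial_cong[OF oK this, of "?h j" "\<lambda>_. 0"] h0 have "partial i (?h j) x = partial i (\<lambda>_. 0) x" by blast
    then show ?thesis using False by (simp add: partial_def)
  qed
  ultimately show ?thesis using that[of R] R h0 by (meson ComplI less_imp_le not_less)
qed

text \<open>Only the component normal to the hyperplane leaves a boundary term; the tangential
  partials integrate to 0 over the half space.\<close>

lemma half_space_divergence:
  "(LINT x|lborel. indicator {x. x $ k < 0} x * (indicator W x * (\<Sum>j\<in>UNIV. partial j (Y j) x))) =
   (LINT x|lborel. indicator {x. 0 < x $ k \<and> x $ k < 1} x * (indicator W (hyper_proj k x) * Y k (hyper_proj k x)))"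
  and divergence_compact_support: "(LINT x|lborel. indicator W x * (\<Sum>j\<in>UNIV. partial j (Y j) x)) = 0"
proof -
  obtain R where R: "0 \<le> R" "\<And>j. Ck_on 1 UNIV (\<lambda>x. if x \<in> W then Y j x else 0)"
    "\<And>j x. R < norm x \<Longrightarrow> (if x \<in> W then Y j x else 0) = 0"
    "\<And>j i x. partial i (\<lambda>x. if x \<in> W then Y j x else 0) x = indicator W x * partial i (Y j) x"
    using zero_extension by blast
  let ?h = "\<lambda>j x. if x \<in> W then Y j x else 0"
  let ?D = "\<lambda>j x. frechet_derivative (?h j) (at x)"
  have der: "(?h j has_derivative ?D j x) (at x)" for j x
    by (rule Ck_on_has_derivative[OF R(2)]) simp_all
  have D: "?D j x (axis j 1) = indicator W x * partial j (Y j) x" for j x using R(4)[of j j x] by (simp only: partial_def)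
  have "Ck_on 0 UNIV (\<lambda>x. ?D j x (axis j 1))" for j
    by (rule Ck_on_frechet) (use R(2) in simp)
  then have cont: "continuous_on UNIV (\<lambda>x. ?D j x (axis j 1))" for j by simp
  have int: "integrable lborel (\<lambda>x. indicator S x * (indicator W x * partial j (Y j) x))" if "S \<in> sets borel" for S j
    using integrable_partial[OF der cont R(3) R(1) that] unfolding D .
  have sum: "(LINT x|lborel. indicator S x * (indicator W x * (\<Sum>j\<in>UNIV. partial j (Y j) x))) =
      (\<Sum>j\<in>UNIV. LINT x|lborel. indicator S x * (indicator W x * partial j (Y j) x))" if "S \<in> sets borel" for S
    unfolding sum_distrib_left by (rule Bochner_Integration.integral_sum) (rule int[OF that])
  have b: "{x :: real^'n. x $ k < 0} \<in> sets borel" by measurable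
  have "(LINT x|lborel. indicator {x. x $ k < 0} x * (indicator W x * partial j (Y j) x)) =
     (if j = k then (LINT x|lborel. indicator {x. 0 < x $ k \<and> x $ k < 1} x * ?h k (hyper_proj k x)) else 0)" for j
    using half_space_partial_tangential[OF der cont R(3) R(1), of j k] half_space_partial_normal[OF der cont R(3) R(1), of k]
    unfolding D by simp
  then have "(LINT x|lborel. indicator {x. x $ k < 0} x * (indicator W x * (\<Sum>j\<in>UNIV. partial j (Y j) x))) =
     (LINT x|lborel. indicator {x. 0 < x $ k \<and> x $ k < 1} x * ?h k (hyper_proj k x))"
    unfolding sum[OF b] by simp
  also have "\<dots> = (LINT x|lborel. indicator {x. 0 < x $ k \<and> x $ k < 1} x * (indicator W (hyper_proj k x) * Y k (hyper_proj k x)))"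
    by (rule Bochner_Integration.integral_cong) (auto simp: indicator_def)
  finally show "(LINT x|lborel. indicator {x. x $ k < 0} x * (indicator W x * (\<Sum>j\<in>UNIV. partial j (Y j) x))) =
   (LINT x|lborel. indicator {x. 0 < x $ k \<and> x $ k < 1} x * (indicator W (hyper_proj k x) * Y k (hyper_proj k x)))" .
  have "(LINT x|lborel. indicator UNIV x * (indicator W x * partial j (Y j) x)) = 0" for j
    using integral_partial_zero[OF der cont R(3) R(1), of j] unfolding D by simp
  then show "(LINT x|lborel. indicator W x * (\<Sum>j\<in>UNIV. partial j (Y j) x)) = 0"
    using sum[of UNIV] by simp
qed

end

lemma half_space_boundary_integrable:
  fixes W K :: "(real^'n) set" and Y :: "'n \<Rightarrow> real^'n \<Rightarrow> real"
  assumes W: "open W" and K: "compact K" "K \<subseteq> W"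
    and Y: "\<And>j. Ck_on 1 W (Y j)" and Y0: "\<And>j x. x \<in> W \<Longrightarrow> x \<notin> K \<Longrightarrow> Y j x = 0"
  shows "integrable lborel (\<lambda>x. indicator {x. 0 < x $ k \<and> x $ k < 1} x * (indicator W (hyper_proj k x) * Y k (hyper_proj k x)))"
proof (rule zero_extension[of W K Y])
  fix R
  assume R: "0 \<le> R" "\<And>j. Ck_on 1 UNIV (\<lambda>x. if x \<in> W then Y j x else 0)"
    "\<And>j x. R < norm x \<Longrightarrow> (if x \<in> W then Y j x else 0) = 0"
  have "integrable lborel (\<lambda>x. indicator {x. 0 < x $ k \<and> x $ k < 1} x * (if hyper_proj k x \<in> W then Y k (hyper_proj k x) else 0))"
    by (rule integrable_slab[OF Ck_on_continuous[OF R(2)[of k]] R(3)[of _ k]])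
  moreover have "(if z \<in> W then Y k z else 0) = indicator W z * Y k z" for z by (simp add: indicator_def)
  ultimately show ?thesis by (simp only:)
qed (fact W K Y Y0)+

context riemannian_manifold
begin

text \<open>The gradient multiplied by the volume density. Its Euclidean divergence
  \<open>lapd\<close> is \<open>- sqrt (det g)\<close> times the Laplacian, so Green's formula
  becomes a statement about Lebesgue integrals in coordinates, free of quotients by the
  density.\<close>

definition flux :: "('m, 'n) chart \<Rightarrow> (real^'n \<Rightarrow> real) \<Rightarrow> real^'n \<Rightarrow> 'n \<Rightarrow> real" where
  "flux c U x i = sqrt (det (g c x)) * (matrix_inv (g c x) *v (\<chi> j. partial j U x)) $ i"

definition lapd :: "('m, 'n) chart \<Rightarrow> (real^'n \<Rightarrow> real) \<Rightarrow> real^'n \<Rightarrow> real" where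
  "lapd c U x = (\<Sum>i\<in>UNIV. partial i (\<lambda>y. flux c U y i) x)"

lemma laplacian_lapd: "laplacian g c u p = - (lapd c (\<lambda>y. u (cinv c y)) (cmap c p) / sqrt (det (g c (cmap c p))))"
  unfolding laplacian_def divergence_def gradient_def lapd_def flux_def ..

lemma flux_cong:
  assumes "open N" "x \<in> N" "\<And>y. y \<in> N \<Longrightarrow> U y = V y" shows "flux c U x i = flux c V x i"
  unfolding flux_def by (simp only: partial_cong[OF assms])

lemma lapd_cong:
  assumes "open N" "x \<in> N" "\<And>y. y \<in> N \<Longrightarrow> U y = V y" shows "lapd c U x = lapd c V x"
  unfolding lapd_def
proof (rule sum.cong[OF refl])
  fix i
  show "partial i (\<lambda>y. flux c U y i) x = partial i (\<lambda>y. flux c V y i) x"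
    by (rule partial_cong[OF assms(1,2)]) (rule flux_cong[OF assms(1) _ assms(3)])
qed

lemma Ck_on_flux:
  assumes c: "c \<in> A" and W: "open W" "W \<subseteq> crange c" and F: "Ck_on (Suc k) W F"
  shows "Ck_on k W (\<lambda>x. flux c F x i)"
  unfolding flux_def matrix_vector_mult_def
  using Ck_on_subset[OF Ck_on_sqrt_det[OF c, of k] W(2)] Ck_on_subset[OF Ck_on_inverse_metric[OF c, of k] W(2)] Ck_on_partial[OF F]
  by (simp add: Ck_on_mult Ck_on_sum W(1))

lemma Ck_on_lapd:
  assumes c: "c \<in> A" and W: "open W" "W \<subseteq> crange c" and F: "Ck_on (Suc (Suc k)) W F"
  shows "Ck_on k W (lapd c F)"
  unfolding lapd_def[abs_def] by (intro Ck_on_sum W Ck_on_partial Ck_on_flux[OF c W F])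

end

context regular_domain
begin

lemma matrix_inv_metric_inner:
  assumes "c \<in> A" "x \<in> crange c"
  shows "v \<bullet> (matrix_inv (g c x) *v w) = w \<bullet> (matrix_inv (g c x) *v v)"
  using metric_inner_commute[OF assms, of "matrix_inv (g c x) *v v" "matrix_inv (g c x) *v w"]
    metric_inv_mult[OF assms] by (simp add: inner_commute)

lemma sum_partial_flux:
  "(\<Sum>i\<in>UNIV. partial i V x * flux c U x i) =
     sqrt (det (g c x)) * ((\<chi> i. partial i V x) \<bullet> (matrix_inv (g c x) *v (\<chi> i. partial i U x)))"
  by (simp add: flux_def inner_vec_def sum_distrib_left mult_ac)

lemma sum_partial_flux_commute:
  assumes "c \<in> A" "x \<in> crange c"
  shows "(\<Sum>i\<in>UNIV. partial i V x * flux c U x i) = (\<Sum>i\<in>UNIV. partial i U x * flux c V x i)"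
  unfolding sum_partial_flux by (simp only: matrix_inv_metric_inner[OF assms, of "\<chi> i. partial i V x"])

text \<open>Product rule for \<open>\<eta> (V grad U - U grad V)\<close>. The products of the two
  gradients cancel since the inverse metric is symmetric; the terms with derivatives of
  \<open>\<eta>\<close> are kept, because the cut-offs are not constant.\<close>

lemma divergence_green:
  assumes c: "c \<in> A" and W: "open W" "W \<subseteq> crange c" and U: "Ck_on 2 W U" and V: "Ck_on 2 W V"
    and \<eta>: "Ck_on 1 W \<eta>" and x: "x \<in> W"
  shows "(\<Sum>j\<in>UNIV. partial j (\<lambda>y. \<eta> y * (V y * flux c U y j - U y * flux c V y j)) x) =
    (V x * (\<Sum>j\<in>UNIV. partial j \<eta> x * flux c U x j) - U x * (\<Sum>j\<in>UNIV. partial j \<eta> x * flux c V x j))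
    + \<eta> x * (V x * lapd c U x - U x * lapd c V x)"
proof -
  note f = Ck_on_flux[OF c W, of 1]
  have dU: "U differentiable (at x)" and dV: "V differentiable (at x)" and d\<eta>: "\<eta> differentiable (at x)"
    using Ck_on_differentiable[OF U _ x] Ck_on_differentiable[OF V _ x] Ck_on_differentiable[OF \<eta> _ x] by simp_all
  have fU: "(\<lambda>y. flux c U y j) differentiable (at x)" and fV: "(\<lambda>y. flux c V y j) differentiable (at x)" for j
    using Ck_on_differentiable[OF f _ x, of U j] Ck_on_differentiable[OF f _ x, of V j] U V by (simp_all add: numeral_2_eq_2)
  have dp: "(\<lambda>y. V y * flux c U y j) differentiable (at x)" "(\<lambda>y. U y * flux c V y j) differentiable (at x)" for j
    using dU dV fU fV by (intro differentiable_mult; simp)+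
  have "partial j (\<lambda>y. \<eta> y * (V y * flux c U y j - U y * flux c V y j)) x =
      V x * (partial j \<eta> x * flux c U x j) - U x * (partial j \<eta> x * flux c V x j)
      + \<eta> x * (V x * partial j (\<lambda>y. flux c U y j) x - U x * partial j (\<lambda>y. flux c V y j) x)
      + \<eta> x * (partial j V x * flux c U x j - partial j U x * flux c V x j)" for j
  proof -
    have "(\<lambda>y. V y * flux c U y j - U y * flux c V y j) differentiable (at x)" using dp by (intro differentiable_diff)
    from partial_mult[OF d\<eta> this, of j] show ?thesis
      unfolding partial_diff[OF dp] partial_mult[OF dV fU] partial_mult[OF dU fV] by (simp add: algebra_simps)
  qed
  then have "(\<Sum>j\<in>UNIV. partial j (\<lambda>y. \<eta> y * (V y * flux c U y j - U y * flux c V y j)) x) =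
     (V x * (\<Sum>j\<in>UNIV. partial j \<eta> x * flux c U x j) - U x * (\<Sum>j\<in>UNIV. partial j \<eta> x * flux c V x j))
      + \<eta> x * (V x * lapd c U x - U x * lapd c V x)
      + \<eta> x * ((\<Sum>j\<in>UNIV. partial j V x * flux c U x j) - (\<Sum>j\<in>UNIV. partial j U x * flux c V x j))"
    unfolding lapd_def by (simp add: sum.distrib sum_subtractf sum_distrib_left right_diff_distrib)
  then show ?thesis
    using sum_partial_flux_commute[OF c, of x V U] W x by auto
qed

text \<open>The function \<open>g(\<nabla>u, \<nabla>w)\<close>.\<close>

definition dinner :: "('m \<Rightarrow> real) \<Rightarrow> ('m \<Rightarrow> real) \<Rightarrow> 'm \<Rightarrow> real" where
  "dinner u w p = (let c = chart_at A p; x = cmap c p in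
     (\<chi> i. partial i (\<lambda>y. w (cinv c y)) x) \<bullet> (matrix_inv (g c x) *v (\<chi> i. partial i (\<lambda>y. u (cinv c y)) x)))"

lemma partial_transition:
  assumes c: "c \<in> A" "c' \<in> A" and x: "x \<in> overlap c c'"
    and u: "(\<lambda>y. u (cinv c' y)) differentiable (at (transition c c' x))"
  shows "(\<chi> i. partial i (\<lambda>y. u (cinv c y)) x) =
    transpose (jacobian c c' x) *v (\<chi> i. partial i (\<lambda>y. u (cinv c' y)) (transition c c' x))"
proof -
  let ?a = "\<chi> i. partial i (\<lambda>y. u (cinv c' y)) (transition c c' x)"
  have "((\<lambda>y. u (cinv c' (transition c c' y))) has_derivative (\<lambda>v. \<Sum>i\<in>UNIV. (jacobian c c' x *v v) $ i * partial i (\<lambda>y. u (cinv c' y)) (transition c c' x))) (at x)"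
    by (rule has_derivative_compose[OF transition_has_derivative[OF c x] has_derivative_partial[OF u]])
  then have "((\<lambda>y. u (cinv c y)) has_derivative (\<lambda>v. \<Sum>i\<in>UNIV. (jacobian c c' x *v v) $ i * partial i (\<lambda>y. u (cinv c' y)) (transition c c' x))) (at x)"
    by (rule has_derivative_transform_within_open[OF _ open_overlap[OF c] x]) (simp add: transition_overlap(3)[OF c])
  then have d: "((\<lambda>y. u (cinv c y)) has_derivative (\<lambda>v. (jacobian c c' x *v v) \<bullet> ?a)) (at x)"
    by (simp add: inner_vec_def)
  have "partial i (\<lambda>y. u (cinv c y)) x = (transpose (jacobian c c' x) *v ?a) $ i" for i
    unfolding partial_eq[OF d] inner_transpose_mult[symmetric] by (simp add: inner_axis' del: transpose_matrix_vector)
  then show ?thesis by (simp add: vec_eq_iff del: transpose_matrix_vector)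
qed

text \<open>Differentials transform with the transposed Jacobian, gradients with the Jacobian, so
  their pairing is independent of the chart. \<open>dinner\<close> uses the arbitrary
  \<open>chart_at\<close>; this links it to the chart in which integration takes place.\<close>

lemma dinner_chart:
  assumes c: "c \<in> A" and p: "p \<in> cdom c"
    and u: "(\<lambda>y. u (cinv c y)) differentiable (at (cmap c p))"
    and w: "(\<lambda>y. w (cinv c y)) differentiable (at (cmap c p))"
  shows "sqrt (det (g c (cmap c p))) * dinner u w p =
    (\<Sum>i\<in>UNIV. partial i (\<lambda>y. w (cinv c y)) (cmap c p) * flux c (\<lambda>y. u (cinv c y)) (cmap c p) i)"
proof -
  define c0 where "c0 = chart_at A p"
  have c0: "c0 \<in> A" "p \<in> cdom c0" unfolding c0_def by (rule chart_at_mem)+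
  let ?x = "cmap c p" and ?z = "cmap c0 p"
  have x: "?z \<in> overlap c0 c" "transition c0 c ?z = ?x" "?z \<in> crange c0" "?x \<in> crange c" using p c0 cinv_cmap[OF c0] by (auto simp: transition_def)
  let ?J = "jacobian c0 c ?z"
  let ?a = "\<chi> i. partial i (\<lambda>y. u (cinv c y)) ?x" and ?b = "\<chi> i. partial i (\<lambda>y. w (cinv c y)) ?x"
  have G: "g c0 ?z = transpose ?J ** g c ?x ** ?J" using metric_transform[OF c0(1) c x(1)] x(2) by simp
  have au: "(\<chi> i. partial i (\<lambda>y. u (cinv c0 y)) ?z) = transpose ?J *v ?a"
    and bw: "(\<chi> i. partial i (\<lambda>y. w (cinv c0 y)) ?z) = transpose ?J *v ?b"
    using partial_transition[OF c0(1) c x(1), of u] partial_transition[OF c0(1) c x(1), of w] u w unfolding x(2) by blast+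
  define n where "n = matrix_inv (g c0 ?z) *v (transpose ?J *v ?a)"
  have "g c0 ?z *v n = transpose ?J *v ?a" unfolding n_def by (rule metric_inv_mult(1)[OF c0(1) x(3)])
  then have "transpose ?J *v (g c ?x *v (?J *v n)) = transpose ?J *v ?a"
    unfolding G matrix_vector_mul_assoc[symmetric] .
  moreover have dJ: "det (transpose ?J) \<noteq> 0" using det_jacobian[OF c0(1) c x(1)] by (simp add: det_transpose)
  have "matrix_inv (transpose ?J) *v (transpose ?J *v v) = v" for v
    using matrix_inv_mult(2)[OF dJ] by (simp only: matrix_vector_mul_assoc matrix_vector_mul_lid)
  ultimately have "g c ?x *v (?J *v n) = ?a" by metis
  then have Jn: "?J *v n = matrix_inv (g c ?x) *v ?a" using metric_inv_mult(2)[OF c x(4)] by metis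
  have "dinner u w p = (transpose ?J *v ?b) \<bullet> n"
    unfolding dinner_def Let_def c0_def[symmetric] au bw n_def ..
  also have "\<dots> = ?b \<bullet> (?J *v n)" by (metis inner_transpose_mult inner_commute)
  finally show ?thesis unfolding sum_partial_flux Jn by simp
qed

end

section \<open>Variation of the eigenfunctions\<close>

lemma slice_has_vector_derivative:
  fixes F :: "real \<times> 'a::euclidean_space \<Rightarrow> 'b::euclidean_space"
  assumes F: "Ck_on 1 W F" and W: "(s, x) \<in> W"
  shows "((\<lambda>t. F (t, x)) has_vector_derivative frechet_derivative F (at (s, x)) (1, 0)) (at s)"
proof -
  have dF: "(F has_derivative frechet_derivative F (at (s, x))) (at (s, x))"
    by (rule Ck_on_has_derivative[OF F _ W]) simp
  have d1: "((\<lambda>t. F (t, x)) has_derivative (\<lambda>t. frechet_derivative F (at (s, x)) (t, 0))) (at s)"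
    by (rule has_derivative_compose[of "\<lambda>t. (t, x)" "\<lambda>t. (t, 0)" s UNIV F, OF _ dF])
      (intro has_derivative_Pair has_derivative_ident has_derivative_const)
  have "frechet_derivative F (at (s, x)) (t, 0) = t *\<^sub>R frechet_derivative F (at (s, x)) (1, 0)" for t
  proof -
    have "frechet_derivative F (at (s, x)) (t *\<^sub>R (1, 0)) = t *\<^sub>R frechet_derivative F (at (s, x)) (1, 0)"
      by (rule linear_scale[OF has_derivative_linear[OF dF]])
    then show ?thesis by simp
  qed
  then have E: "(\<lambda>t. frechet_derivative F (at (s, x)) (t, 0)) = (\<lambda>t. t *\<^sub>R frechet_derivative F (at (s, x)) (1, 0))"
    by (rule ext)
  show ?thesis unfolding has_vector_derivative_def by (rule has_derivative_eq_rhs[OF d1 E])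
qed

lemma first_order_estimate:
  fixes \<gamma> :: "real \<Rightarrow> 'b::real_normed_vector"
  assumes d: "\<And>t. \<bar>t\<bar> \<le> \<bar>h\<bar> \<Longrightarrow> (\<gamma> has_vector_derivative \<gamma>' t) (at t)"
    and B: "\<And>t. \<bar>t\<bar> \<le> \<bar>h\<bar> \<Longrightarrow> norm (\<gamma>' t - a) \<le> B"
  shows "norm (\<gamma> h - \<gamma> 0 - h *\<^sub>R a) \<le> B * \<bar>h\<bar>"
proof -
  have "norm ((\<gamma> h - h *\<^sub>R a) - (\<gamma> 0 - 0 *\<^sub>R a)) \<le> B * norm (h - 0)"
  proof (rule differentiable_bound[of "cball 0 \<bar>h\<bar>"])
    fix t :: real assume "t \<in> cball 0 \<bar>h\<bar>"
    then have t: "\<bar>t\<bar> \<le> \<bar>h\<bar>" by simp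
    show "((\<lambda>t. \<gamma> t - t *\<^sub>R a) has_derivative (\<lambda>s. s *\<^sub>R \<gamma>' t - s *\<^sub>R a)) (at t within cball 0 \<bar>h\<bar>)"
      using d[OF t] unfolding has_vector_derivative_def
      by (intro has_derivative_diff has_derivative_scaleR_left has_derivative_ident) (rule has_derivative_at_withinI)
    show "onorm (\<lambda>s. s *\<^sub>R \<gamma>' t - s *\<^sub>R a) \<le> B"
    proof (rule onorm_bound)
      show "0 \<le> B" using B[OF t] norm_ge_zero order_trans by blast
      show "norm (s *\<^sub>R \<gamma>' t - s *\<^sub>R a) \<le> B * norm s" for s
        using mult_left_mono[OF B[OF t], of "\<bar>s\<bar>"] by (simp add: scaleR_diff_right[symmetric] mult.commute)
    qed
  qed auto
  then show ?thesis by (simp add: algebra_simps)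
qed

locale eigenvalue_deformation = regular_domain A g \<Omega>
  for A :: "('m::{t2_space,second_countable_topology}, 'n::finite) chart set"
    and g :: "('m, 'n) chart \<Rightarrow> real^'n \<Rightarrow> real^'n^'n" and \<Omega> :: "'m set" +
  fixes I :: "real set" and f :: "real \<Rightarrow> 'm \<Rightarrow> 'm" and \<phi> :: "real \<Rightarrow> 'm \<Rightarrow> real" and \<Lambda> :: "real \<Rightarrow> real"
  assumes open_I: "open I" and zero_I: "0 \<in> I"
    and deformation: "deformation A I \<Omega> f"
    and smooth_\<phi>: "\<And>\<epsilon>. \<epsilon> \<in> I \<Longrightarrow> smooth_fun_on A (closure (f \<epsilon> ` \<Omega>)) (\<phi> \<epsilon>)"
    and curve: "differentiable_curve A I \<Omega> (\<lambda>\<epsilon>. \<phi> \<epsilon> \<circ> f \<epsilon>)"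
    and \<Lambda>_differentiable: "\<Lambda> differentiable (at 0)"
    and eigen: "\<And>\<epsilon> p c. \<epsilon> \<in> I \<Longrightarrow> p \<in> f \<epsilon> ` \<Omega> \<Longrightarrow> c \<in> A \<Longrightarrow> p \<in> cdom c \<Longrightarrow>
           laplacian g c (\<phi> \<epsilon>) p = \<Lambda> \<epsilon> * \<phi> \<epsilon> p"
    and dirichlet: "\<And>\<epsilon> p. \<epsilon> \<in> I \<Longrightarrow> p \<in> frontier (f \<epsilon> ` \<Omega>) \<Longrightarrow> \<phi> \<epsilon> p = 0"
begin

lemma f_zero: "p \<in> closure \<Omega> \<Longrightarrow> f 0 p = p"
  and family: "smooth_family_on A I (closure \<Omega>) f"
  and f_frontier: "\<epsilon> \<in> I \<Longrightarrow> f \<epsilon> ` frontier \<Omega> = frontier (f \<epsilon> ` \<Omega>)"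
  using deformation unfolding deformation_def by blast+

lemma f_zero_image: "f 0 ` \<Omega> = \<Omega>"
proof -
  have "f 0 ` \<Omega> = (\<lambda>p. p) ` \<Omega>" by (rule image_cong) (use f_zero closure_subset in auto)
  then show ?thesis by simp
qed

lemma smooth_\<phi>0: "smooth_fun_on A (closure \<Omega>) (\<phi> 0)"
  using smooth_\<phi>[OF zero_I] unfolding f_zero_image .

lemma curve_derivative_ex:
  "\<exists>G. smooth_fun_on A (closure \<Omega>) G \<and> (\<forall>c\<in>A. \<forall>K. compact K \<and> K \<subseteq> crange c \<longrightarrow>
     uniform_limit (K \<inter> cmap c ` (cdom c \<inter> \<Omega>))
       (\<lambda>h x. (\<phi> h (f h (cinv c x)) - \<phi> 0 (f 0 (cinv c x))) / h - G (cinv c x)) (\<lambda>_. 0) (at 0))"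
proof -
  from curve zero_I obtain G where G: "smooth_fun_on A (closure \<Omega>) G"
    "\<forall>c\<in>A. \<forall>K vs. compact K \<and> K \<subseteq> crange c \<longrightarrow>
       uniform_limit (K \<inter> cmap c ` (cdom c \<inter> \<Omega>))
         (\<lambda>h. dirs_deriv vs (\<lambda>x. ((\<phi> (0 + h) \<circ> f (0 + h)) (cinv c x) - (\<phi> 0 \<circ> f 0) (cinv c x)) / h - G (cinv c x)))
         (\<lambda>_. 0) (at 0)"
    unfolding differentiable_curve_def by blast
  have "uniform_limit (K \<inter> cmap c ` (cdom c \<inter> \<Omega>))
       (\<lambda>h x. (\<phi> h (f h (cinv c x)) - \<phi> 0 (f 0 (cinv c x))) / h - G (cinv c x)) (\<lambda>_. 0) (at 0)"
    if "c \<in> A" "compact K" "K \<subseteq> crange c" for c K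
    using G(2)[rule_format, OF that(1), of K "[]"] that(2,3) by simp
  then show ?thesis using G(1) by blast
qed

definition curve_derivative :: "'m \<Rightarrow> real" where
  "curve_derivative = (SOME G. smooth_fun_on A (closure \<Omega>) G \<and> (\<forall>c\<in>A. \<forall>K. compact K \<and> K \<subseteq> crange c \<longrightarrow>
     uniform_limit (K \<inter> cmap c ` (cdom c \<inter> \<Omega>))
       (\<lambda>h x. (\<phi> h (f h (cinv c x)) - \<phi> 0 (f 0 (cinv c x))) / h - G (cinv c x)) (\<lambda>_. 0) (at 0)))"

lemma smooth_curve_derivative: "smooth_fun_on A (closure \<Omega>) curve_derivative"
  and curve_derivative_limit: "c \<in> A \<Longrightarrow> compact K \<Longrightarrow> K \<subseteq> crange c \<Longrightarrow>
     uniform_limit (K \<inter> cmap c ` (cdom c \<inter> \<Omega>))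
       (\<lambda>h x. (\<phi> h (f h (cinv c x)) - \<phi> 0 (f 0 (cinv c x))) / h - curve_derivative (cinv c x)) (\<lambda>_. 0) (at 0)"
  using someI_ex[OF curve_derivative_ex] unfolding curve_derivative_def[symmetric] by blast+

lemma pulled_back_frontier: "h \<in> I \<Longrightarrow> p \<in> frontier \<Omega> \<Longrightarrow> \<phi> h (f h p) = 0"
  using dirichlet[of h "f h p"] f_frontier[of h] by blast

lemma smooth_pulled_back: "h \<in> I \<Longrightarrow> smooth_fun_on A (closure \<Omega>) (\<lambda>p. \<phi> h (f h p))"
  using curve unfolding differentiable_curve_def o_def by blast

lemma eventually_in_I: "\<forall>\<^sub>F h in at 0. h \<in> I"
  using open_I zero_I by (simp add: eventually_at_in_open')

text \<open>All composites vanish on the frontier, but the uniform convergence is stated on \<Omega>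
  only. The estimate is therefore taken at interior points for one fixed \<open>h\<close> and passed
  to the boundary point by continuity of the three functions involved.\<close>

lemma curve_derivative_frontier:
  assumes p: "p \<in> frontier \<Omega>" shows "curve_derivative p = 0"
proof (rule ccontr)
  assume ne: "curve_derivative p \<noteq> 0"
  \<comment> \<open>Half the supposed nonzero value: at the frontier the quotient is 0, so the
    limiting estimate reads \<open>\<bar>curve_derivative p\<bar> \<le> \<eta>\<close>, which is
    then impossible.\<close>
  define \<eta> where "\<eta> = \<bar>curve_derivative p\<bar> / 2"
  have \<eta>: "\<eta> > 0" using ne by (simp add: \<eta>_def)
  obtain c k where bc: "boundary_chart A \<Omega> c k" and pc: "p \<in> cdom c" using ex_boundary_chart[OF p] by blast
  note c = boundary_chart_A[OF bc]
  let ?x = "cmap c p"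
  have xk: "?x $ k = 0" using boundary_chart_frontier[OF bc pc] p by blast
  have pcl: "p \<in> closure \<Omega>" using p by (simp add: closure_eq)
  have xr: "?x \<in> crange c" using pc by blast
  obtain e where e: "e > 0" "cball ?x e \<subseteq> crange c" using open_crange[OF c] xr open_contains_cball by blast
  from curve_derivative_limit[OF c compact_cball e(2)]
  have "\<forall>\<^sub>F h in at 0. \<forall>x\<in>cball ?x e \<inter> cmap c ` (cdom c \<inter> \<Omega>).
     dist ((\<phi> h (f h (cinv c x)) - \<phi> 0 (f 0 (cinv c x))) / h - curve_derivative (cinv c x)) 0 < \<eta>"
    using \<eta> by (rule uniform_limitD)
  with eventually_in_I have "\<forall>\<^sub>F h in at 0. h \<in> I \<and> (\<forall>x\<in>cball ?x e \<inter> cmap c ` (cdom c \<inter> \<Omega>).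
     dist ((\<phi> h (f h (cinv c x)) - \<phi> 0 (f 0 (cinv c x))) / h - curve_derivative (cinv c x)) 0 < \<eta>)"
    by (rule eventually_conj)
  then obtain h where h': "h \<in> I \<and> (\<forall>x\<in>cball ?x e \<inter> cmap c ` (cdom c \<inter> \<Omega>).
     dist ((\<phi> h (f h (cinv c x)) - \<phi> 0 (f 0 (cinv c x))) / h - curve_derivative (cinv c x)) 0 < \<eta>)"
    using eventually_happens'[OF at_neq_bot[of "0::real"]] by blast
  have h: "h \<in> I" "\<And>x. x \<in> cball ?x e \<Longrightarrow> x \<in> cmap c ` (cdom c \<inter> \<Omega>) \<Longrightarrow>
     \<bar>(\<phi> h (f h (cinv c x)) - \<phi> 0 (f 0 (cinv c x))) / h - curve_derivative (cinv c x)\<bar> < \<eta>"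
    using h' unfolding dist_real_def diff_0_right by blast+
  obtain W1 F1 where W1: "open W1" "?x \<in> W1" "W1 \<subseteq> crange c" "\<And>j. Ck_on j W1 F1"
    "\<And>x. x \<in> W1 \<Longrightarrow> cinv c x \<in> closure \<Omega> \<Longrightarrow> F1 x = \<phi> h (f h (cinv c x))"
    using local_extension[OF smooth_pulled_back[OF h(1)] pcl pc c] by blast
  obtain W2 F2 where W2: "open W2" "?x \<in> W2" "W2 \<subseteq> crange c" "\<And>j. Ck_on j W2 F2"
    "\<And>x. x \<in> W2 \<Longrightarrow> cinv c x \<in> closure \<Omega> \<Longrightarrow> F2 x = \<phi> 0 (f 0 (cinv c x))"
    using local_extension[OF smooth_pulled_back[OF zero_I] pcl pc c] by blast
  obtain W3 F3 where W3: "open W3" "?x \<in> W3" "W3 \<subseteq> crange c" "\<And>j. Ck_on j W3 F3"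
    "\<And>x. x \<in> W3 \<Longrightarrow> cinv c x \<in> closure \<Omega> \<Longrightarrow> F3 x = curve_derivative (cinv c x)"
    using local_extension[OF smooth_curve_derivative pcl pc c] by blast
  \<comment> \<open>The approach is along the inner coordinate normal, so that \<open>y t\<close>
    represents a point of \<Omega> for small positive \<open>t\<close>.\<close>
  define y where "y = (\<lambda>t::real. ?x - t *\<^sub>R axis k 1)"
  have ylim: "(y \<longlongrightarrow> ?x) (at_right 0)" unfolding y_def by (rule tendsto_eq_intros refl | simp)+
  have cont: "((\<lambda>t. F (y t)) \<longlongrightarrow> F ?x) (at_right 0)" if "open W" "?x \<in> W" "Ck_on 0 W F" for W and F :: "real^'n \<Rightarrow> real"
    using that ylim by (intro continuous_on_tendsto_compose[of W F]) (auto intro: topological_tendstoD)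
  have lim: "((\<lambda>t. \<bar>(F1 (y t) - F2 (y t)) / h - F3 (y t)\<bar>) \<longlongrightarrow> \<bar>(F1 ?x - F2 ?x) / h - F3 ?x\<bar>) (at_right 0)"
    unfolding divide_inverse by (intro tendsto_intros cont[OF W1(1,2,4)] cont[OF W2(1,2,4)] cont[OF W3(1,2,4)])
  have ins: "\<forall>\<^sub>F t in at_right 0. y t \<in> W1 \<inter> W2 \<inter> W3 \<inter> ball ?x e"
    by (rule topological_tendstoD[OF ylim]) (use W1 W2 W3 e in auto)
  have "\<forall>\<^sub>F t in at_right (0::real). 0 < t" by (simp add: eventually_at_right_less)
  with ins have "\<forall>\<^sub>F t in at_right 0. \<bar>(F1 (y t) - F2 (y t)) / h - F3 (y t)\<bar> \<le> \<eta>"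
  proof eventually_elim
    case (elim t)
    have yk: "y t $ k < 0" using elim(2) xk by (simp add: y_def)
    have yr: "y t \<in> crange c" using elim(1) W1(3) by blast
    have om: "cinv c (y t) \<in> \<Omega>" using boundary_cinv(1)[OF bc yr] yk by simp
    then have cl: "cinv c (y t) \<in> closure \<Omega>" using closure_subset by blast
    have "y t = cmap c (cinv c (y t))" using cmap_cinv[OF yr] by simp
    then have mem: "y t \<in> cmap c ` (cdom c \<inter> \<Omega>)" using om cinv_cdom[OF yr] by blast
    have "y t \<in> cball ?x e" using elim(1) by auto
    from h(2)[OF this mem] show ?case
      using W1(5)[OF _ cl] W2(5)[OF _ cl] W3(5)[OF _ cl] elim(1) by simp
  qed
  then have le: "\<bar>(F1 ?x - F2 ?x) / h - F3 ?x\<bar> \<le> \<eta>"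
    by (intro tendsto_upperbound[OF lim]) auto
  have "F1 ?x = 0" "F2 ?x = 0" "F3 ?x = curve_derivative p"
    using W1(5)[OF W1(2)] W2(5)[OF W2(2)] W3(5)[OF W3(2)] pcl cinv_cmap[OF c pc]
      pulled_back_frontier[OF h(1) p] pulled_back_frontier[OF zero_I p] by simp_all
  then show False using le \<eta> by (simp add: \<eta>_def)
qed

definition velocity :: "('m, 'n) chart \<Rightarrow> 'm \<Rightarrow> real^'n" where
  "velocity c p = vector_derivative (\<lambda>\<epsilon>. cmap c (f \<epsilon> p)) (at 0)"

text \<open>The extension \<open>F\<close> is differentiable near \<open>(0, x)\<close> even if
  \<open>x\<close> represents a boundary point, so the velocity is a partial derivative of
  \<open>F\<close> and inherits its regularity in \<open>x\<close>.\<close>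

lemma family_velocity:
  assumes W: "open W" "(0, x) \<in> W" and F: "Ck_on 1 W F"
    and ext: "\<And>t x. (t, x) \<in> W \<Longrightarrow> t \<in> I \<Longrightarrow> cinv c x \<in> closure \<Omega> \<Longrightarrow>
      f t (cinv c x) \<in> cdom c \<and> F (t, x) = cmap c (f t (cinv c x))"
    and x: "cinv c x \<in> closure \<Omega>"
  shows "((\<lambda>\<epsilon>. cmap c (f \<epsilon> (cinv c x))) has_vector_derivative frechet_derivative F (at (0, x)) (1, 0)) (at 0)"
    and "velocity c (cinv c x) = frechet_derivative F (at (0, x)) (1, 0)"
    and "\<forall>\<^sub>F \<epsilon> in at 0. f \<epsilon> (cinv c x) \<in> cdom c"
proof -
  let ?N = "I \<inter> (\<lambda>t. (t, x)) -` W"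
  have N: "open ?N" "0 \<in> ?N"
    using W open_I zero_I by (auto intro!: open_Int open_vimage continuous_intros)
  have "((\<lambda>t. F (t, x)) has_vector_derivative frechet_derivative F (at (0, x)) (1, 0)) (at 0)"
    by (rule slice_has_vector_derivative[OF F W(2)])
  then show d: "((\<lambda>\<epsilon>. cmap c (f \<epsilon> (cinv c x))) has_vector_derivative frechet_derivative F (at (0, x)) (1, 0)) (at 0)"
    by (rule has_vector_derivative_transform_within_open[OF _ N]) (use ext x in blast)
  then show "velocity c (cinv c x) = frechet_derivative F (at (0, x)) (1, 0)"
    unfolding velocity_def by (rule vector_derivative_at)
  have "\<forall>\<^sub>F \<epsilon> in at 0. \<epsilon> \<in> ?N" using eventually_at_in_open'[OF N] .
  then show "\<forall>\<^sub>F \<epsilon> in at 0. f \<epsilon> (cinv c x) \<in> cdom c" 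
  proof eventually_elim
    case (elim \<epsilon>)
    then show ?case using ext x by blast
  qed
qed

lemma Ck_on_velocity:
  assumes W: "open W" and F: "Ck_on (Suc k) W F"
  shows "open {x. (0::real, x) \<in> W}" "Ck_on k {x. (0, x) \<in> W} (\<lambda>x. frechet_derivative F (at (0, x)) (1, 0))"
proof -
  have "open ((\<lambda>x. (0::real, x)) -` W)" by (rule open_vimage[OF W]) (intro continuous_intros)
  then show o: "open {x. (0::real, x) \<in> W}" by (simp add: vimage_def)
  have "bounded_linear (\<lambda>x :: 'a. (0::real, x))" by (intro bounded_linear_Pair bounded_linear_zero bounded_linear_ident)
  then show "Ck_on k {x. (0, x) \<in> W} (\<lambda>x. frechet_derivative F (at (0, x)) (1, 0))"
    by (intro Ck_on_compose[OF o W _ Ck_on_frechet[OF F, of "(1, 0)"]] Ck_on_bounded_linear) auto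
qed

section \<open>Variation at interior points\<close>

definition chart_dom :: "('m, 'n) chart \<Rightarrow> (real^'n) set" where
  "chart_dom c = {x \<in> crange c. cinv c x \<in> \<Omega>}"

lemma open_chart_dom: "c \<in> A \<Longrightarrow> open (chart_dom c)"
proof -
  assume c: "c \<in> A"
  have "open (crange c \<inter> cinv c -` \<Omega>)"
    by (rule continuous_open_preimage[OF continuous_on_cinv[OF c] open_crange[OF c] open_\<Omega>])
  then show ?thesis by (simp add: chart_dom_def Int_def vimage_def)
qed

lemma Ck_on_smooth_fun:
  assumes u: "smooth_fun_on A S u" and c: "c \<in> A" and N: "open N" "N \<subseteq> crange c" "\<And>y. y \<in> N \<Longrightarrow> cinv c y \<in> S"
  shows "Ck_on k N (\<lambda>y. u (cinv c y))"
proof (rule Ck_on_local)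
  fix y assume y: "y \<in> N"
  then have yr: "y \<in> crange c" using N(2) by blast
  obtain W F where W: "open W" "cmap c (cinv c y) \<in> W" "\<And>k. Ck_on k W F"
    "\<And>x. x \<in> W \<Longrightarrow> cinv c x \<in> S \<Longrightarrow> F x = u (cinv c x)"
    using local_extension[OF u N(3)[OF y] cinv_cdom[OF yr] c] by metis
  have o: "open (W \<inter> N)" using W(1) N(1) by blast
  have "Ck_on k (W \<inter> N) (\<lambda>y. u (cinv c y))"
    by (rule Ck_on_cong[OF o _ Ck_on_subset[OF W(3)]]) (use W(4) N(3) in auto)
  moreover have "y \<in> W \<inter> N" using W(2) y cmap_cinv[OF yr] by simp
  ultimately show "\<exists>U. open U \<and> y \<in> U \<and> Ck_on k U (\<lambda>y. u (cinv c y))" using o by blast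
qed

lemma chart_domD: "x \<in> chart_dom c \<Longrightarrow> x \<in> crange c" "x \<in> chart_dom c \<Longrightarrow> cinv c x \<in> \<Omega>"
  "x \<in> chart_dom c \<Longrightarrow> cinv c x \<in> closure \<Omega>"
  using closure_subset by (auto simp: chart_dom_def)

lemma chart_dom_image: "c \<in> A \<Longrightarrow> x \<in> chart_dom c \<Longrightarrow> x \<in> cmap c ` (cdom c \<inter> \<Omega>)"
  using chart_domD[of x c] cinv_cdom[of x c] cmap_cinv[of x c] by (metis IntI imageI)

lemma Ck_on_closure_fun: "smooth_fun_on A (closure \<Omega>) u \<Longrightarrow> c \<in> A \<Longrightarrow> Ck_on k (chart_dom c) (\<lambda>y. u (cinv c y))"
  by (rule Ck_on_smooth_fun[OF _ _ open_chart_dom]) (auto intro: chart_domD)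

text \<open>A point \<open>y\<close> near \<open>x0\<close> is written as \<open>f\<^sub>h(x)\<close> with \<open>\<bar>x - y\<bar> = O(h)\<close> by Brouwer's theorem, applied to
  \<open>x \<mapsto> x + y - f\<^sub>h(x)\<close>. The estimate then transfers the derivative of \<open>\<phi>\<^sub>h \<circ> f\<^sub>h\<close> to \<open>\<phi>\<^sub>h\<close>.\<close>

lemma interior_variation:
  assumes c: "c \<in> A" and x0: "x0 \<in> chart_dom c"
  obtains r where "0 < r" "cball x0 r \<subseteq> chart_dom c"
    "\<forall>\<^sub>F h in at 0. h \<in> I \<and> (\<forall>y\<in>cball x0 r. cinv c y \<in> f h ` \<Omega>)"
    "uniform_limit (cball x0 r) (\<lambda>h y. (\<phi> h (cinv c y) - \<phi> 0 (cinv c y)) / h)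
      (\<lambda>y. curve_derivative (cinv c y) - frechet_derivative (\<lambda>y. \<phi> 0 (cinv c y)) (at y) (velocity c (cinv c y))) (at 0)"
    "\<forall>k. Ck_on k (ball x0 r) (\<lambda>y. curve_derivative (cinv c y) - frechet_derivative (\<lambda>y. \<phi> 0 (cinv c y)) (at y) (velocity c (cinv c y)))"
proof -
  let ?p = "cinv c x0" and ?O = "chart_dom c" and ?U = "\<lambda>y. \<phi> 0 (cinv c y)" and ?G = "\<lambda>y. curve_derivative (cinv c y)"
  have x0r: "x0 \<in> crange c" using x0 by (rule chart_domD)
  have p: "?p \<in> closure \<Omega>" "?p \<in> cdom c" "f 0 ?p \<in> cdom c" "cmap c ?p = x0"
    using chart_domD(3)[OF x0] cinv_cdom[OF x0r] f_zero cmap_cinv[OF x0r] by simp_all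
  obtain W F where W: "open W" "(0, x0) \<in> W" and Wc: "\<And>t x. (t, x) \<in> W \<Longrightarrow> x \<in> crange c" and CF: "\<And>k. Ck_on k W F"
    and F: "\<And>t x. (t, x) \<in> W \<Longrightarrow> t \<in> I \<Longrightarrow> cinv c x \<in> closure \<Omega> \<Longrightarrow> f t (cinv c x) \<in> cdom c \<and> F (t, x) = cmap c (f t (cinv c x))"
    using local_family_extension[OF family zero_I p(1,2) c p(3) c] unfolding p(4) by metis
  have oO: "open ?O" by (rule open_chart_dom[OF c])
  have CU: "Ck_on k ?O ?U" for k by (rule Ck_on_closure_fun[OF smooth_\<phi>0 c])
  have CG: "Ck_on k ?O ?G" for k by (rule Ck_on_closure_fun[OF smooth_curve_derivative c])
  \<comment> \<open>Points whose image under \<open>F\<close> again lies in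
    \<open>chart_dom c\<close>, so that \<open>\<phi> 0\<close> may be evaluated there through its
    smooth coordinate expression.\<close>
  define W' where "W' = (W \<inter> F -` ?O) \<inter> (I \<times> ?O)"
  have oW': "open W'" unfolding W'_def
    by (intro open_Int open_Times open_I oO continuous_open_preimage[OF Ck_on_continuous[OF CF[of 0]] W(1) oO])
  have F0: "F (0, x) = x" if "(0, x) \<in> W" "x \<in> ?O" for x
    using F[OF that(1) zero_I chart_domD(3)[OF that(2)]] f_zero[OF chart_domD(3)[OF that(2)]] cmap_cinv[OF chart_domD(1)[OF that(2)]] by simp
  have "(0, x0) \<in> W'" using W(2) F0[OF W(2) x0] x0 zero_I by (simp add: W'_def)
  then obtain S T where ST: "open S" "open T" "(0, x0) \<in> S \<times> T" "S \<times> T \<subseteq> W'"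
    using open_prod_elim[OF oW'] by metis
  then obtain d R where d: "0 < d" "cball 0 d \<subseteq> S" and R: "0 < R" "cball x0 R \<subseteq> T"
    using open_contains_cball by (metis mem_Sigma_iff)
  have box: "(t, x) \<in> W'" if "\<bar>t\<bar> \<le> d" "x \<in> cball x0 R" for t x
    using ST(4) d(2) R(2) that by (auto simp: subset_iff dist_real_def)
  have bW: "(t, x) \<in> W" "F (t, x) \<in> ?O" "t \<in> I" "x \<in> ?O" if "\<bar>t\<bar> \<le> d" "x \<in> cball x0 R" for t x
    using box[OF that] by (auto simp: W'_def)
  have Fc: "f t (cinv c x) \<in> cdom c" "F (t, x) = cmap c (f t (cinv c x))" if "\<bar>t\<bar> \<le> d" "x \<in> cball x0 R" for t x
    using F[OF bW(1,3)[OF that] chart_domD(3)[OF bW(4)[OF that]]] by auto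
  \<comment> \<open>\<open>Q\<close> is \<open>\<phi> 0 \<circ> f t\<close> in coordinates; its
    \<open>t\<close>-derivative \<open>q\<close> at 0 is the transport term
    \<open>d\<phi>(V)\<close>.\<close>
  define Q where "Q = (\<lambda>z. ?U (F z))"
  have CF': "Ck_on k W' F" for k by (rule Ck_on_subset[OF CF]) (auto simp: W'_def)
  have CQ: "Ck_on k W' Q" for k unfolding Q_def
    by (rule Ck_on_compose[OF oW' oO _ CU CF']) (auto simp: W'_def)
  define q where "q = (\<lambda>z. frechet_derivative Q (at z) (1, 0))"
  define v where "v = (\<lambda>z. frechet_derivative F (at z) (1, 0))"
  define B where "B = cball (0::real) d \<times> cball x0 R"
  have B: "compact B" "B \<subseteq> W'" unfolding B_def using box by (auto intro: compact_Times simp: dist_real_def)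
  have "Ck_on 0 W' q" "Ck_on 0 W' v" unfolding q_def v_def using CQ[of 1] CF'[of 1] by (auto simp: One_nat_def)
  then have cq: "continuous_on B q" and cv: "continuous_on B v"
    using continuous_on_subset[OF _ B(2)] by auto
  obtain C where C: "0 < C" "\<And>z. z \<in> B \<Longrightarrow> norm (v z) \<le> C"
  proof -
    have "bounded (v ` B)" using compact_imp_bounded[OF compact_continuous_image[OF cv B(1)]] .
    then show ?thesis using that unfolding bounded_pos by blast
  qed
  have dF: "((\<lambda>t. F (t, x)) has_vector_derivative v (s, x)) (at s)" and dQ: "((\<lambda>t. Q (t, x)) has_vector_derivative q (s, x)) (at s)"
    if "\<bar>s\<bar> \<le> d" "x \<in> cball x0 R" for s x
    unfolding v_def q_def using box[OF that] by (intro slice_has_vector_derivative[OF CF'] slice_has_vector_derivative[OF CQ]; simp)+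
  have Fb: "norm (F (h, x) - x) \<le> C * \<bar>h\<bar>" if "\<bar>h\<bar> \<le> d" "x \<in> cball x0 R" for h x
  proof -
    have "norm (F (h, x) - F (0, x) - h *\<^sub>R 0) \<le> C * \<bar>h\<bar>"
    proof (rule first_order_estimate[of h "\<lambda>t. F (t, x)" "\<lambda>t. v (t, x)"])
      fix t assume t: "\<bar>t\<bar> \<le> \<bar>h\<bar>"
      show "((\<lambda>t. F (t, x)) has_vector_derivative v (t, x)) (at t)" using dF[of t x] t that by linarith
      show "norm (v (t, x) - 0) \<le> C" using C(2)[of "(t, x)"] t that by (simp add: B_def dist_real_def)
    qed
    moreover have "F (0, x) = x" using F0 bW[of 0 x] d(1) that by simp
    ultimately show ?thesis by simp
  qed
  \<comment> \<open>Half of \<open>R\<close>: balls of radius \<open>r\<close> around points of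
    \<open>cball x0 r\<close> stay in \<open>cball x0 R\<close>, where all estimates hold.\<close>
  define r where "r = R / 2"
  have r: "0 < r" using R by (simp add: r_def)
  have solve: "\<exists>x\<in>cball x0 R. F (h, x) = y \<and> norm (x - y) \<le> C * \<bar>h\<bar>"
    if h: "\<bar>h\<bar> \<le> d" "C * \<bar>h\<bar> \<le> r" and y: "y \<in> cball x0 r" for h y
  proof -
    have sub: "cball y r \<subseteq> cball x0 R"
    proof
      fix x assume "x \<in> cball y r"
      then show "x \<in> cball x0 R" using y dist_triangle[of x0 x y] by (simp add: r_def)
    qed
    have "continuous_on W' F" by (rule Ck_on_continuous[OF CF'[of 0]])
    then have "continuous_on (cball y r) (\<lambda>x. x + y - F (h, x))"
      by (intro continuous_intros continuous_on_compose2[of W' F "cball y r" "\<lambda>x. (h, x)"]) (use box h(1) sub in auto)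
    \<comment> \<open>The value differs from \<open>y\<close> by \<open>x - F (h, x)\<close>, whose
      norm is at most \<open>C * \<bar>h\<bar>\<close>, hence at most \<open>r\<close>; a fixed
      point solves \<open>F (h, x) = y\<close>.\<close>
    moreover have "(\<lambda>x. x + y - F (h, x)) \<in> cball y r \<rightarrow> cball y r"
    proof
      fix x assume "x \<in> cball y r"
      then have "norm (F (h, x) - x) \<le> r" using Fb[OF h(1), of x] sub h(2) by fastforce
      moreover have "dist y (x + y - F (h, x)) = norm (F (h, x) - x)" by (simp add: dist_norm)
      ultimately show "x + y - F (h, x) \<in> cball y r" by simp
    qed
    ultimately obtain x where x: "x \<in> cball y r" "x + y - F (h, x) = x"
      using brouwer[of "cball y r" "\<lambda>x. x + y - F (h, x)"] r by (auto simp: Pi_iff image_subset_iff)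
    then have Fy: "F (h, x) = y" by (simp add: algebra_simps)
    have xR: "x \<in> cball x0 R" using x(1) sub by blast
    then show ?thesis using Fy Fb[OF h(1) xR] by (intro bexI[of _ x]) (simp_all only: norm_minus_commute simp_thms)
  qed
  have solve_f: "cinv c y = f h (cinv c x)" if "\<bar>h\<bar> \<le> d" "x \<in> cball x0 R" "F (h, x) = y" for h x y
    using Fc[OF that(1,2)] that(3) cinv_cmap[OF c] by metis
  have small: "\<forall>\<^sub>F h in at (0::real). \<bar>h\<bar> \<le> e" if "0 < e" for e
    using that unfolding eventually_at by (intro exI[of _ e]) (auto simp: dist_real_def)
  have rR: "cball x0 r \<subseteq> cball x0 R" using R by (simp add: r_def subset_cball)
  have sub_dom: "cball x0 R \<subseteq> chart_dom c" using bW(4)[of 0] d(1) by (auto simp del: mem_cball)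
  have ev1: "\<forall>\<^sub>F h in at 0. \<bar>h\<bar> \<le> d \<and> C * \<bar>h\<bar> \<le> r"
    using small[OF d(1)] small[of "r / C"] C(1) r by (auto simp: field_simps elim: eventually_elim2)
  have img: "\<forall>\<^sub>F h in at 0. h \<in> I \<and> (\<forall>y\<in>cball x0 r. cinv c y \<in> f h ` \<Omega>)"
    using eventually_in_I ev1
  proof eventually_elim
    case (elim h)
    have "cinv c y \<in> f h ` \<Omega>" if y: "y \<in> cball x0 r" for y
    proof -
      obtain x where x: "x \<in> cball x0 R" "F (h, x) = y" using solve[of h y] elim y by blast
      have "cinv c y = f h (cinv c x)" using solve_f[OF _ x] elim by blast
      moreover have "cinv c x \<in> \<Omega>" using sub_dom x(1) chart_domD(2) by blast
      ultimately show ?thesis by blast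
    qed
    then show ?case using elim by blast
  qed
  have q0: "q (0, y) = frechet_derivative ?U (at y) (velocity c (cinv c y))" if y: "y \<in> cball x0 R" for y
  proof -
    have z: "(0, y) \<in> W'" "(0, y) \<in> W" "y \<in> ?O" using box[of 0 y] bW[of 0 y] d(1) y by auto
    have Fy: "F (0, y) = y" by (rule F0[OF z(2,3)])
    have "(F has_derivative frechet_derivative F (at (0, y))) (at (0, y))"
      by (rule Ck_on_has_derivative[OF CF[of 1] _ z(2)]) simp
    moreover have "(?U has_derivative frechet_derivative ?U (at y)) (at (F (0, y)))"
      unfolding Fy by (rule Ck_on_has_derivative[OF CU[of 1] _ z(3)]) simp
    ultimately have "(Q has_derivative (\<lambda>w. frechet_derivative ?U (at y) (frechet_derivative F (at (0, y)) w))) (at (0, y))"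
      unfolding Q_def by (rule has_derivative_compose)
    then have "q (0, y) = frechet_derivative ?U (at y) (frechet_derivative F (at (0, y)) (1, 0))"
      unfolding q_def by (simp add: frechet_derivative_at[symmetric])
    also have "frechet_derivative F (at (0, y)) (1, 0) = velocity c (cinv c y)"
      by (rule family_velocity(2)[OF W(1) z(2) CF F chart_domD(3)[OF z(3)], symmetric])
    finally show ?thesis .
  qed
  have ucq: "uniformly_continuous_on B q" by (rule compact_uniformly_continuous[OF cq B(1)])
  have "continuous_on (cball x0 R) ?G"
    using continuous_on_subset[OF Ck_on_continuous[OF CG[of 0]] sub_dom] .
  then have ucG: "uniformly_continuous_on (cball x0 R) ?G" by (rule compact_uniformly_continuous) simp
  have lim: "uniform_limit (cball x0 r) (\<lambda>h y. (\<phi> h (cinv c y) - \<phi> 0 (cinv c y)) / h) (\<lambda>y. ?G y - q (0, y)) (at 0)"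
  proof (rule uniform_limitI)
    fix e :: real assume e: "0 < e"
    define \<eta> where "\<eta> = e / 4"
    have \<eta>: "0 < \<eta>" using e by (simp add: \<eta>_def)
    obtain \<delta>1 where \<delta>1: "0 < \<delta>1" "\<And>z z'. z \<in> B \<Longrightarrow> z' \<in> B \<Longrightarrow> dist z' z < \<delta>1 \<Longrightarrow> dist (q z') (q z) < \<eta>"
      using ucq \<eta> unfolding uniformly_continuous_on_def by metis
    obtain \<delta>2 where \<delta>2: "0 < \<delta>2" "\<And>x x'. x \<in> cball x0 R \<Longrightarrow> x' \<in> cball x0 R \<Longrightarrow> dist x' x < \<delta>2 \<Longrightarrow> dist (?G x') (?G x) < \<eta>"
      using ucG \<eta> unfolding uniformly_continuous_on_def by metis
    have "cball x0 R \<subseteq> crange c" using sub_dom chart_domD(1) by blast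
    from uniform_limitD[OF curve_derivative_limit[OF c compact_cball this] \<eta>]
    have ev2: "\<forall>\<^sub>F h in at 0. \<forall>x\<in>cball x0 R \<inter> cmap c ` (cdom c \<inter> \<Omega>).
      dist ((\<phi> h (f h (cinv c x)) - \<phi> 0 (f 0 (cinv c x))) / h - curve_derivative (cinv c x)) 0 < \<eta>" .
    have ev3: "\<forall>\<^sub>F h in at 0. (1 + C) * \<bar>h\<bar> \<le> \<delta>1 / 2 \<and> C * \<bar>h\<bar> \<le> \<delta>2 / 2"
      using small[of "\<delta>1 / 2 / (1 + C)"] small[of "\<delta>2 / 2 / C"] C(1) \<delta>1(1) \<delta>2(1)
      by (auto simp: field_simps elim: eventually_elim2)
    have "\<forall>\<^sub>F h in at (0::real). h \<noteq> 0" by (simp add: eventually_at_filter)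
    with ev1 ev2 ev3
    show "\<forall>\<^sub>F h in at 0. \<forall>y\<in>cball x0 r. dist ((\<phi> h (cinv c y) - \<phi> 0 (cinv c y)) / h) (?G y - q (0, y)) < e"
    proof eventually_elim
      case (elim h)
      show ?case
      proof
        fix y assume y: "y \<in> cball x0 r"
        then have yR: "y \<in> cball x0 R" using rR by blast
        have hd: "\<bar>h\<bar> \<le> d" using elim by blast
        obtain x where x: "x \<in> cball x0 R" "F (h, x) = y" "norm (x - y) \<le> C * \<bar>h\<bar>" using solve[of h y] elim y by blast
        have xO: "x \<in> ?O" using sub_dom x(1) by blast
        let ?D1 = "(\<phi> h (f h (cinv c x)) - \<phi> 0 (f 0 (cinv c x))) / h"
        have e1: "\<bar>?D1 - ?G x\<bar> < \<eta>"
          using elim(2) x(1) chart_dom_image[OF c xO] by (auto simp: dist_real_def)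
        have e2: "\<bar>?G x - ?G y\<bar> < \<eta>"
          using \<delta>2(2)[OF yR x(1)] x(3) elim(3) \<delta>2(1) by (simp add: dist_norm)
        have e3: "\<bar>Q (h, x) - Q (0, x) - h * q (0, y)\<bar> \<le> \<eta> * \<bar>h\<bar>"
        proof -
          have "norm (Q (h, x) - Q (0, x) - h *\<^sub>R q (0, y)) \<le> \<eta> * \<bar>h\<bar>"
          proof (rule first_order_estimate[of h "\<lambda>t. Q (t, x)" "\<lambda>t. q (t, x)"])
            fix t assume t: "\<bar>t\<bar> \<le> \<bar>h\<bar>"
            show "((\<lambda>t. Q (t, x)) has_vector_derivative q (t, x)) (at t)" using dQ[of t x] t hd x(1) by linarith
            \<comment> \<open>The parameter is off by at most \<open>\<bar>h\<bar>\<close> and the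
              point by at most \<open>C * \<bar>h\<bar>\<close>; hence the constant
              \<open>1 + C\<close> in \<open>ev3\<close>.\<close>
            have "dist (t, x) (0, y) \<le> \<bar>t\<bar> + norm (x - y)"
              using sqrt_sum_squares_le_sum[of "norm (t - 0)" "norm (x - y)"] unfolding dist_Pair_Pair by (simp add: dist_norm)
            also have "\<dots> \<le> (1 + C) * \<bar>h\<bar>" using t x(3) by (simp add: algebra_simps)
            also have "\<dots> < \<delta>1" using elim(3) \<delta>1(1) by linarith
            finally have "dist (q (t, x)) (q (0, y)) < \<eta>"
              using \<delta>1(2)[of "(0, y)" "(t, x)"] t hd x(1) yR d(1) by (simp add: B_def dist_real_def)
            then show "norm (q (t, x) - q (0, y)) \<le> \<eta>" by (simp add: dist_norm)
          qed
          then show ?thesis by simp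
        qed
        have e3': "\<bar>(Q (h, x) - Q (0, x)) / h - q (0, y)\<bar> \<le> \<eta>"
        proof -
          have "(Q (h, x) - Q (0, x)) / h - q (0, y) = (Q (h, x) - Q (0, x) - h * q (0, y)) / h"
            using elim(4) by (simp add: diff_divide_distrib)
          then have "\<bar>(Q (h, x) - Q (0, x)) / h - q (0, y)\<bar> = \<bar>Q (h, x) - Q (0, x) - h * q (0, y)\<bar> / \<bar>h\<bar>"
            by (simp only: abs_divide)
          also have "\<dots> \<le> \<eta>" using e3 elim(4) by (simp add: pos_divide_le_eq)
          finally show ?thesis .
        qed
        \<comment> \<open>With \<open>y = F (h, x)\<close> both functions are evaluated at the same
          moved point. Inserting \<open>\<phi> 0\<close> at the unmoved point \<open>x\<close>
          splits the quotient into that of the composites minus that of \<open>Q\<close>, the latter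
          tending to the transport term.\<close>
        have "\<phi> h (cinv c y) = \<phi> h (f h (cinv c x))" using solve_f[OF hd x(1,2)] by simp
        moreover have "\<phi> 0 (cinv c y) = Q (h, x)" unfolding Q_def x(2) ..
        moreover have "\<phi> 0 (f 0 (cinv c x)) = Q (0, x)"
          unfolding Q_def using F0[of x] bW[of 0 x] d(1) x(1) f_zero[OF chart_domD(3)[OF xO]] by simp
        ultimately have "(\<phi> h (cinv c y) - \<phi> 0 (cinv c y)) / h = ?D1 - (Q (h, x) - Q (0, x)) / h"
          by (simp add: diff_divide_distrib)
        then have "(\<phi> h (cinv c y) - \<phi> 0 (cinv c y)) / h - (?G y - q (0, y)) =
           (?D1 - ?G x) + (?G x - ?G y) - ((Q (h, x) - Q (0, x)) / h - q (0, y))" by linarith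
        then have "\<bar>(\<phi> h (cinv c y) - \<phi> 0 (cinv c y)) / h - (?G y - q (0, y))\<bar> < e"
          using e1 e2 e3' unfolding \<eta>_def by linarith
        then show "dist ((\<phi> h (cinv c y) - \<phi> 0 (cinv c y)) / h) (?G y - q (0, y)) < e" by (simp add: dist_real_def)
      qed
    qed
  qed
  have "Ck_on k (ball x0 r) (\<lambda>y. ?G y - q (0, y))" for k
  proof -
    have bO: "ball x0 r \<subseteq> ?O" using sub_dom rR by force
    have lin: "bounded_linear (\<lambda>x :: real^'n. (0::real, x))" by (intro bounded_linear_Pair bounded_linear_zero bounded_linear_ident)
    have "(\<lambda>y. (0::real, y)) ` ball x0 r \<subseteq> W'" using box[of 0] d(1) rR by (force simp: subset_iff)
    then have "Ck_on k (ball x0 r) (\<lambda>y. q (0, y))" unfolding q_def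
      by (intro Ck_on_compose[OF open_ball oW' _ Ck_on_frechet[OF CQ] Ck_on_bounded_linear[OF lin]])
    then show ?thesis by (intro Ck_on_diff Ck_on_subset[OF CG bO]) auto
  qed
  moreover have eq: "?G y - q (0, y) = ?G y - frechet_derivative ?U (at y) (velocity c (cinv c y))" if "y \<in> cball x0 r" for y
    using q0 that rR by auto
  ultimately have "Ck_on k (ball x0 r) (\<lambda>y. ?G y - frechet_derivative ?U (at y) (velocity c (cinv c y)))" for k
    by (rule Ck_on_cong[OF open_ball, rotated]) (use ball_subset_cball in blast)
  moreover have "uniform_limit (cball x0 r) (\<lambda>h y. (\<phi> h (cinv c y) - \<phi> 0 (cinv c y)) / h)
      (\<lambda>y. ?G y - frechet_derivative ?U (at y) (velocity c (cinv c y))) (at 0)"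
    using lim by (rule uniform_limit_cong'[THEN iffD1, rotated 2]) (use eq in auto)
  ultimately show ?thesis using that[OF r _ img] sub_dom rR by blast
qed

end

section \<open>The linearised eigenvalue equation\<close>

lemma integrable_compactly_supported:
  fixes w :: "'a::euclidean_space \<Rightarrow> real"
  assumes K: "compact K" "K \<subseteq> B" and w: "continuous_on B w" and w0: "\<And>x. x \<in> B \<Longrightarrow> x \<notin> K \<Longrightarrow> w x = 0"
  shows "integrable lborel (\<lambda>x. indicator B x * w x)"
proof -
  have "integrable lborel (\<lambda>x. indicator K x *\<^sub>R w x)"
    by (rule borel_integrable_compact[OF K(1) continuous_on_subset[OF w K(2)]])
  moreover have "(\<lambda>x. indicator K x *\<^sub>R w x) = (\<lambda>x. indicator B x * w x)"
  proof
    fix x show "indicator K x *\<^sub>R w x = indicator B x * w x"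
      using K(2) w0[of x] by (auto simp: indicator_def)
  qed
  ultimately show ?thesis by (simp only:)
qed

text \<open>A continuous function that is nonzero at the centre has constant sign near it, so its
  integral against a bump concentrated there cannot vanish.\<close>

lemma continuous_zero_if_bump_integrals_zero:
  fixes H :: "'a::euclidean_space \<Rightarrow> real"
  assumes r: "0 < r" and H: "continuous_on (ball x0 r) H"
    and int: "\<And>\<rho>. 0 < \<rho> \<Longrightarrow> \<rho> < r \<Longrightarrow> (LINT x|lborel. indicator (ball x0 r) x * (bump x0 \<rho> x * H x)) = 0"
  shows "H x0 = 0"
proof (rule ccontr)
  assume ne: "H x0 \<noteq> 0"
  have x0: "x0 \<in> ball x0 r" using r by simp
  obtain \<delta> where \<delta>: "0 < \<delta>" "\<And>x. x \<in> ball x0 r \<Longrightarrow> dist x x0 < \<delta> \<Longrightarrow> dist (H x) (H x0) < \<bar>H x0\<bar> / 2"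
    using H[unfolded continuous_on_iff, rule_format, OF x0, of "\<bar>H x0\<bar> / 2"] ne by (auto simp: dist_commute)
  \<comment> \<open>Half of the minimum keeps the closed ball inside both the ball of constant sign
    and the domain of continuity.\<close>
  define \<rho> where "\<rho> = min \<delta> r / 2"
  have \<rho>: "0 < \<rho>" "\<rho> < r" "\<rho> < \<delta>" using \<delta> r by (auto simp: \<rho>_def min_def)
  let ?b = "bump x0 \<rho>" and ?c = "\<bar>H x0\<bar> / 2"
  have b0: "?b x = 0" if "x \<notin> cball x0 \<rho>" for x using bump_eq_0[OF \<rho>(1), of x0 x] that by simp
  have pos: "?c \<le> sgn (H x0) * H x" if "x \<in> cball x0 \<rho>" for x
  proof -
    have "\<bar>H x - H x0\<bar> < ?c" using \<delta>(2)[of x] that \<rho> by (auto simp: dist_real_def dist_commute)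
    from abs_less_iff[THEN iffD1, OF this] have l: "H x - H x0 < ?c" "- ?c < H x - H x0" by linarith+
    show ?thesis
    proof (cases "H x0 > 0")
      case True
      then show ?thesis using l by simp
    next
      case False
      then have "H x0 < 0" using ne by simp
      then show ?thesis using l by simp
    qed
  qed
  have int1: "integrable lborel (\<lambda>x. indicator (ball x0 r) x * (?b x * H x))"
  proof (rule integrable_compactly_supported[of "cball x0 \<rho>"])
    show "continuous_on (ball x0 r) (\<lambda>x. ?b x * H x)"
      by (intro continuous_intros H continuous_on_subset[OF Ck_on_continuous[OF Ck_on_bump]]) simp
  qed (use \<rho> b0 in auto)
  have int2: "integrable lborel (\<lambda>x. indicator (cball x0 (\<rho> / 2)) x * ?c)"
    using borel_integrable_compact[of "cball x0 (\<rho> / 2)" "\<lambda>_. ?c"] by simp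
  \<comment> \<open>The factor \<open>sgn (H x0)\<close> treats both signs at once; the bump is
    bounded below by the indicator of the ball of radius \<open>\<rho> / 2\<close>, on which it
    equals 1.\<close>
  have "(LINT x|lborel. indicator (cball x0 (\<rho> / 2)) x * ?c) \<le>
     (LINT x|lborel. sgn (H x0) * (indicator (ball x0 r) x * (?b x * H x)))"
  proof (rule integral_mono[OF int2])
    show "integrable lborel (\<lambda>x. sgn (H x0) * (indicator (ball x0 r) x * (?b x * H x)))" using int1 by simp
    fix x
    show "indicator (cball x0 (\<rho> / 2)) x * ?c \<le> sgn (H x0) * (indicator (ball x0 r) x * (?b x * H x))"
    proof (cases "x \<in> cball x0 \<rho>")
      case True
      then have xr: "x \<in> ball x0 r" using \<rho> by auto
      have "indicator (cball x0 (\<rho> / 2)) x \<le> ?b x"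
        using bump_eq_1[OF \<rho>(1), of x0 x] bump_bounds(1)[of x0 \<rho> x] by (auto simp: indicator_def)
      then have "indicator (cball x0 (\<rho> / 2)) x * ?c \<le> ?b x * (sgn (H x0) * H x)"
        using pos[OF True] bump_bounds(1)[of x0 \<rho> x] by (intro mult_mono) auto
      then show ?thesis using xr by (simp add: mult_ac)
    next
      case False
      then have "x \<notin> cball x0 (\<rho> / 2)" using \<rho>(1) by auto
      then show ?thesis using b0[OF False] by simp
    qed
  qed
  also have "\<dots> = sgn (H x0) * (LINT x|lborel. indicator (ball x0 r) x * (?b x * H x))" by simp
  also have "\<dots> = 0" using int[OF \<rho>(1,2)] by simp
  finally have "measure lborel (cball x0 (\<rho> / 2)) * ?c \<le> 0" by simp
  moreover have "0 < measure lborel (cball x0 (\<rho> / 2))" using \<rho>(1) content_cball_pos by simp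
  ultimately show False using ne by (simp add: mult_le_0_iff)
qed

text \<open>Pointwise majorant for a dominated convergence argument: \<open>d\<close>,
  \<open>l\<close>, \<open>q\<close> stand for the difference quotient of the eigenfunctions, the
  eigenvalue and its difference quotient, and \<open>p\<close>, \<open>m\<close>, \<open>n\<close>
  for their bounds.\<close>

lemma dominating_bound:
  fixes d l q p m n :: real
  assumes d: "\<bar>d\<bar> \<le> p" and l: "\<bar>l\<bar> \<le> m" and q: "\<bar>q\<bar> \<le> n"
  shows "\<bar>d * a + (l * d + q * z) * b\<bar> \<le> p * \<bar>a\<bar> + (m * p + n * \<bar>z\<bar>) * \<bar>b\<bar>"
proof -
  have "0 \<le> m" using l abs_ge_zero order_trans by blast
  have "\<bar>l * d + q * z\<bar> \<le> \<bar>l\<bar> * \<bar>d\<bar> + \<bar>q\<bar> * \<bar>z\<bar>"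
    using abs_triangle_ineq[of "l * d" "q * z"] by (simp only: abs_mult)
  also have "\<dots> \<le> m * p + n * \<bar>z\<bar>"
    by (intro add_mono mult_mono d l q) (use \<open>0 \<le> m\<close> q abs_ge_zero order_trans in auto)
  finally have lq: "\<bar>l * d + q * z\<bar> * \<bar>b\<bar> \<le> (m * p + n * \<bar>z\<bar>) * \<bar>b\<bar>" by (rule mult_right_mono) simp
  have "\<bar>d\<bar> * \<bar>a\<bar> \<le> p * \<bar>a\<bar>" by (rule mult_right_mono[OF d]) simp
  with lq show ?thesis
    using abs_triangle_ineq[of "d * a" "(l * d + q * z) * b"] unfolding abs_mult by linarith
qed

context eigenvalue_deformation
begin

text \<open>On the frontier a fixed point may lie outside the moving domain, so the expected
  boundary value is taken as the definition there. \<open>boundary_extension\<close> justifies the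
  choice: near a boundary point both cases are values of one \<open>C^2\<close> function.\<close>

definition phidot :: "'m \<Rightarrow> real" where
  "phidot p = (if p \<in> \<Omega> then vector_derivative (\<lambda>h. \<phi> h p) (at 0)
     else - (normal_velocity A g \<Omega> f p * normal_derivative A g \<Omega> (\<phi> 0) p))"

lemma phidot_interior:
  assumes c: "c \<in> A" and y: "y \<in> chart_dom c"
  shows "phidot (cinv c y) = curve_derivative (cinv c y) - frechet_derivative (\<lambda>y. \<phi> 0 (cinv c y)) (at y) (velocity c (cinv c y))"
    (is "_ = ?L y")
proof -
  obtain r where r: "0 < r" "cball y r \<subseteq> chart_dom c"
    "\<forall>\<^sub>F h in at 0. h \<in> I \<and> (\<forall>y\<in>cball y r. cinv c y \<in> f h ` \<Omega>)"
    "uniform_limit (cball y r) (\<lambda>h y. (\<phi> h (cinv c y) - \<phi> 0 (cinv c y)) / h)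
      (\<lambda>y. curve_derivative (cinv c y) - frechet_derivative (\<lambda>y. \<phi> 0 (cinv c y)) (at y) (velocity c (cinv c y))) (at 0)"
    "\<forall>k. Ck_on k (ball y r) (\<lambda>y. curve_derivative (cinv c y) - frechet_derivative (\<lambda>y. \<phi> 0 (cinv c y)) (at y) (velocity c (cinv c y)))"
    by (rule interior_variation[OF c y])
  have "((\<lambda>h. (\<phi> h (cinv c y) - \<phi> 0 (cinv c y)) / h) \<longlongrightarrow> ?L y) (at 0)"
    by (rule tendsto_uniform_limitI[OF r(4)]) (use r(1) in simp)
  then have "((\<lambda>h. \<phi> h (cinv c y)) has_real_derivative ?L y) (at 0)" by (simp add: DERIV_def)
  then have "vector_derivative (\<lambda>h. \<phi> h (cinv c y)) (at 0) = ?L y"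
    by (intro vector_derivative_at) (simp add: has_real_derivative_iff_has_vector_derivative)
  then show ?thesis using chart_domD(2)[OF y] by (simp add: phidot_def)
qed

text \<open>Smoothness is read off from the explicit formula of \<open>phidot_interior\<close>; no
  derivative of a difference quotient is passed to the limit.\<close>

lemma Ck_on_phidot:
  assumes c: "c \<in> A" shows "Ck_on k (chart_dom c) (\<lambda>y. phidot (cinv c y))"
proof (rule Ck_on_local)
  fix x assume x: "x \<in> chart_dom c"
  obtain r where r: "0 < r" "cball x r \<subseteq> chart_dom c"
    "\<forall>\<^sub>F h in at 0. h \<in> I \<and> (\<forall>y\<in>cball x r. cinv c y \<in> f h ` \<Omega>)"
    "uniform_limit (cball x r) (\<lambda>h y. (\<phi> h (cinv c y) - \<phi> 0 (cinv c y)) / h)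
      (\<lambda>y. curve_derivative (cinv c y) - frechet_derivative (\<lambda>y. \<phi> 0 (cinv c y)) (at y) (velocity c (cinv c y))) (at 0)"
    "\<forall>k. Ck_on k (ball x r) (\<lambda>y. curve_derivative (cinv c y) - frechet_derivative (\<lambda>y. \<phi> 0 (cinv c y)) (at y) (velocity c (cinv c y)))"
    by (rule interior_variation[OF c x])
  have "Ck_on k (ball x r) (\<lambda>y. phidot (cinv c y))"
  proof (rule Ck_on_cong[OF open_ball _ r(5)[rule_format]])
    fix y assume "y \<in> ball x r"
    then have "y \<in> chart_dom c" using r(2) by auto
    from phidot_interior[OF c this]
    show "curve_derivative (cinv c y) - frechet_derivative (\<lambda>y. \<phi> 0 (cinv c y)) (at y) (velocity c (cinv c y)) = phidot (cinv c y)" by simp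
  qed
  then show "\<exists>U. open U \<and> x \<in> U \<and> Ck_on k U (\<lambda>y. phidot (cinv c y))" using r(1) by (intro exI[of _ "ball x r"]) simp
qed

lemma lapd_eigen:
  assumes h: "h \<in> I" and c: "c \<in> A" and y: "y \<in> crange c" "cinv c y \<in> f h ` \<Omega>"
  shows "lapd c (\<lambda>y. \<phi> h (cinv c y)) y = - (sqrt (det (g c y)) * (\<Lambda> h * \<phi> h (cinv c y)))"
proof -
  have "- (lapd c (\<lambda>y. \<phi> h (cinv c y)) y / sqrt (det (g c y))) = \<Lambda> h * \<phi> h (cinv c y)"
    using eigen[OF h y(2) c cinv_cdom[OF y(1)]] unfolding laplacian_lapd cmap_cinv[OF y(1)] .
  moreover have "0 < sqrt (det (g c y))" using det_metric_pos[OF c y(1)] by simp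
  ultimately show ?thesis by (simp add: field_simps)
qed

lemma flux_zero: "open N \<Longrightarrow> x \<in> N \<Longrightarrow> (\<And>y. y \<in> N \<Longrightarrow> U y = 0) \<Longrightarrow> flux c U x j = 0"
proof -
  assume N: "open N" "x \<in> N" "\<And>y. y \<in> N \<Longrightarrow> U y = 0"
  have "partial i U x = 0" for i
    using partial_cong[OF N(1,2), of U "\<lambda>_. 0" i] N(3) by (simp add: partial_def)
  then show ?thesis by (simp add: flux_def matrix_vector_mult_def)
qed

text \<open>Integration by parts moves the operator to the test function, and a test function
  supported in a compact part of \<open>B\<close> leaves no boundary term. The factor 1 in
  \<open>?Y\<close> is the constant cut-off of \<open>divergence_green\<close>.\<close>

lemma weak_green:
  assumes c: "c \<in> A" and B: "open B" "B \<subseteq> crange c" and P: "Ck_on 2 B P" and \<psi>: "Ck_on 2 B \<psi>"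
    and K: "compact K" "K \<subseteq> B" and \<psi>0: "\<And>x. x \<notin> K \<Longrightarrow> \<psi> x = 0"
  shows "(LINT x|lborel. indicator B x * (P x * lapd c \<psi> x - \<psi> x * lapd c P x)) = 0"
proof -
  let ?Y = "\<lambda>j y. 1 * (P y * flux c \<psi> y j - \<psi> y * flux c P y j)"
  have oK: "open (- K)" using K(1) by (simp add: compact_imp_closed open_Compl)
  have f: "Ck_on 1 B (\<lambda>x. flux c \<psi> x j)" "Ck_on 1 B (\<lambda>x. flux c P x j)" for j
    using Ck_on_flux[OF c B, of 1] P \<psi> by (simp_all add: numeral_2_eq_2)
  have P1: "Ck_on 1 B P" "Ck_on 1 B \<psi>" using Ck_on_mono[OF P, of 1] Ck_on_mono[OF \<psi>, of 1] by simp_all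
  have int: "(LINT x|lborel. indicator B x * (\<Sum>j\<in>UNIV. partial j (?Y j) x)) = 0"
  proof (rule divergence_compact_support[OF B(1) K])
    show "Ck_on 1 B (?Y j)" for j by (intro Ck_on_mult Ck_on_diff Ck_on_const B f P1)
    show "?Y j x = 0" if "x \<in> B" "x \<notin> K" for j x
      using flux_zero[OF oK, of x \<psi> c j] \<psi>0 that by simp
  qed
  have eq: "indicator B x * (\<Sum>j\<in>UNIV. partial j (?Y j) x) = indicator B x * (P x * lapd c \<psi> x - \<psi> x * lapd c P x)" for x
  proof (cases "x \<in> B")
    case True
    show ?thesis unfolding divergence_green[OF c B \<psi> P Ck_on_const True] by (simp add: partial_def)
  qed simp
  from int show ?thesis unfolding eq .
qed

definition \<Lambda>' :: real where "\<Lambda>' = deriv \<Lambda> 0"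

lemma \<Lambda>_has_derivative: "(\<Lambda> has_real_derivative \<Lambda>') (at 0)"
  unfolding \<Lambda>'_def using \<Lambda>_differentiable by (metis DERIV_deriv_iff_real_differentiable)

text \<open>The difference quotients of \<open>\<phi>\<^sub>\<epsilon>\<close> are only known to converge uniformly, without derivatives.
  The equation is therefore obtained in the weak sense, with bump functions as test functions.\<close>

lemma linearised_equation:
  assumes c: "c \<in> A" and x0: "x0 \<in> chart_dom c"
  shows "lapd c (\<lambda>y. phidot (cinv c y)) x0 =
    - (sqrt (det (g c x0)) * (\<Lambda> 0 * phidot (cinv c x0) + \<Lambda>' * \<phi> 0 (cinv c x0)))"
proof -
  obtain r where r: "0 < r" "cball x0 r \<subseteq> chart_dom c"
    "\<forall>\<^sub>F h in at 0. h \<in> I \<and> (\<forall>y\<in>cball x0 r. cinv c y \<in> f h ` \<Omega>)"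
    "uniform_limit (cball x0 r) (\<lambda>h y. (\<phi> h (cinv c y) - \<phi> 0 (cinv c y)) / h)
      (\<lambda>y. curve_derivative (cinv c y) - frechet_derivative (\<lambda>y. \<phi> 0 (cinv c y)) (at y) (velocity c (cinv c y))) (at 0)"
    "\<forall>k. Ck_on k (ball x0 r) (\<lambda>y. curve_derivative (cinv c y) - frechet_derivative (\<lambda>y. \<phi> 0 (cinv c y)) (at y) (velocity c (cinv c y)))"
    by (rule interior_variation[OF c x0])
  let ?B = "ball x0 r" and ?P = "\<lambda>h y. \<phi> h (cinv c y)" and ?P' = "\<lambda>y. phidot (cinv c y)" and ?s = "\<lambda>y. sqrt (det (g c y))"
  have Bd: "?B \<subseteq> chart_dom c" using r(2) ball_subset_cball by blast
  then have Bc: "?B \<subseteq> crange c" using chart_domD(1) by blast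
  have ul: "uniform_limit ?B (\<lambda>h y. (?P h y - ?P 0 y) / h) ?P' (at 0)"
  proof (rule uniform_limit_cong'[THEN iffD1, rotated 2])
    show "uniform_limit ?B (\<lambda>h y. (?P h y - ?P 0 y) / h)
      (\<lambda>y. curve_derivative (cinv c y) - frechet_derivative (\<lambda>y. \<phi> 0 (cinv c y)) (at y) (velocity c (cinv c y))) (at 0)"
      by (rule uniform_limit_on_subset[OF r(4) ball_subset_cball])
    show "curve_derivative (cinv c y) - frechet_derivative (\<lambda>y. \<phi> 0 (cinv c y)) (at y) (velocity c (cinv c y)) = ?P' y" if "y \<in> ?B" for y
      using phidot_interior[OF c] that Bd by (simp add: subset_iff)
  qed simp
  have good0: "0 \<in> I \<and> (\<forall>y\<in>cball x0 r. cinv c y \<in> f 0 ` \<Omega>)"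
    using zero_I r(2) chart_domD(2) unfolding f_zero_image by blast
  have CP: "Ck_on 2 ?B (?P h)" if "h \<in> I \<and> (\<forall>y\<in>cball x0 r. cinv c y \<in> f h ` \<Omega>)" for h
    by (rule Ck_on_smooth_fun[OF smooth_\<phi> c open_ball Bc]) (use that closure_subset in force)+
  have CP': "Ck_on 2 ?B ?P'" by (rule Ck_on_subset[OF Ck_on_phidot[OF c] Bd])
  have cs: "continuous_on ?B ?s" by (rule continuous_on_subset[OF Ck_on_continuous[OF Ck_on_sqrt_det[OF c]] Bc])
  have clP': "continuous_on ?B (lapd c ?P')"
    using Ck_on_lapd[OF c open_ball Bc, of 0 ?P'] CP' by (simp add: numeral_2_eq_2)
  have cP: "continuous_on ?B (?P h)" if "h \<in> I \<and> (\<forall>y\<in>cball x0 r. cinv c y \<in> f h ` \<Omega>)" for h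
    by (rule Ck_on_continuous[OF CP[OF that]])
  have cP': "continuous_on ?B ?P'" by (rule Ck_on_continuous[OF CP'])
  \<comment> \<open>The defect of the linearised equation, continuous near \<open>x0\<close>; the
    claim is \<open>H x0 = 0\<close>.\<close>
  define H where "H = (\<lambda>y. lapd c ?P' y + ?s y * (\<Lambda> 0 * ?P' y + \<Lambda>' * ?P 0 y))"
  have "H x0 = 0"
  proof (rule continuous_zero_if_bump_integrals_zero[of r x0 H, OF r(1)])
    show "continuous_on ?B H" unfolding H_def by (intro continuous_intros clP' cs cP' cP good0)
    fix \<rho> assume \<rho>: "0 < \<rho>" "\<rho> < r"
    let ?\<psi> = "bump x0 \<rho>" and ?K = "cball x0 \<rho>"
    have K: "compact ?K" "?K \<subseteq> ?B" using \<rho> by auto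
    have oK: "open (- ?K)" by (simp add: open_Compl)
    have C\<psi>: "Ck_on 2 ?B ?\<psi>" by (rule Ck_on_subset[OF Ck_on_bump]) simp
    have \<psi>0: "?\<psi> x = 0" if "x \<notin> ?K" for x using bump_eq_0[OF \<rho>(1), of x0 x] that by simp
    define a where "a = lapd c ?\<psi>"
    define b where "b = (\<lambda>y. ?s y * ?\<psi> y)"
    have ca: "continuous_on ?B a" unfolding a_def
      using Ck_on_lapd[OF c open_ball Bc, of 0 ?\<psi>] C\<psi> by (simp add: numeral_2_eq_2)
    have cb: "continuous_on ?B b" unfolding b_def by (intro continuous_intros cs Ck_on_continuous[OF C\<psi>])
    have a0: "a x = 0" if "x \<notin> ?K" for x
    proof -
      have "a x = lapd c (\<lambda>_. 0) x" unfolding a_def by (rule lapd_cong[OF oK]) (use that \<psi>0 in auto)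
      also have "\<dots> = 0" unfolding lapd_def flux_zero[OF open_UNIV UNIV_I refl] by (simp add: partial_def)
      finally show ?thesis .
    qed
    have b0: "b x = 0" if "x \<notin> ?K" for x using \<psi>0[OF that] by (simp add: b_def)
    have int: "integrable lborel (\<lambda>x. indicator ?B x * (w x * a x + v x * b x))"
      if "continuous_on ?B w" "continuous_on ?B v" for w v
      by (rule integrable_compactly_supported[OF K]) (use that a0 b0 in \<open>auto intro!: continuous_intros ca cb\<close>)
    \<comment> \<open>Weak form of the eigenvalue equation for \<open>\<phi> h\<close>: all
      derivatives have been moved to the bump, so that only values of \<open>\<phi> h\<close> enter
      the limit.\<close>
    have Z: "(LINT y|lborel. indicator ?B y * (?P h y * a y + (\<Lambda> h * ?P h y) * b y)) = 0"
      if h: "h \<in> I \<and> (\<forall>y\<in>cball x0 r. cinv c y \<in> f h ` \<Omega>)" for h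
    proof -
      have eq: "indicator ?B y * (?P h y * a y + (\<Lambda> h * ?P h y) * b y) =
        indicator ?B y * (?P h y * lapd c ?\<psi> y - ?\<psi> y * lapd c (?P h) y)" for y
      proof (cases "y \<in> ?B")
        case True
        then have "y \<in> crange c" "cinv c y \<in> f h ` \<Omega>" using Bc h by auto
        from lapd_eigen[OF _ c this] h show ?thesis by (simp add: a_def b_def algebra_simps)
      qed simp
      show ?thesis unfolding eq by (rule weak_green[OF c open_ball Bc CP[OF h] C\<psi> K \<psi>0])
    qed
    have Z': "(LINT y|lborel. indicator ?B y * (?P' y * a y - ?\<psi> y * lapd c ?P' y)) = 0"
      using weak_green[OF c open_ball Bc CP' C\<psi> K \<psi>0] unfolding a_def .
    define D where "D = (\<lambda>h y. (?P h y - ?P 0 y) / h)"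
    \<comment> \<open>The integrand of the weak equation for \<open>h\<close> minus that for 0,
      divided by \<open>h\<close>, with the product of eigenvalue and eigenfunction split by the
      discrete product rule. \<open>E0\<close> is its formal limit.\<close>
    define E where "E = (\<lambda>h y. indicator ?B y * (D h y * a y + (\<Lambda> h * D h y + (\<Lambda> h - \<Lambda> 0) / h * ?P 0 y) * b y))"
    define E0 where "E0 = (\<lambda>y. indicator ?B y * (?P' y * a y + (\<Lambda> 0 * ?P' y + \<Lambda>' * ?P 0 y) * b y))"
    have intE: "integrable lborel (E h)" and E: "(LINT y|lborel. E h y) = 0" if h: "h \<in> I \<and> (\<forall>y\<in>cball x0 r. cinv c y \<in> f h ` \<Omega>)" "h \<noteq> 0" for h
    proof -
      have cD: "continuous_on ?B (D h)" unfolding D_def using h(2) by (intro continuous_intros cP h(1) good0) auto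
      show "integrable lborel (E h)" unfolding E_def by (rule int) (intro continuous_intros cD cP good0)+
      have i1: "integrable lborel (\<lambda>y. indicator ?B y * (?P h y * a y + (\<Lambda> h * ?P h y) * b y))"
        by (rule int) (intro continuous_intros cP h(1))+
      have i0: "integrable lborel (\<lambda>y. indicator ?B y * (?P 0 y * a y + (\<Lambda> 0 * ?P 0 y) * b y))"
        by (rule int) (intro continuous_intros cP good0)+
      have eq: "E h y = (indicator ?B y * (?P h y * a y + (\<Lambda> h * ?P h y) * b y) - indicator ?B y * (?P 0 y * a y + (\<Lambda> 0 * ?P 0 y) * b y)) / h" for y
        using h(2) by (simp add: E_def D_def field_simps)
      show "(LINT y|lborel. E h y) = 0"
        unfolding eq using Bochner_Integration.integral_diff[OF i1 i0] Z[OF h(1)] Z[OF good0] by simp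
    qed
    have E0: "(LINT y|lborel. E0 y) = 0" and intE0: "integrable lborel E0"
    proof -
      show "integrable lborel E0" unfolding E0_def by (rule int) (intro continuous_intros cP' cP good0)+
      have evD: "\<forall>\<^sub>F h in at 0. \<forall>y\<in>?B. dist (D h y) (?P' y) < 1"
        using uniform_limitD[OF ul, of 1] unfolding D_def by simp
      have quot: "((\<lambda>h. (\<Lambda> h - \<Lambda> 0) / h) \<longlongrightarrow> \<Lambda>') (at 0)" using \<Lambda>_has_derivative by (simp add: DERIV_def)
      have \<Lambda>lim: "(\<Lambda> \<longlongrightarrow> \<Lambda> 0) (at 0)" using DERIV_isCont[OF \<Lambda>_has_derivative] by (simp add: isCont_def)
      have ev: "\<forall>\<^sub>F h in at 0. (h \<in> I \<and> (\<forall>y\<in>cball x0 r. cinv c y \<in> f h ` \<Omega>)) \<and> h \<noteq> 0 \<and>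
          (\<forall>y\<in>?B. dist (D h y) (?P' y) < 1) \<and> dist (\<Lambda> h) (\<Lambda> 0) < 1 \<and> dist ((\<Lambda> h - \<Lambda> 0) / h) \<Lambda>' < 1"
        by (intro eventually_conj r(3) evD tendstoD[OF \<Lambda>lim] tendstoD[OF quot]) (auto simp: eventually_at_filter)
      \<comment> \<open>Dominated convergence is a statement about sequences; the shift by
        \<open>N\<close> below makes the bounds hold for every index.\<close>
      define X :: "nat \<Rightarrow> real" where "X = (\<lambda>n. inverse (real (Suc n)))"
      have X: "filterlim X (at 0) sequentially"
        unfolding filterlim_at X_def using LIMSEQ_inverse_real_of_nat by auto
      from X ev have "\<forall>\<^sub>F n in sequentially. (X n \<in> I \<and> (\<forall>y\<in>cball x0 r. cinv c y \<in> f (X n) ` \<Omega>)) \<and> X n \<noteq> 0 \<and>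
          (\<forall>y\<in>?B. dist (D (X n) y) (?P' y) < 1) \<and> dist (\<Lambda> (X n)) (\<Lambda> 0) < 1 \<and> dist ((\<Lambda> (X n) - \<Lambda> 0) / X n) \<Lambda>' < 1"
        unfolding filterlim_iff by blast
      then obtain N where N: "\<And>n. N \<le> n \<Longrightarrow> (X n \<in> I \<and> (\<forall>y\<in>cball x0 r. cinv c y \<in> f (X n) ` \<Omega>)) \<and> X n \<noteq> 0 \<and>
          (\<forall>y\<in>?B. dist (D (X n) y) (?P' y) < 1) \<and> dist (\<Lambda> (X n)) (\<Lambda> 0) < 1 \<and> dist ((\<Lambda> (X n) - \<Lambda> 0) / X n) \<Lambda>' < 1"
        unfolding eventually_sequentially by blast
      define h where "h = (\<lambda>n. X (n + N))"
      have hl: "filterlim h (at 0) sequentially" unfolding h_def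
        by (rule filterlim_compose[OF X]) (rule filterlim_add_const_nat_at_top)
      have h: "(h n \<in> I \<and> (\<forall>y\<in>cball x0 r. cinv c y \<in> f (h n) ` \<Omega>))" "h n \<noteq> 0"
          "\<And>y. y \<in> ?B \<Longrightarrow> dist (D (h n) y) (?P' y) < 1" "dist (\<Lambda> (h n)) (\<Lambda> 0) < 1" "dist ((\<Lambda> (h n) - \<Lambda> 0) / h n) \<Lambda>' < 1" for n
        using N[of "n + N"] by (auto simp: h_def)
      \<comment> \<open>Every quotient, and the eigenvalue itself, differs from its limit by less
        than 1; hence the summands 1 in the majorant.\<close>
      define w where "w = (\<lambda>y. indicator ?B y * ((\<bar>?P' y\<bar> + 1) * \<bar>a y\<bar> + ((\<bar>\<Lambda> 0\<bar> + 1) * (\<bar>?P' y\<bar> + 1) + (\<bar>\<Lambda>'\<bar> + 1) * \<bar>?P 0 y\<bar>) * \<bar>b y\<bar>))"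
      have "integrable lborel w" unfolding w_def
        by (rule integrable_compactly_supported[OF K]) (use a0 b0 in \<open>auto intro!: continuous_intros ca cb cP' cP good0\<close>)
      then have "(\<lambda>n. LINT y|lborel. E (h n) y) \<longlonglongrightarrow> (LINT y|lborel. E0 y)"
      proof (rule integral_dominated_convergence[rotated 2])
        show "E0 \<in> borel_measurable lborel" using \<open>integrable lborel E0\<close> by (rule borel_measurable_integrable)
        show "E (h n) \<in> borel_measurable lborel" for n using intE[OF h(1,2)] by (rule borel_measurable_integrable)
        show "AE y in lborel. (\<lambda>n. E (h n) y) \<longlonglongrightarrow> E0 y"
        proof (rule AE_I2)
          fix y
          show "(\<lambda>n. E (h n) y) \<longlonglongrightarrow> E0 y"
          proof (cases "y \<in> ?B")
            case True
            have "(\<lambda>n. D (h n) y) \<longlonglongrightarrow> ?P' y"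
              using filterlim_compose[OF tendsto_uniform_limitI[OF ul True] hl] unfolding D_def .
            moreover have "(\<lambda>n. \<Lambda> (h n)) \<longlonglongrightarrow> \<Lambda> 0" by (rule filterlim_compose[OF \<Lambda>lim hl])
            moreover have "(\<lambda>n. (\<Lambda> (h n) - \<Lambda> 0) / h n) \<longlonglongrightarrow> \<Lambda>'" by (rule filterlim_compose[OF quot hl])
            ultimately show ?thesis unfolding E_def E0_def by (intro tendsto_intros)
          qed (simp add: E_def E0_def)
        qed
        show "AE y in lborel. norm (E (h n) y) \<le> w y" for n
        proof (rule AE_I2)
          fix y
          show "norm (E (h n) y) \<le> w y"
          proof (cases "y \<in> ?B")
            case True
            have D1: "\<bar>D (h n) y\<bar> \<le> \<bar>?P' y\<bar> + 1" using h(3)[OF True, of n] by (simp add: dist_real_def) 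
            have L1: "\<bar>\<Lambda> (h n)\<bar> \<le> \<bar>\<Lambda> 0\<bar> + 1" using h(4)[of n] by (simp add: dist_real_def)
            have L2: "\<bar>(\<Lambda> (h n) - \<Lambda> 0) / h n\<bar> \<le> \<bar>\<Lambda>'\<bar> + 1" using h(5)[of n] unfolding dist_real_def by linarith
            show ?thesis unfolding E_def w_def
              using True dominating_bound[OF D1 L1 L2] by (simp only: indicator_simps mult_1 real_norm_def)
          qed (simp add: E_def w_def)
        qed
      qed
      moreover have "(\<lambda>n. LINT y|lborel. E (h n) y) = (\<lambda>_. 0)" using E[OF h(1,2)] by simp
      ultimately show "(LINT y|lborel. E0 y) = 0" using LIMSEQ_unique tendsto_const by metis
    qed
    have i2: "integrable lborel (\<lambda>y. indicator ?B y * (?P' y * a y - ?\<psi> y * lapd c ?P' y))"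
      by (rule integrable_compactly_supported[OF K])
        (use a0 \<psi>0 in \<open>auto intro!: continuous_intros ca cP' clP' Ck_on_continuous[OF C\<psi>]\<close>)
    \<comment> \<open>Integration by parts back to \<open>phidot\<close>, legitimate because
      \<open>phidot\<close> is smooth in \<Omega>: the weak limit equation minus Green's identity
      for \<open>phidot\<close> tests the defect \<open>H\<close> against the bump.\<close>
    have eq: "indicator ?B y * (?\<psi> y * H y) = E0 y - indicator ?B y * (?P' y * a y - ?\<psi> y * lapd c ?P' y)" for y
      by (simp add: E0_def H_def b_def algebra_simps)
    show "(LINT y|lborel. indicator ?B y * (?\<psi> y * H y)) = 0"
      unfolding eq using Bochner_Integration.integral_diff[OF intE0 i2] E0 Z' by simp
  qed
  then show ?thesis by (simp add: H_def)
qed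

section \<open>Green's identity for the eigenfunction and its variation\<close>

text \<open>The partials along the hyperplane are derivatives of the zero function, so only the
  \<open>k\<close>-th remains. Applied to \<open>\<phi>\<close>, this is why only the normal
  component of the velocity enters.\<close>

lemma hyperplane_gradient:
  assumes W: "open W" "y \<in> W" "y $ k = 0" and F: "Ck_on 1 W F" and F0: "\<And>x. x \<in> W \<Longrightarrow> x $ k = 0 \<Longrightarrow> F x = (0::real)"
  shows "frechet_derivative F (at y) v = v $ k * partial k F y" and "i \<noteq> k \<Longrightarrow> partial i F y = 0"
proof -
  have d: "F differentiable (at y)" using Ck_on_differentiable[OF F _ W(2)] by simp
  have p0: "partial i F y = 0" if "i \<noteq> k" for i
  proof -
    have dF: "(F has_derivative frechet_derivative F (at y)) (at (y + 0 *\<^sub>R axis i 1))"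
      using d[unfolded frechet_derivative_works] by (simp only: scale_zero_left add_0_right)
    have d1: "((\<lambda>t. F (y + t *\<^sub>R axis i 1)) has_derivative (\<lambda>t. frechet_derivative F (at y) (t *\<^sub>R axis i 1))) (at 0)"
      by (rule has_derivative_compose[of "\<lambda>t. y + t *\<^sub>R axis i 1" "\<lambda>t. t *\<^sub>R axis i 1" 0 UNIV, OF _ dF])
        (auto intro!: derivative_eq_intros)
    have o: "open ((\<lambda>t. y + t *\<^sub>R axis i 1) -` W)" by (rule open_vimage[OF W(1)]) (intro continuous_intros)
    have "((\<lambda>_. 0) has_derivative (\<lambda>t. frechet_derivative F (at y) (t *\<^sub>R axis i 1))) (at 0)"
      by (rule has_derivative_transform_within_open[OF d1 o]) (use W F0 that in \<open>auto simp: axis_def\<close>)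
    then have "(\<lambda>t. frechet_derivative F (at y) (t *\<^sub>R axis i 1)) = (\<lambda>_. 0)"
      using has_derivative_const has_derivative_unique by blast
    from fun_cong[OF this, of 1] show ?thesis by (simp add: partial_def)
  qed
  then show "i \<noteq> k \<Longrightarrow> partial i F y = 0" .
  have "frechet_derivative F (at y) = (\<lambda>v. \<Sum>i\<in>UNIV. v $ i * partial i F y)"
    using frechet_derivative_at[OF has_derivative_partial[OF d]] by simp
  then have "frechet_derivative F (at y) v = (\<Sum>i\<in>UNIV. v $ i * partial i F y)" by simp
  also have "\<dots> = v $ k * partial k F y" using p0 by (subst sum.remove[of _ k]) auto
  finally show "frechet_derivative F (at y) v = v $ k * partial k F y" .
qed

text \<open>\<open>\<Phi>\<close> is the interior formula for \<open>phidot\<close> with every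
  ingredient replaced by a local extension, so it is \<open>C^2\<close> across the boundary. On the
  hyperplane \<open>curve_derivative\<close> vanishes and the transport term reduces to its
  \<open>k\<close>-th component; the factors \<open>sqrt (inv_nn c k y)\<close> of normal derivative
  and normal velocity cancel, leaving the frontier case of \<open>phidot\<close>.\<close>

lemma boundary_extension:
  assumes bc: "boundary_chart A \<Omega> c k" and p: "p \<in> cdom c" "p \<in> frontier \<Omega>"
  obtains W F \<Phi> where "open W" "cmap c p \<in> W" "W \<subseteq> crange c" "Ck_on 2 W F" "Ck_on 2 W \<Phi>"
    "\<forall>y\<in>W. cinv c y \<in> closure \<Omega> \<longrightarrow> F y = \<phi> 0 (cinv c y) \<and> \<Phi> y = phidot (cinv c y)"
    "\<forall>y\<in>W. y $ k = 0 \<longrightarrow> normal_derivative A g \<Omega> (\<phi> 0) (cinv c y) = sqrt (inv_nn c k y) * partial k F y"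
    "\<forall>y\<in>W. y $ k = 0 \<longrightarrow> F y = 0 \<and> (\<forall>i. i \<noteq> k \<longrightarrow> partial i F y = 0)"
proof -
  note c = boundary_chart_A[OF bc]
  have pcl: "p \<in> closure \<Omega>" using p(2) by (simp add: closure_eq)
  have pf: "f 0 p \<in> cdom c" using f_zero[OF pcl] p(1) by simp
  obtain W1 F1 where W1: "open W1" "cmap c p \<in> W1" "W1 \<subseteq> crange c" "\<And>k. Ck_on k W1 F1"
    and F1: "\<And>x. x \<in> W1 \<Longrightarrow> cinv c x \<in> closure \<Omega> \<Longrightarrow> F1 x = \<phi> 0 (cinv c x)"
    using local_extension[OF smooth_\<phi>0 pcl p(1) c] by blast
  obtain W2 F2 where W2: "open W2" "cmap c p \<in> W2" "W2 \<subseteq> crange c" "\<And>k. Ck_on k W2 F2"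
    and F2: "\<And>x. x \<in> W2 \<Longrightarrow> cinv c x \<in> closure \<Omega> \<Longrightarrow> F2 x = curve_derivative (cinv c x)"
    using local_extension[OF smooth_curve_derivative pcl p(1) c] by blast
  obtain W3 F3 where W3: "open W3" "(0, cmap c p) \<in> W3" and W3c: "\<And>t x. (t, x) \<in> W3 \<Longrightarrow> x \<in> crange c" and CF3: "\<And>k. Ck_on k W3 F3"
    and F3: "\<And>t x. (t, x) \<in> W3 \<Longrightarrow> t \<in> I \<Longrightarrow> cinv c x \<in> closure \<Omega> \<Longrightarrow> f t (cinv c x) \<in> cdom c \<and> F3 (t, x) = cmap c (f t (cinv c x))"
    using local_family_extension[OF family zero_I pcl p(1) c pf c] unfolding f_zero[OF pcl] by metis
  define W where "W = W1 \<inter> W2 \<inter> {x. (0, x) \<in> W3}"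
  define V where "V = (\<lambda>x. frechet_derivative F3 (at (0, x)) (1, 0))"
  define \<Phi> where "\<Phi> = (\<lambda>x. F2 x - frechet_derivative F1 (at x) (V x))"
  have oW: "open W" unfolding W_def using W1(1) W2(1) Ck_on_velocity(1)[OF W3(1) CF3] by blast
  have CV: "Ck_on 2 W V" unfolding V_def
    by (rule Ck_on_subset[OF Ck_on_velocity(2)[OF W3(1) CF3]]) (auto simp: W_def)
  have sub: "W \<subseteq> W1" "W \<subseteq> W2" by (auto simp: W_def)
  have CF1: "Ck_on j W F1" and CF2: "Ck_on j W F2" for j
    by (rule Ck_on_subset[OF W1(4) sub(1)] Ck_on_subset[OF W2(4) sub(2)])+
  have C\<Phi>: "Ck_on 2 W \<Phi>" unfolding \<Phi>_def by (intro Ck_on_diff oW CF2 Ck_on_frechet'[OF oW CF1 CV])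
  have Wc: "W \<subseteq> crange c" using W1(3) by (auto simp: W_def)
  have vel: "velocity c (cinv c y) = V y" "((\<lambda>\<epsilon>. cmap c (f \<epsilon> (cinv c y))) has_vector_derivative V y) (at 0)"
    "\<forall>\<^sub>F \<epsilon> in at 0. f \<epsilon> (cinv c y) \<in> cdom c"
    if "y \<in> W" "cinv c y \<in> closure \<Omega>" for y
  proof -
    have y3: "(0, y) \<in> W3" using that(1) by (simp add: W_def)
    note fv = family_velocity[OF W3(1) y3 CF3 F3 that(2)]
    show "velocity c (cinv c y) = V y" "((\<lambda>\<epsilon>. cmap c (f \<epsilon> (cinv c y))) has_vector_derivative V y) (at 0)"
      "\<forall>\<^sub>F \<epsilon> in at 0. f \<epsilon> (cinv c y) \<in> cdom c"
      using fv unfolding V_def by blast+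
  qed
  have fr: "cinv c y \<in> frontier \<Omega>" "cinv c y \<in> closure \<Omega>" "cinv c y \<in> cdom c" "cmap c (cinv c y) = y" "y \<in> crange c"
    if "y \<in> W" "y $ k = 0" for y
    using boundary_cinv(2,3)[OF bc, of y] cinv_cdom[of y c] cmap_cinv[of y c] that Wc by (auto simp: subset_iff)
  have F10: "F1 y = 0" if "y \<in> W" "y $ k = 0" for y
  proof -
    have "F1 y = \<phi> 0 (cinv c y)" using F1[OF _ fr(2)[OF that]] that(1) by (simp add: W_def)
    also have "\<dots> = 0" using dirichlet[OF zero_I] fr(1)[OF that] unfolding f_zero_image by blast
    finally show ?thesis .
  qed
  have grad: "frechet_derivative F1 (at y) v = v $ k * partial k F1 y" "i \<noteq> k \<Longrightarrow> partial i F1 y = 0"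
    if "y \<in> W" "y $ k = 0" for y v i
    using hyperplane_gradient[OF oW that CF1 F10] by blast+
  have nd: "normal_derivative A g \<Omega> (\<phi> 0) (cinv c y) = sqrt (inv_nn c k y) * partial k F1 y"
    if "y \<in> W" "y $ k = 0" for y
  proof -
    note fr = fr[OF that]
    have y1: "cmap c (cinv c y) \<in> W1" using that(1) fr(4) by (simp add: W_def)
    have "normal_derivative A g \<Omega> (\<phi> 0) (cinv c y) =
      frechet_derivative F1 (at (cmap c (cinv c y))) (unit_normal c k (cmap c (cinv c y)))"
      by (rule normal_derivative_boundary_chart[OF bc fr(3,1) W1(1) y1 W1(4)]) (rule F1)
    then show ?thesis unfolding fr(4) grad(1)[OF that] unit_normal_nth[OF c fr(5)] .
  qed
  have \<Phi>: "\<Phi> y = phidot (cinv c y)" if y: "y \<in> W" "cinv c y \<in> closure \<Omega>" for y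
  proof (cases "y $ k < 0")
    case True
    have yr: "y \<in> crange c" using y(1) Wc by blast
    have yd: "y \<in> chart_dom c" using boundary_cinv(1)[OF bc yr] True yr by (simp add: chart_dom_def)
    have N: "open (W \<inter> chart_dom c)" "y \<in> W \<inter> chart_dom c" using oW open_chart_dom[OF c] y(1) yd by auto
    have "frechet_derivative F1 (at y) = frechet_derivative (\<lambda>y. \<phi> 0 (cinv c y)) (at y)"
      by (rule frechet_derivative_cong_open[OF N]) (use F1 chart_domD(3) in \<open>auto simp: W_def\<close>)
    moreover have "F2 y = curve_derivative (cinv c y)" using F2[OF _ y(2)] y(1) by (simp add: W_def)
    ultimately show ?thesis unfolding phidot_interior[OF c yd] \<Phi>_def vel(1)[OF y] by simp
  next
    case False
    have yr: "y \<in> crange c" using y(1) Wc by blast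
    have yk: "y $ k = 0" using boundary_cinv(2)[OF bc yr] y(2) False by simp
    note fr = fr[OF y(1) yk]
    have "F2 y = 0" using F2[OF _ y(2)] y(1) curve_derivative_frontier[OF fr(1)] by (simp add: W_def)
    then have "\<Phi> y = - (V y $ k * partial k F1 y)" unfolding \<Phi>_def grad(1)[OF y(1) yk] by simp
    moreover have "normal_velocity A g \<Omega> f (cinv c y) = V y $ k / sqrt (inv_nn c k y)"
      using normal_velocity_boundary_chart[where f = f, OF bc fr(3,1) vel(2)[OF y] f_zero[OF y(2)] vel(3)[OF y]] unfolding fr(4) .
    moreover have "cinv c y \<notin> \<Omega>" using boundary_cinv(1)[OF bc yr] yk by simp
    moreover have "0 < sqrt (inv_nn c k y)" using inv_nn_pos[OF c yr, of k] by simp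
    ultimately show ?thesis unfolding phidot_def nd[OF y(1) yk] by simp
  qed
  show ?thesis
  proof (rule that[of W F1 \<Phi>])
    show "cmap c p \<in> W" using W1(2) W2(2) W3(2) by (simp add: W_def)
    show "\<forall>y\<in>W. cinv c y \<in> closure \<Omega> \<longrightarrow> F1 y = \<phi> 0 (cinv c y) \<and> \<Phi> y = phidot (cinv c y)"
      using F1 \<Phi> by (auto simp: W_def)
    show "\<forall>y\<in>W. y $ k = 0 \<longrightarrow> normal_derivative A g \<Omega> (\<phi> 0) (cinv c y) = sqrt (inv_nn c k y) * partial k F1 y"
      using nd by blast
    show "\<forall>y\<in>W. y $ k = 0 \<longrightarrow> F1 y = 0 \<and> (\<forall>i. i \<noteq> k \<longrightarrow> partial i F1 y = 0)"
      using F10 grad(2) by blast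
  qed (rule oW Wc CF1 C\<Phi>)+
qed

section \<open>Green's identity with a cut-off\<close>

lemma measurable_chart_fun:
  assumes c: "c \<in> A" and k: "(k :: real^'n \<Rightarrow> real) \<in> borel_measurable borel"
  shows "(\<lambda>p. if p \<in> cdom c then k (cmap c p) else 0) \<in> borel_measurable borel"
proof -
  have [measurable]: "cdom c \<in> sets borel" using open_cdom[OF c] by simp
  have "(\<lambda>p. if p \<in> cdom c then cmap c p else 0) \<in> borel_measurable borel"
    by (intro borel_measurable_continuous_on_if continuous_on_cmap[OF c]) auto
  then have "(\<lambda>p. k (if p \<in> cdom c then cmap c p else 0)) \<in> borel_measurable borel"
    by (rule measurable_compose[OF _ k])
  then have "(\<lambda>p. if p \<in> cdom c then k (if p \<in> cdom c then cmap c p else 0) else 0) \<in> borel_measurable borel"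
    by measurable
  then show ?thesis by (simp cong: if_cong)
qed

definition C1_fun :: "('m \<Rightarrow> real) \<Rightarrow> bool" where
  "C1_fun \<eta> \<longleftrightarrow> (\<forall>c\<in>A. Ck_on 1 (crange c) (\<lambda>y. \<eta> (cinv c y)))"

text \<open>The divergence of \<open>\<eta> (phidot grad \<phi> - \<phi> grad phidot)\<close> on
  \<Omega>: the two equations eliminate the Laplacians, the terms with \<open>\<Lambda> 0\<close>
  cancel and \<open>\<Lambda>' \<eta> \<phi>\<^sup>2\<close> remains.\<close>

definition vol_integrand :: "('m \<Rightarrow> real) \<Rightarrow> 'm \<Rightarrow> real" where
  "vol_integrand \<eta> p = indicator \<Omega> p * (phidot p * dinner (\<phi> 0) \<eta> p - \<phi> 0 p * dinner phidot \<eta> p + \<Lambda>' * \<eta> p * (\<phi> 0 p)\<^sup>2)"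

definition bd_integrand :: "('m \<Rightarrow> real) \<Rightarrow> 'm \<Rightarrow> real" where
  "bd_integrand \<eta> p = indicator (frontier \<Omega>) p * (\<eta> p * phidot p * normal_derivative A g \<Omega> (\<phi> 0) p)"

text \<open>Green's formula multiplied by a cut-off \<open>\<eta>\<close>. The terms with \<open>\<nabla>\<eta>\<close> disappear after summation over a
  partition of unity.\<close>

definition green_identity :: "('m \<Rightarrow> real) \<Rightarrow> bool" where
  "green_identity \<eta> \<longleftrightarrow> integrable vol (vol_integrand \<eta>) \<and> integrable bdvol (bd_integrand \<eta>) \<and>
     (LINT p|vol. vol_integrand \<eta> p) = (LINT p|bdvol. bd_integrand \<eta> p)"

text \<open>A locally constant cut-off has zero differential. This is used off its support and on
  the neighbourhood where it equals 1.\<close>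

lemma dinner_locally_constant:
  assumes N: "open N" "p \<in> N" and \<eta>: "\<And>q. q \<in> N \<Longrightarrow> \<eta> q = k"
  shows "dinner u \<eta> p = 0"
proof -
  define c where "c = chart_at A p"
  have c: "c \<in> A" "p \<in> cdom c" unfolding c_def by (rule chart_at_mem)+
  have o: "open (crange c \<inter> cinv c -` N)" by (rule continuous_open_preimage[OF continuous_on_cinv[OF c(1)] open_crange[OF c(1)] N(1)])
  have "cmap c p \<in> crange c \<inter> cinv c -` N" using c N(2) cinv_cmap by auto
  from partial_cong[OF o this, of "\<lambda>y. \<eta> (cinv c y)" "\<lambda>_. k"] \<eta>
  have "partial i (\<lambda>y. \<eta> (cinv c y)) (cmap c p) = 0" for i by (simp add: partial_def)
  then show ?thesis unfolding dinner_def Let_def c_def[symmetric] by (simp add: inner_vec_def)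
qed

text \<open>Common to interior and boundary charts: the intrinsic integral over \<Omega> becomes a
  coordinate integral of a divergence, and only the evaluation of the latter differs. The extensions
  \<open>F\<close> and \<open>\<Phi>\<close> have to agree with the true functions on \<Omega>
  alone.\<close>

lemma local_volume_identity:
  assumes c: "c \<in> A" and W: "open W" "W \<subseteq> crange c" and K: "compact K" "K \<subseteq> W"
    and F: "Ck_on 2 W F" and \<Phi>: "Ck_on 2 W \<Phi>"
    and agree: "\<forall>y\<in>W. cinv c y \<in> \<Omega> \<longrightarrow> F y = \<phi> 0 (cinv c y) \<and> \<Phi> y = phidot (cinv c y)"
    and \<eta>: "C1_fun \<eta>" and supp: "\<forall>p. p \<notin> cinv c ` K \<longrightarrow> \<eta> p = 0"
  defines "Y \<equiv> (\<lambda>j y. \<eta> (cinv c y) * (\<Phi> y * flux c F y j - F y * flux c \<Phi> y j))"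
  shows "Ck_on 1 W (Y j)" and "\<And>y. y \<in> W \<Longrightarrow> y \<notin> K \<Longrightarrow> Y j y = 0"
    and "integrable vol (vol_integrand \<eta>)"
    and "(LINT p|vol. vol_integrand \<eta> p) =
      (LINT x|lborel. indicator (chart_dom c) x * (indicator W x * (\<Sum>j\<in>UNIV. partial j (Y j) x)))"
proof -
  note \<eta>0 = supp[rule_format]
  let ?\<eta> = "\<lambda>y. \<eta> (cinv c y)"
  have C\<eta>: "Ck_on 1 W ?\<eta>" using Ck_on_subset[OF _ W(2)] \<eta> c unfolding C1_fun_def by blast
  have fl: "Ck_on 1 W (\<lambda>y. flux c F y j)" "Ck_on 1 W (\<lambda>y. flux c \<Phi> y j)" for j
    using Ck_on_flux[OF c W, of 1] F \<Phi> by (simp_all add: numeral_2_eq_2)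
  have F1: "Ck_on 1 W F" "Ck_on 1 W \<Phi>" using Ck_on_mono[OF F, of 1] Ck_on_mono[OF \<Phi>, of 1] by simp_all
  show CY: "Ck_on 1 W (Y j)" for j unfolding Y_def by (intro Ck_on_mult Ck_on_diff W C\<eta> fl F1)
  have \<eta>K: "?\<eta> y = 0" if "y \<in> crange c" "y \<notin> K" for y
  proof (rule \<eta>0)
    show "cinv c y \<notin> cinv c ` K"
    proof
      assume "cinv c y \<in> cinv c ` K"
      then obtain z where z: "z \<in> K" "cinv c y = cinv c z" by blast
      then have "cmap c (cinv c y) = cmap c (cinv c z)" by simp
      then show False using cmap_cinv[OF that(1)] cmap_cinv[of z c] z K W that(2) by auto
    qed
  qed
  show Y0: "Y j y = 0" if "y \<in> W" "y \<notin> K" for j y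
    using \<eta>K[of y] that W(2) by (auto simp: Y_def)
  \<comment> \<open>The coordinate density. \<open>vol_integrand\<close> is shown to be its quotient
    by the volume weight, which gives both its measurability and its integral.\<close>
  define num where "num = (\<lambda>x. indicator (chart_dom c) x * (indicator W x * (\<Sum>j\<in>UNIV. partial j (Y j) x)))"
  have Kcl: "closed (cinv c ` K)"
    by (intro compact_imp_closed compact_continuous_image continuous_on_subset[OF continuous_on_cinv[OF c]])
      (use K W in auto)
  have cs: "continuous_on W (\<lambda>x. \<Sum>j\<in>UNIV. partial j (Y j) x)"
    using Ck_on_partial[of 0 W] CY by (intro continuous_intros) simp
  have pY0: "partial j (Y j) x = 0" if "x \<in> W" "x \<notin> K" for j x
  proof -
    have "open (W - K)" using W(1) K(1) by (simp add: open_Diff compact_imp_closed)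
    from partial_cong[OF this, of x "Y j" "\<lambda>_. 0" j] show ?thesis using that Y0 by (simp add: partial_def)
  qed
  have i1: "integrable lborel (\<lambda>x. indicator W x * (\<Sum>j\<in>UNIV. partial j (Y j) x))"
    by (rule integrable_compactly_supported[OF K cs]) (simp add: pY0)
  have bd: "chart_dom c \<in> sets borel" using open_chart_dom[OF c] by simp
  have inum: "integrable lborel num" unfolding num_def
    using integrable_mult_indicator[of "chart_dom c" lborel, OF _ i1] bd by simp
  have H: "vol_integrand \<eta> p = (if p \<in> cdom c then num (cmap c p) / vol_weight c (cmap c p) else 0)" for p
  proof (cases "p \<in> cinv c ` K")
    case False
    have "open (- cinv c ` K)" using Kcl by (simp add: open_Compl)
    then have z: "dinner u \<eta> p = 0" for u by (rule dinner_locally_constant) (use False \<eta>0 in auto)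
    have "num (cmap c p) = 0" if "p \<in> cdom c"
    proof -
      have "cmap c p \<notin> K" using False cinv_cmap[OF c that] by (metis imageI)
      then show ?thesis by (cases "cmap c p \<in> W") (simp_all add: num_def pY0)
    qed
    then show ?thesis using \<eta>0[OF False] z by (simp add: vol_integrand_def)
  next
    case True
    then obtain x where x: "x \<in> K" "p = cinv c x" by blast
    have xW: "x \<in> W" and xr: "x \<in> crange c" using x(1) K W by auto
    have pc: "p \<in> cdom c" "cmap c p = x" using cinv_cdom[OF xr] cmap_cinv[OF xr] x(2) by simp_all
    show ?thesis
    proof (cases "p \<in> \<Omega>")
      case False
      then have "x \<notin> chart_dom c" using x(2) by (simp add: chart_dom_def)
      then show ?thesis using False pc by (simp add: vol_integrand_def num_def)
    next
      case True
      then have xd: "x \<in> chart_dom c" using xr x(2) by (simp add: chart_dom_def)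
      let ?N = "W \<inter> chart_dom c"
      have N: "open ?N" "x \<in> ?N" using W(1) open_chart_dom[OF c] xW xd by auto
      have FN: "F y = \<phi> 0 (cinv c y)" "\<Phi> y = phidot (cinv c y)" if "y \<in> ?N" for y
        using agree that chart_domD(2)[of y c] by auto
      have lF: "lapd c F x = - (sqrt (det (g c x)) * (\<Lambda> 0 * \<phi> 0 p))"
        using lapd_cong[OF N FN(1)] lapd_eigen[OF zero_I c xr] True x(2) by (simp add: f_zero_image)
      have l\<Phi>: "lapd c \<Phi> x = - (sqrt (det (g c x)) * (\<Lambda> 0 * phidot p + \<Lambda>' * \<phi> 0 p))"
        using lapd_cong[OF N FN(2)] linearised_equation[OF c xd] x(2) by simp
      have d\<eta>: "?\<eta> differentiable (at (cmap c p))" using Ck_on_differentiable[OF C\<eta> _ xW] pc(2) by simp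
      have dF: "(\<lambda>y. \<phi> 0 (cinv c y)) differentiable (at (cmap c p))"
        using Ck_on_differentiable[OF Ck_on_closure_fun[OF smooth_\<phi>0 c, of 1] _ xd] pc(2) by simp
      have d\<Phi>: "(\<lambda>y. phidot (cinv c y)) differentiable (at (cmap c p))"
        using Ck_on_differentiable[OF Ck_on_phidot[OF c, of 1] _ xd] pc(2) by simp
      have e1: "(\<Sum>j\<in>UNIV. partial j ?\<eta> x * flux c F x j) = sqrt (det (g c x)) * dinner (\<phi> 0) \<eta> p"
        using dinner_chart[OF c pc(1) dF d\<eta>] flux_cong[OF N FN(1)] pc(2) by simp
      have e2: "(\<Sum>j\<in>UNIV. partial j ?\<eta> x * flux c \<Phi> x j) = sqrt (det (g c x)) * dinner phidot \<eta> p"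
        using dinner_chart[OF c pc(1) d\<Phi> d\<eta>] flux_cong[OF N FN(2)] pc(2) by simp
      have "(\<Sum>j\<in>UNIV. partial j (Y j) x) =
        sqrt (det (g c x)) * (phidot p * dinner (\<phi> 0) \<eta> p - \<phi> 0 p * dinner phidot \<eta> p + \<Lambda>' * \<eta> p * (\<phi> 0 p)\<^sup>2)"
        unfolding Y_def divergence_green[OF c W F \<Phi> C\<eta> xW] e1 e2 lF l\<Phi> FN[OF N(2)] x(2)[symmetric]
        by (simp add: algebra_simps power2_eq_square)
      moreover have "0 < sqrt (det (g c x))" using det_metric_pos[OF c xr] by simp
      ultimately show ?thesis using pc xW xd xr True by (simp add: vol_integrand_def num_def vol_weight_def)
    qed
  qed
  have mH: "vol_integrand \<eta> \<in> borel_measurable borel"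
  proof -
    have "num \<in> borel_measurable borel" using inum by auto
    then have "(\<lambda>x. num x / vol_weight c x) \<in> borel_measurable borel" using measurable_vol_weight[OF c] by measurable
    from measurable_chart_fun[OF c this] show ?thesis unfolding H[abs_def] .
  qed
  have "vol_weight c x * vol_integrand \<eta> (cinv c x) = num x" for x
  proof (cases "x \<in> crange c")
    case True
    then have "vol_weight c x \<noteq> 0" using det_metric_pos[OF c True] by (simp add: vol_weight_def)
    then show ?thesis using cinv_cdom[OF True] cmap_cinv[OF True] by (simp add: H)
  qed (use W(2) in \<open>auto simp: vol_weight_def num_def indicator_def\<close>)
  then have eq: "(\<lambda>x. vol_weight c x * vol_integrand \<eta> (cinv c x)) = num" by (rule ext)
  have out: "vol_integrand \<eta> p = 0" if "p \<notin> cdom c" for p using that by (simp add: H)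
  show "integrable vol (vol_integrand \<eta>)"
    using integral_vol(1)[OF c mH out] inum unfolding eq by blast
  show "(LINT p|vol. vol_integrand \<eta> p) = (LINT x|lborel. indicator (chart_dom c) x * (indicator W x * (\<Sum>j\<in>UNIV. partial j (Y j) x)))"
    using integral_vol(2)[OF c mH out] unfolding eq num_def .
qed

lemma flux_hyperplane:
  assumes "\<And>i. i \<noteq> k \<Longrightarrow> partial i F y = 0"
  shows "flux c F y k = sqrt (det (g c y)) * (inv_nn c k y * partial k F y)"
proof -
  have "(matrix_inv (g c y) *v (\<chi> j. partial j F y)) $ k = (\<Sum>j\<in>UNIV. matrix_inv (g c y) $ k $ j * partial j F y)"
    by (simp add: matrix_vector_mult_def)
  also have "\<dots> = matrix_inv (g c y) $ k $ k * partial k F y"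
    by (subst sum.remove[of _ k]) (use assms in auto)
  finally show ?thesis unfolding flux_def inv_nn_def by simp
qed

text \<open>Matching of densities at the boundary: the normal flux in coordinates,
  \<open>sqrt (det g) g^kk \<partial>_k F\<close>, is the induced density times the normal
  derivative \<open>sqrt (g^kk) \<partial>_k F\<close>.\<close>

lemma sqrt_det_induced_gram:
  assumes c: "c \<in> A" and y: "y \<in> crange c"
  shows "sqrt (det (induced_gram k (g c y))) * (sqrt (inv_nn c k y) * t) = sqrt (det (g c y)) * (inv_nn c k y * t)"
proof -
  have p: "0 < inv_nn c k y" by (rule inv_nn_pos[OF c y])
  have "det (induced_gram k (g c y)) = det (g c y) * inv_nn c k y"
    unfolding inv_nn_def using det_metric_pos[OF c y] by (intro det_induced_gram) simp
  then have "sqrt (det (induced_gram k (g c y))) * sqrt (inv_nn c k y) = sqrt (det (g c y)) * (sqrt (inv_nn c k y) * sqrt (inv_nn c k y))"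
    by (simp only: real_sqrt_mult mult.assoc)
  also have "sqrt (inv_nn c k y) * sqrt (inv_nn c k y) = inv_nn c k y" using p by simp
  finally show ?thesis by (simp only: mult.assoc[symmetric])
qed

text \<open>On the hyperplane the extension \<open>F\<close> of the Dirichlet eigenfunction
  vanishes, so of the two flux terms in \<open>Y\<close> only the one with \<open>\<Phi>\<close>
  survives; \<open>sqrt_det_induced_gram\<close> matches it with the boundary integrand.\<close>

lemma green_identity_boundary:
  assumes bc: "boundary_chart A \<Omega> c k" and W: "open W" "W \<subseteq> crange c" and K: "compact K" "K \<subseteq> W"
    and F: "Ck_on 2 W F" and \<Phi>: "Ck_on 2 W \<Phi>"
    and cl: "\<forall>y\<in>W. cinv c y \<in> closure \<Omega> \<longrightarrow> F y = \<phi> 0 (cinv c y) \<and> \<Phi> y = phidot (cinv c y)"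
    and nd: "\<forall>y\<in>W. y $ k = 0 \<longrightarrow> normal_derivative A g \<Omega> (\<phi> 0) (cinv c y) = sqrt (inv_nn c k y) * partial k F y"
    and F0: "\<forall>y\<in>W. y $ k = 0 \<longrightarrow> F y = 0 \<and> (\<forall>i. i \<noteq> k \<longrightarrow> partial i F y = 0)"
    and \<eta>: "C1_fun \<eta>" and supp: "\<forall>p. p \<notin> cinv c ` K \<longrightarrow> \<eta> p = 0"
  shows "green_identity \<eta>"
proof -
  note c = boundary_chart_A[OF bc]
  define Y where "Y = (\<lambda>j y. \<eta> (cinv c y) * (\<Phi> y * flux c F y j - F y * flux c \<Phi> y j))"
  have agree: "\<forall>y\<in>W. cinv c y \<in> \<Omega> \<longrightarrow> F y = \<phi> 0 (cinv c y) \<and> \<Phi> y = phidot (cinv c y)"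
    using cl closure_subset by blast
  note \<eta>0 = supp[rule_format]
  note lv = local_volume_identity[OF c W K F \<Phi> agree \<eta> supp]
  have Y: "Ck_on 1 W (Y j)" for j unfolding Y_def by (rule lv(1))
  have Y0: "Y j y = 0" if "y \<in> W" "y \<notin> K" for j y unfolding Y_def by (rule lv(2)[OF that])
  have dom: "indicator (chart_dom c) x * (indicator W x * s) = indicator {x. x $ k < 0} x * (indicator W x * (s::real))" for x s
    using boundary_cinv(1)[OF bc, of x] W(2) by (auto simp: chart_dom_def indicator_def)
  have vol: "(LINT p|vol. vol_integrand \<eta> p) =
     (LINT x|lborel. indicator {x. 0 < x $ k \<and> x $ k < 1} x * (indicator W (hyper_proj k x) * Y k (hyper_proj k x)))"
    unfolding lv(4) dom Y_def[symmetric, THEN fun_cong, THEN fun_cong]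
    by (rule half_space_divergence[of W K Y]; (fact W(1) K Y | (rule Y0; assumption)))
  have int: "integrable lborel (\<lambda>x. indicator {x. 0 < x $ k \<and> x $ k < 1} x * (indicator W (hyper_proj k x) * Y k (hyper_proj k x)))"
    by (rule half_space_boundary_integrable[of W K Y]; (fact W(1) K Y | (rule Y0; assumption)))
  have wK: "cinv c y \<notin> cinv c ` K" if "y \<in> crange c" "y \<notin> K" for y
  proof
    assume "cinv c y \<in> cinv c ` K"
    then obtain z where z: "z \<in> K" "cinv c y = cinv c z" by blast
    then have "cmap c (cinv c y) = cmap c (cinv c z)" by simp
    moreover have "z \<in> crange c" using z(1) K(2) W(2) by blast
    ultimately show False using cmap_cinv[OF that(1)] cmap_cinv[of z c] z(1) that(2) by simp
  qed
  \<comment> \<open>The boundary integrand in coordinates, restricted to a closed subset of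
    \<open>K\<close>. Continuity on that set gives Borel measurability, although
    \<open>normal_derivative\<close> is defined through an arbitrary chart at each point.\<close>
  define h where "h = (\<lambda>z. if z \<in> K \<inter> {z. z $ k = 0} then \<eta> (cinv c z) * \<Phi> z * (sqrt (inv_nn c k z) * partial k F z) else 0)"
  have bd: "bd_integrand \<eta> p = (if p \<in> cdom c then h (cmap c p) else 0)" for p
  proof (cases "p \<in> cdom c")
    case True
    have y: "cmap c p \<in> crange c" "cinv c (cmap c p) = p" using True cinv_cmap[OF c] by auto
    show ?thesis
    proof (cases "cmap c p \<in> K")
      case False
      then have "p \<notin> cinv c ` K" using wK[OF y(1)] y(2) by simp
      then show ?thesis using \<eta>0 False by (simp add: bd_integrand_def h_def)
    next
      case K': True
      then have "cmap c p \<in> W" by (rule subsetD[OF K(2)])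
      note * = cl[rule_format, OF this] nd[rule_format, OF this]
      have fr: "p \<in> frontier \<Omega> \<longleftrightarrow> cmap c p $ k = 0" by (rule boundary_chart_frontier[OF bc True])
      show ?thesis
      proof (cases "p \<in> frontier \<Omega>")
        case fp: True
        then have "p \<in> closure \<Omega>" by (simp add: closure_eq)
        then have "\<Phi> (cmap c p) = phidot p" using *(1) y(2) by simp
        then show ?thesis using True K' fp fr *(2) y(2) by (simp add: bd_integrand_def h_def)
      qed (use fr True in \<open>simp add: bd_integrand_def h_def\<close>)
    qed
  next
    case False
    have "p \<notin> cinv c ` K"
    proof
      assume "p \<in> cinv c ` K"
      then obtain z where "z \<in> K" "p = cinv c z" by blast
      then show False using False cinv_cdom[of z c] K(2) W(2) by auto
    qed
    then show ?thesis using \<eta>0 False by (simp add: bd_integrand_def)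
  qed
  have hm: "h \<in> borel_measurable borel" unfolding h_def
  proof (rule borel_measurable_continuous_on_if)
    have cl: "closed (K \<inter> {z. z $ k = 0})"
      using K(1) by (intro closed_Int compact_imp_closed closed_Collect_eq continuous_intros) auto
    then show "K \<inter> {z. z $ k = 0} \<in> sets borel" by simp
    have sub: "K \<inter> {z. z $ k = 0} \<subseteq> W" by (rule le_infI1[OF K(2)])
    have c\<eta>: "continuous_on W (\<lambda>z. \<eta> (cinv c z))"
      by (rule continuous_on_subset[OF Ck_on_continuous[OF \<eta>[unfolded C1_fun_def, rule_format, OF c]] W(2)])
    have cp: "continuous_on W (partial k F)"
      using Ck_on_partial[of 0 W F] Ck_on_mono[OF F, of 1] by simp
    have ci: "continuous_on W (inv_nn c k)"
      unfolding inv_nn_def[abs_def] by (rule continuous_on_subset[OF Ck_on_continuous[OF Ck_on_inverse_metric[OF c, of 0]] W(2)])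
    have "continuous_on W (\<lambda>z. \<eta> (cinv c z) * \<Phi> z * (sqrt (inv_nn c k z) * partial k F z))"
      by (intro continuous_intros c\<eta> cp ci Ck_on_continuous[OF \<Phi>])
    then show "continuous_on (K \<inter> {z. z $ k = 0}) (\<lambda>z. \<eta> (cinv c z) * \<Phi> z * (sqrt (inv_nn c k z) * partial k F z))"
      by (rule continuous_on_subset) (rule sub)
  qed auto
  have mb: "bd_integrand \<eta> \<in> borel_measurable borel"
    using measurable_chart_fun[OF c hm] unfolding bd[abs_def] .
  have out: "bd_integrand \<eta> p = 0" if "p \<notin> cdom c" for p using that by (simp add: bd)
  have eq: "bd_weight c k x * bd_integrand \<eta> (bd_map c k x) =
     indicator {x. 0 < x $ k \<and> x $ k < 1} x * (indicator W (hyper_proj k x) * Y k (hyper_proj k x))" for x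
  proof (cases "0 < x $ k \<and> x $ k < 1")
    case True
    let ?z = "hyper_proj k x"
    have zk: "?z $ k = 0" by (simp add: insert_zero_def)
    show ?thesis
    proof (cases "?z \<in> K")
      case False
      have "bd_weight c k x = 0 \<or> bd_integrand \<eta> (bd_map c k x) = 0"
        using False cmap_cinv[of ?z c] by (cases "?z \<in> crange c") (auto simp: bd_weight_def bd h_def bd_map_def)
      moreover have "indicator W ?z * Y k ?z = 0"
      proof (cases "?z \<in> W")
        case True
        show ?thesis unfolding Y0[OF True False] by simp
      qed simp
      ultimately show ?thesis by (elim disjE) (simp_all only: mult_zero_left mult_zero_right)
    next
      case K': True
      then have zW: "?z \<in> W" and zr: "?z \<in> crange c" using K(2) W(2) by blast+
      have "bd_integrand \<eta> (bd_map c k x) = \<eta> (cinv c ?z) * \<Phi> ?z * (sqrt (inv_nn c k ?z) * partial k F ?z)"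
        unfolding bd bd_map_def using cinv_cdom[OF zr] cmap_cinv[OF zr] K' zk by (simp add: h_def)
      moreover have "bd_weight c k x = sqrt (det (induced_gram k (g c ?z)))" using True zr by (simp add: bd_weight_def)
      moreover have "flux c F ?z k = sqrt (det (g c ?z)) * (inv_nn c k ?z * partial k F ?z)"
        using F0 zW zk by (intro flux_hyperplane) blast
      moreover have "F ?z = 0" using F0 zW zk by blast
      ultimately show ?thesis using True zW sqrt_det_induced_gram[OF c zr, of k 1] by (simp add: Y_def mult_ac)
    qed
  qed (auto simp: bd_weight_def)
  have I: "integrable bdvol (bd_integrand \<eta>) \<longleftrightarrow> integrable lborel (\<lambda>x. bd_weight c k x * bd_integrand \<eta> (bd_map c k x))"
    "(LINT p|bdvol. bd_integrand \<eta> p) = (LINT x|lborel. bd_weight c k x * bd_integrand \<eta> (bd_map c k x))"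
    by (rule integral_bdvol[OF bc mb]; rule out; assumption)+
  show ?thesis unfolding green_identity_def
  proof (intro conjI)
    show "integrable vol (vol_integrand \<eta>)" by (rule lv(3))
    show "integrable bdvol (bd_integrand \<eta>)" unfolding I(1) eq by (rule int)
    show "(LINT p|vol. vol_integrand \<eta> p) = (LINT p|bdvol. bd_integrand \<eta> p)"
      unfolding I(2) eq by (rule vol)
  qed
qed

text \<open>\<open>K\<close> does not meet the boundary hypersurface: the divergence integrates to 0
  and the cut-off annihilates the boundary integrand.\<close>

lemma green_identity_interior:
  assumes c: "c \<in> A" and K: "compact K" "K \<subseteq> chart_dom c"
    and \<eta>: "C1_fun \<eta>" and supp: "\<forall>p. p \<notin> cinv c ` K \<longrightarrow> \<eta> p = 0"
  shows "green_identity \<eta>"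
proof -
  let ?F = "\<lambda>y. \<phi> 0 (cinv c y)" and ?\<Phi> = "\<lambda>y. phidot (cinv c y)"
  define Y where "Y = (\<lambda>j y. \<eta> (cinv c y) * (?\<Phi> y * flux c ?F y j - ?F y * flux c ?\<Phi> y j))"
  have W: "open (chart_dom c)" "chart_dom c \<subseteq> crange c" using open_chart_dom[OF c] chart_domD(1) by blast+
  have agree: "\<forall>y\<in>chart_dom c. cinv c y \<in> \<Omega> \<longrightarrow> ?F y = \<phi> 0 (cinv c y) \<and> ?\<Phi> y = phidot (cinv c y)" by blast
  note lv = local_volume_identity[OF c W K Ck_on_closure_fun[OF smooth_\<phi>0 c] Ck_on_phidot[OF c] agree \<eta> supp]
  have Y: "Ck_on 1 (chart_dom c) (Y j)" for j unfolding Y_def by (rule lv(1))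
  have Y0: "Y j y = 0" if "y \<in> chart_dom c" "y \<notin> K" for j y unfolding Y_def by (rule lv(2)[OF that])
  have "indicator (chart_dom c) x * (indicator (chart_dom c) x * s) = indicator (chart_dom c) x * (s::real)" for x s
    by (simp add: indicator_def)
  note ind = this
  have vol: "(LINT p|vol. vol_integrand \<eta> p) = 0"
    unfolding lv(4) ind Y_def[symmetric, THEN fun_cong, THEN fun_cong]
    by (rule divergence_compact_support[of "chart_dom c" K Y]; (fact W(1) K Y | (rule Y0; assumption)))
  have "bd_integrand \<eta> p = 0" for p
  proof (cases "p \<in> frontier \<Omega>")
    case True
    then have "p \<notin> \<Omega>" using open_\<Omega> by (simp add: frontier_def interior_open)
    then have "p \<notin> cinv c ` K" using K(2) chart_domD(2) by blast
    then show ?thesis using supp by (simp add: bd_integrand_def)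
  qed (simp add: bd_integrand_def)
  then have "bd_integrand \<eta> = (\<lambda>_. 0)" by (rule ext)
  then show ?thesis using vol lv(3) by (simp add: green_identity_def)
qed

section \<open>Globalisation\<close>

lemma C1_fun_const: "C1_fun (\<lambda>_. k)"
  unfolding C1_fun_def by (blast intro: Ck_on_const)

lemma C1_fun_mult: "C1_fun u \<Longrightarrow> C1_fun w \<Longrightarrow> C1_fun (\<lambda>p. u p * w p)"
  unfolding C1_fun_def by (auto intro!: Ck_on_mult open_crange simp del: Ck_on.simps One_nat_def)

lemma C1_fun_diff: "C1_fun u \<Longrightarrow> C1_fun w \<Longrightarrow> C1_fun (\<lambda>p. u p - w p)"
  unfolding C1_fun_def by (auto intro!: Ck_on_diff open_crange simp del: Ck_on.simps One_nat_def)

definition chart_bump :: "('m, 'n) chart \<Rightarrow> real^'n \<Rightarrow> real \<Rightarrow> 'm \<Rightarrow> real" where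
  "chart_bump c a r p = (if p \<in> cdom c then bump a r (cmap c p) else 0)"

lemma chart_bump_eq_0:
  assumes c: "c \<in> A" and r: "0 < r" and p: "p \<notin> cinv c ` cball a r"
  shows "chart_bump c a r p = 0"
proof (cases "p \<in> cdom c")
  case True
  have "cmap c p \<notin> cball a r"
  proof
    assume "cmap c p \<in> cball a r"
    then have "cinv c (cmap c p) \<in> cinv c ` cball a r" by (rule imageI)
    then show False using p cinv_cmap[OF c True] by simp
  qed
  then show ?thesis using bump_eq_0[OF r, of a "cmap c p"] by (simp add: chart_bump_def)
qed (simp add: chart_bump_def)

lemma C1_fun_chart_bump:
  assumes c: "c \<in> A" and r: "0 < r" "cball a r \<subseteq> crange c"
  shows "C1_fun (chart_bump c a r)"
  unfolding C1_fun_def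
proof
  fix c' assume c': "c' \<in> A"
  show "Ck_on 1 (crange c') (\<lambda>y. chart_bump c a r (cinv c' y))"
  proof (rule Ck_on_local)
    fix x assume x: "x \<in> crange c'"
    show "\<exists>U. open U \<and> x \<in> U \<and> Ck_on 1 U (\<lambda>y. chart_bump c a r (cinv c' y))"
    proof (cases "cinv c' x \<in> cdom c")
      case True
      have o: "open (overlap c' c)" by (rule open_overlap[OF c' c])
      have "Ck_on 1 (overlap c' c) (\<lambda>y. bump a r (transition c' c y))"
        by (rule Ck_on_compose[OF o open_UNIV subset_UNIV Ck_on_mono[OF Ck_on_bump] Ck_on_transition[OF c' c]]) simp
      then have "Ck_on 1 (overlap c' c) (\<lambda>y. chart_bump c a r (cinv c' y))"
        by (rule Ck_on_cong[OF o, rotated]) (use overlap_iff[OF c'] in \<open>simp add: chart_bump_def transition_def\<close>)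
      moreover have "x \<in> overlap c' c" using overlap_iff[OF c'] x True by blast
      ultimately show ?thesis using o by blast
    next
      case False
      \<comment> \<open>Near a point outside the chart the bump is 0, because the image of the
        closed ball is compact and hence closed in the Hausdorff space.\<close>
      have "compact (cinv c ` cball a r)"
        by (intro compact_continuous_image continuous_on_subset[OF continuous_on_cinv[OF c] r(2)] compact_cball)
      then have "open (- (cinv c ` cball a r))" by (simp add: compact_imp_closed open_Compl)
      then have o: "open (crange c' \<inter> cinv c' -` (- (cinv c ` cball a r)))" (is "open ?U")
        by (rule continuous_open_preimage[OF continuous_on_cinv[OF c'] open_crange[OF c']])
      have "Ck_on 1 ?U (\<lambda>y. chart_bump c a r (cinv c' y))"
        by (rule Ck_on_cong[OF o _ Ck_on_const[of 1 _ 0]]) (use chart_bump_eq_0[OF c r(1)] in simp)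
      moreover have "cinv c' x \<notin> cinv c ` cball a r"
      proof
        assume "cinv c' x \<in> cinv c ` cball a r"
        then obtain z where "z \<in> cball a r" "cinv c' x = cinv c z" by (rule imageE)
        then show False using False cinv_cdom[OF subsetD[OF r(2), of z]] by simp
      qed
      then have "x \<in> ?U" using x by simp
      ultimately show ?thesis using o by blast
    qed
  qed
qed

lemma dinner_add:
  assumes "C1_fun \<eta>" "C1_fun \<xi>"
  shows "dinner u (\<lambda>p. \<eta> p + \<xi> p) p = dinner u \<eta> p + dinner u \<xi> p"
proof -
  define c where "c = chart_at A p"
  have c: "c \<in> A" "cmap c p \<in> crange c" unfolding c_def using chart_at_mem by blast+
  have "(\<lambda>y. \<eta> (cinv c y)) differentiable (at (cmap c p))" "(\<lambda>y. \<xi> (cinv c y)) differentiable (at (cmap c p))"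
    using assms c unfolding C1_fun_def by (auto dest: Ck_on_differentiable[OF _ _ c(2)])
  then have "partial i (\<lambda>y. \<eta> (cinv c y) + \<xi> (cinv c y)) (cmap c p) =
    partial i (\<lambda>y. \<eta> (cinv c y)) (cmap c p) + partial i (\<lambda>y. \<xi> (cinv c y)) (cmap c p)" for i
    unfolding frechet_derivative_works by (subst partial_eq[OF has_derivative_add]) (auto simp: partial_def)
  then show ?thesis unfolding dinner_def Let_def c_def[symmetric]
    by (simp add: inner_vec_def distrib_right sum.distrib)
qed

lemma green_identity_add:
  assumes C: "C1_fun \<eta>" "C1_fun \<xi>" and G: "green_identity \<eta>" "green_identity \<xi>"
  shows "green_identity (\<lambda>p. \<eta> p + \<xi> p)"
proof -
  have v: "vol_integrand (\<lambda>p. \<eta> p + \<xi> p) = (\<lambda>p. vol_integrand \<eta> p + vol_integrand \<xi> p)"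
    unfolding vol_integrand_def dinner_add[OF C] by (simp add: algebra_simps)
  have b: "bd_integrand (\<lambda>p. \<eta> p + \<xi> p) = (\<lambda>p. bd_integrand \<eta> p + bd_integrand \<xi> p)"
    unfolding bd_integrand_def by (simp add: algebra_simps)
  show ?thesis using G unfolding green_identity_def v b by simp
qed

lemma green_identity_local:
  assumes p: "p \<in> closure \<Omega>"
  obtains c r where "c \<in> A" "p \<in> cdom c" "0 < r" "cball (cmap c p) r \<subseteq> crange c"
    "\<forall>\<eta>. C1_fun \<eta> \<longrightarrow> (\<forall>q. q \<notin> cinv c ` cball (cmap c p) r \<longrightarrow> \<eta> q = 0) \<longrightarrow> green_identity \<eta>"
proof (cases "p \<in> \<Omega>")
  case True
  define c where "c = chart_at A p"
  have c: "c \<in> A" "p \<in> cdom c" unfolding c_def by (rule chart_at_mem)+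
  have "cmap c p \<in> chart_dom c" using c True cinv_cmap by (auto simp: chart_dom_def)
  then obtain r where r: "0 < r" "cball (cmap c p) r \<subseteq> chart_dom c"
    using open_chart_dom[OF c(1)] open_contains_cball by blast
  show ?thesis
  proof (rule that[OF c r(1)])
    show "cball (cmap c p) r \<subseteq> crange c" using r(2) chart_domD(1) by blast
    show "\<forall>\<eta>. C1_fun \<eta> \<longrightarrow> (\<forall>q. q \<notin> cinv c ` cball (cmap c p) r \<longrightarrow> \<eta> q = 0) \<longrightarrow> green_identity \<eta>"
      using green_identity_interior[OF c(1) compact_cball r(2)] by blast
  qed
next
  case False
  then have pf: "p \<in> frontier \<Omega>" using p by (simp add: closure_eq)
  then obtain c k where bc: "boundary_chart A \<Omega> c k" and pc: "p \<in> cdom c" using ex_boundary_chart by blast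
  obtain W F \<Phi> where W: "open W" "cmap c p \<in> W" "W \<subseteq> crange c" and C: "Ck_on 2 W F" "Ck_on 2 W \<Phi>"
    and cl: "\<forall>y\<in>W. cinv c y \<in> closure \<Omega> \<longrightarrow> F y = \<phi> 0 (cinv c y) \<and> \<Phi> y = phidot (cinv c y)"
    and nd: "\<forall>y\<in>W. y $ k = 0 \<longrightarrow> normal_derivative A g \<Omega> (\<phi> 0) (cinv c y) = sqrt (inv_nn c k y) * partial k F y"
    and F0: "\<forall>y\<in>W. y $ k = 0 \<longrightarrow> F y = 0 \<and> (\<forall>i. i \<noteq> k \<longrightarrow> partial i F y = 0)"
    by (rule boundary_extension[OF bc pc pf])
  obtain r where r: "0 < r" "cball (cmap c p) r \<subseteq> W" using W(1,2) open_contains_cball by blast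
  show ?thesis
  proof (rule that[OF boundary_chart_A[OF bc] pc r(1)])
    show "cball (cmap c p) r \<subseteq> crange c" using r(2) W(3) by blast
    show "\<forall>\<eta>. C1_fun \<eta> \<longrightarrow> (\<forall>q. q \<notin> cinv c ` cball (cmap c p) r \<longrightarrow> \<eta> q = 0) \<longrightarrow> green_identity \<eta>"
      using green_identity_boundary[OF bc W(1,3) compact_cball r(2) C cl nd F0] by blast
  qed
qed

text \<open>Chart, centre and radius form one index, so that compactness of the closure can select a
  finite list of balls. The closed ball lies in the chart range, which makes its bump a
  \<open>C^1\<close> function on the whole manifold.\<close>

definition green_ball :: "('m, 'n) chart \<times> (real^'n) \<times> real \<Rightarrow> bool" where
  "green_ball = (\<lambda>(c, a, r). c \<in> A \<and> 0 < r \<and> cball a r \<subseteq> crange c \<and>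
    (\<forall>\<eta>. C1_fun \<eta> \<longrightarrow> (\<forall>q. q \<notin> cinv c ` cball a r \<longrightarrow> \<eta> q = 0) \<longrightarrow> green_identity \<eta>))"

text \<open>Since \<open>1 - \<Prod>(1 - b\<^sub>i) = \<Sum> b\<^sub>i \<Prod>\<^bsub>j<i\<^esub> (1 - b\<^sub>j)\<close>, and the left side is 1 wherever some \<open>b\<^sub>i\<close> is 1, the
  products serve as a partition of unity.\<close>

definition one_minus_bumps :: "(('m, 'n) chart \<times> (real^'n) \<times> real) list \<Rightarrow> 'm \<Rightarrow> real" where
  "one_minus_bumps zs p = (\<Prod>(c, a, r)\<leftarrow>zs. 1 - chart_bump c a r p)"

lemma one_minus_bumps_green:
  assumes "\<forall>z\<in>set zs. green_ball z"
  shows "C1_fun (one_minus_bumps zs)" and "green_identity (\<lambda>p. 1 - one_minus_bumps zs p)"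
proof -
  have "C1_fun (one_minus_bumps zs) \<and> green_identity (\<lambda>p. 1 - one_minus_bumps zs p)"
    using assms
  proof (induction zs)
    case Nil
    have "dinner u (\<lambda>_. 0) p = 0" for u p by (rule dinner_locally_constant[OF open_UNIV UNIV_I]) simp
    then have "vol_integrand (\<lambda>_. 0) = (\<lambda>_. 0)" "bd_integrand (\<lambda>_. 0) = (\<lambda>_. 0)"
      by (auto simp: vol_integrand_def bd_integrand_def)
    then show ?case using C1_fun_const[of 1] by (simp add: one_minus_bumps_def[abs_def] green_identity_def)
  next
    case (Cons z zs)
    obtain c a r where z: "z = (c, a, r)" by (cases z)
    have g: "c \<in> A" "0 < r" "cball a r \<subseteq> crange c"
      and green: "\<And>\<eta>. C1_fun \<eta> \<Longrightarrow> \<forall>q. q \<notin> cinv c ` cball a r \<longrightarrow> \<eta> q = 0 \<Longrightarrow> green_identity \<eta>"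
      using Cons.prems unfolding z green_ball_def by auto
    let ?b = "chart_bump c a r" and ?R = "one_minus_bumps zs"
    have IH: "C1_fun ?R" "green_identity (\<lambda>p. 1 - ?R p)" using Cons by auto
    have Cb: "C1_fun ?b" by (rule C1_fun_chart_bump[OF g])
    have R: "one_minus_bumps (z # zs) = (\<lambda>p. (1 - ?b p) * ?R p)" by (simp add: one_minus_bumps_def[abs_def] z)
    \<comment> \<open>The new summand is supported in the ball of \<open>?b\<close>, whatever
      \<open>?R\<close> is, so the local identity applies to it; it is then added to the identity
      for the shorter list.\<close>
    have "green_identity (\<lambda>p. ?b p * ?R p)"
      by (rule green[OF C1_fun_mult[OF Cb IH(1)]]) (simp add: chart_bump_eq_0[OF g(1,2)])
    then have "green_identity (\<lambda>p. (1 - ?R p) + ?b p * ?R p)"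
      by (intro green_identity_add C1_fun_diff C1_fun_const C1_fun_mult Cb IH)
    moreover have "(\<lambda>p. (1 - ?R p) + ?b p * ?R p) = (\<lambda>p. 1 - (1 - ?b p) * ?R p)" by (simp add: algebra_simps)
    moreover have "C1_fun (\<lambda>p. (1 - ?b p) * ?R p)" by (intro C1_fun_diff C1_fun_const C1_fun_mult Cb IH)
    ultimately show ?case unfolding R by simp
  qed
  then show "C1_fun (one_minus_bumps zs)" "green_identity (\<lambda>p. 1 - one_minus_bumps zs p)" by auto
qed

lemma global_green_identity:
  obtains N \<eta> where "open N" "closure \<Omega> \<subseteq> N" "\<forall>p\<in>N. \<eta> p = 1" "green_identity \<eta>"
proof -
  \<comment> \<open>Half the radius, because there the bump equals 1; a single vanishing factor
    makes the product 0 and the cut-off 1 on the whole union.\<close>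
  define U where "U = (\<lambda>(c :: ('m, 'n) chart, a, r). {p \<in> cdom c. dist a (cmap c p) < r / 2})"
  have oU: "open (U z)" if gz: "green_ball z" for z
  proof -
    obtain c a r where z: "z = (c, a, r)" by (cases z)
    have c: "c \<in> A" using gz by (simp add: green_ball_def z)
    have "open (cdom c \<inter> cmap c -` ball a (r / 2))"
      by (rule continuous_open_preimage[OF continuous_on_cmap[OF c] open_cdom[OF c] open_ball])
    moreover have "U z = cdom c \<inter> cmap c -` ball a (r / 2)" by (auto simp: U_def z)
    ultimately show ?thesis by simp
  qed
  have "closure \<Omega> \<subseteq> \<Union>(U ` {z. green_ball z})"
  proof
    fix p assume "p \<in> closure \<Omega>"
    then obtain c r where c: "c \<in> A" "p \<in> cdom c" "0 < r" "cball (cmap c p) r \<subseteq> crange c"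
      "\<forall>\<eta>. C1_fun \<eta> \<longrightarrow> (\<forall>q. q \<notin> cinv c ` cball (cmap c p) r \<longrightarrow> \<eta> q = 0) \<longrightarrow> green_identity \<eta>"
      by (rule green_identity_local)
    then have "green_ball (c, cmap c p, r)" "p \<in> U (c, cmap c p, r)" by (simp_all add: green_ball_def U_def)
    then show "p \<in> \<Union>(U ` {z. green_ball z})" by blast
  qed
  then obtain Z where Z: "Z \<subseteq> {z. green_ball z}" "finite Z" "closure \<Omega> \<subseteq> \<Union>(U ` Z)"
    using compactE_image[OF compact_closure, of "{z. green_ball z}" U] oU by blast
  obtain zs where zs: "set zs = Z" using finite_list[OF Z(2)] by blast
  show ?thesis
  proof (rule that)
    show "open (\<Union>(U ` Z))" using oU Z(1) by blast
    show "closure \<Omega> \<subseteq> \<Union>(U ` Z)" by (rule Z(3))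
    show "green_identity (\<lambda>p. 1 - one_minus_bumps zs p)"
      by (rule one_minus_bumps_green(2)) (use zs Z(1) in blast)
    show "\<forall>p\<in>\<Union>(U ` Z). 1 - one_minus_bumps zs p = 1"
    proof
      fix p assume "p \<in> \<Union>(U ` Z)"
      then obtain z where z: "z \<in> Z" "p \<in> U z" by blast
      obtain c a r where z': "z = (c, a, r)" by (cases z)
      have "green_ball z" using z(1) Z(1) by blast
      then have "chart_bump c a r p = 1"
        using z(2) bump_eq_1[of r a "cmap c p"] by (simp add: z' U_def green_ball_def chart_bump_def)
      then have "0 \<in> set (map (\<lambda>(c, a, r). 1 - chart_bump c a r p) zs)"
        using z(1) zs by (force simp: z')
      then show "1 - one_minus_bumps zs p = 1" by (simp add: one_minus_bumps_def prod_list_zero_iff)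
    qed
  qed
qed

theorem \<Lambda>'_boundary_integral:
  "\<Lambda>' * (LINT p:\<Omega>|vol. (\<phi> 0 p)\<^sup>2) =
    - (LINT p:frontier \<Omega>|bdvol. normal_velocity A g \<Omega> f p * (normal_derivative A g \<Omega> (\<phi> 0) p)\<^sup>2)"
proof -
  obtain N \<eta> where N: "open N" "closure \<Omega> \<subseteq> N" "\<forall>p\<in>N. \<eta> p = 1" and green: "green_identity \<eta>"
    by (rule global_green_identity)
  have "vol_integrand \<eta> p = \<Lambda>' * (indicator \<Omega> p *\<^sub>R (\<phi> 0 p)\<^sup>2)" for p
  proof (cases "p \<in> \<Omega>")
    case True
    then have p: "p \<in> N" using N(2) closure_subset by blast
    \<comment> \<open>The cut-off is constant near the point, so the gradient terms drop out and
      only \<open>\<Lambda>' \<phi>\<^sup>2\<close> remains.\<close>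
    have "dinner u \<eta> p = 0" for u by (rule dinner_locally_constant[OF N(1) p]) (rule bspec[OF N(3)])
    then show ?thesis using N(3) p by (simp add: vol_integrand_def)
  qed (simp add: vol_integrand_def)
  then have v: "(LINT p|vol. vol_integrand \<eta> p) = \<Lambda>' * (LINT p:\<Omega>|vol. (\<phi> 0 p)\<^sup>2)"
    unfolding set_lebesgue_integral_def by simp
  have "bd_integrand \<eta> p =
      - (indicator (frontier \<Omega>) p *\<^sub>R (normal_velocity A g \<Omega> f p * (normal_derivative A g \<Omega> (\<phi> 0) p)\<^sup>2))" for p
  proof (cases "p \<in> frontier \<Omega>")
    case True
    then have "p \<notin> \<Omega>" using open_\<Omega> by (simp add: frontier_def interior_open)
    moreover have "\<eta> p = 1" by (rule bspec[OF N(3) subsetD[OF N(2)]]) (use True in \<open>simp add: frontier_def\<close>)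
    \<comment> \<open>On the frontier \<open>phidot\<close> is by definition minus the product of
      normal velocity and normal derivative, which gives the square and the sign.\<close>
    ultimately show ?thesis using True by (simp add: bd_integrand_def phidot_def power2_eq_square)
  qed (simp add: bd_integrand_def)
  then have b: "(LINT p|bdvol. bd_integrand \<eta> p) =
      - (LINT p:frontier \<Omega>|bdvol. normal_velocity A g \<Omega> f p * (normal_derivative A g \<Omega> (\<phi> 0) p)\<^sup>2)"
    unfolding set_lebesgue_integral_def by simp
  show ?thesis using green unfolding green_identity_def v b by blast
qed

end

theorem corollary2p1:
  fixes A Or :: "('m::{t2_space,second_countable_topology}, 'n::finite) chart set"
    and g :: "('m, 'n) chart \<Rightarrow> real^'n \<Rightarrow> real^'n^'n"
    and \<Omega> :: "'m set"
    and I :: "real set"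
    and f :: "real \<Rightarrow> 'm \<Rightarrow> 'm"
    and \<phi> :: "real \<Rightarrow> 'm \<Rightarrow> real"
    and \<Lambda> :: "real \<Rightarrow> real"
  assumes "smooth_structure A"
    and "orientation A Or"
    and "riemannian_metric A g"
    and "bounded_regular_domain A \<Omega>"
    and "open I" and "is_interval I" and "0 \<in> I"
    and "deformation A I \<Omega> f"
    and "\<And>\<epsilon>. \<epsilon> \<in> I \<Longrightarrow> smooth_fun_on A (closure (f \<epsilon> ` \<Omega>)) (\<phi> \<epsilon>)"
    and "differentiable_curve A I \<Omega> (\<lambda>\<epsilon>. \<phi> \<epsilon> \<circ> f \<epsilon>)"
    and "\<And>\<epsilon>. \<epsilon> \<in> I \<Longrightarrow> \<Lambda> differentiable (at \<epsilon>)"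
    and "\<And>\<epsilon>. \<epsilon> \<in> I \<Longrightarrow> L2_norm_on (riemannian_volume A g) (f \<epsilon> ` \<Omega>) (\<phi> \<epsilon>) = 1"
    and "\<And>\<epsilon> p c. \<epsilon> \<in> I \<Longrightarrow> p \<in> f \<epsilon> ` \<Omega> \<Longrightarrow> c \<in> A \<Longrightarrow> p \<in> cdom c \<Longrightarrow>
           laplacian g c (\<phi> \<epsilon>) p = \<Lambda> \<epsilon> * \<phi> \<epsilon> p"
    and "\<And>\<epsilon> p. \<epsilon> \<in> I \<Longrightarrow> p \<in> frontier (f \<epsilon> ` \<Omega>) \<Longrightarrow> \<phi> \<epsilon> p = 0"
  shows "(\<Lambda> has_real_derivative
           - (LINT p:frontier \<Omega>|boundary_volume A g \<Omega>.
                normal_velocity A g \<Omega> f p * (normal_derivative A g \<Omega> (\<phi> 0) p)\<^sup>2)) (at 0)"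
proof -
  interpret eigenvalue_deformation A g \<Omega> I f \<phi> \<Lambda>
    by unfold_locales (fact assms | rule assms(11)[OF assms(7)])+
  \<comment> \<open>The normalisation at parameter 0, where the deformed domain is \<Omega>
    itself.\<close>
  have "(LINT p:\<Omega>|vol. (\<phi> 0 p)\<^sup>2) = 1"
    using assms(12)[OF zero_I] unfolding f_zero_image L2_norm_on_def by simp
  then show ?thesis using \<Lambda>_has_derivative \<Lambda>'_boundary_integral by simp
qed

end
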